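(* Let $A,B$ be commuting sectorial operators on a complex Banach space $X$ such that $A$ admits an $H^\infty(\Sigma_\sigma)$-calculus and $\omega(B)<\sigma'$. Let $f\in H^\infty(\Sigma_\rho\times\Sigma_{\sigma'})$, where $\sigma<\rho<\pi$, be such that $f(w,\cdot)\in\mathcal H(B)$ for every $w\in\Sigma_\rho$, and suppose the set $\{f(w,B):w\in\Sigma_\rho\}$ is U-bounded. Then $f\in\mathcal H(A,B)$, i.e. $f(A,B)$ is a bounded operator.
   Context: $\Sigma_\sigma=\{z\ne0:|\arg z|<\sigma\}$. A closed densely defined operator $A$ is sectorial of type $\omega\in[0,\pi)$ if injective with dense range, $R(\lambda,A)$ exists for $|\arg\lambda|>\omega$ and $\sup_{|\arg\lambda|\ge\sigma}\|\lambda R(\lambda,A)\|<\infty$ for all $\sigma\in(\omega,\pi)$; $\omega(A)$ is the infimum of such $\omega$. $A,B$ commute if their resolvents commute. For scalar $g$ with $|g(z)|\le C(|z|/(1+|z|^2))^\epsilon$ on $\Sigma_\sigma$, $\sigma>\omega(A)$, $g(A)=\frac1{2\pi i}\int_{\partial\Sigma_\nu}g(\lambda)R(\lambda,A)d\lambda$ ($\omega(A)<\nu<\sigma$, oriented from $\infty e^{i\nu}$ through $0$ to $\infty e^{-i\nu}$); $A$ admits an $H^\infty(\Sigma_\sigma)$-calculus if $\|g(A)\|\le C\sup_{\Sigma_\sigma}|g|$ for all such $g$. Let $\varphi_n(z)=\frac n{n+z}-\frac1{1+nz}$. For $g\in H^\infty(\Sigma_{\sigma'})$ (bounded analytic), $g\in\mathcal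 H(B)$ means $\sup_n\|(\varphi_ng)(B)\|<\infty$, and then $g(B)$ is the strong limit of $(\varphi_ng)(B)$. For $f\in H^\infty(\Sigma_\rho\times\Sigma_{\sigma'})$ (bounded analytic in both variables), with $\psi_n(w,z)=\varphi_n(w)\varphi_n(z)$, $(\psi_nf)(A,B)=\big(\frac1{2\pi i}\big)^2\int_{\partial\Sigma_\nu}\int_{\partial\Sigma_{\nu'}}\psi_n(\lambda,\mu)f(\lambda,\mu)R(\lambda,A)R(\mu,B)\,d\mu\,d\lambda$ ($\omega(A)<\nu<\rho$, $\omega(B)<\nu'<\sigma'$); $f\in\mathcal H(A,B)$ means $\sup_n\|(\psi_nf)(A,B)\|<\infty$, and then $f(A,B)$ is the strong limit of $(\psi_nf)(A,B)$. A family $\mathcal F\subset\mathcal L(X)$ is U-bounded if there is $C$ with $\sum_{k=1}^n|\langle T_kx_k,x_k^*\rangle|\le C\max_{\epsilon_k=\pm1}\|\sum\epsilon_kx_k\|\max_{\epsilon_k=\pm1}\|\sum\epsilon_kx_k^*\|$ for all $n$, $x_k\in X$, $x_k^*\in X^*$, $T_k\in\mathcal F$. *)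

theory Defs
  imports "HOL-Analysis.Analysis"
begin

class complex_banach = banach +
  fixes scaleC :: "complex \<Rightarrow> 'a \<Rightarrow> 'a" (infixr "*\<^sub>C" 75)
  assumes scaleC_add_right: "scaleC a (x + y) = scaleC a x + scaleC a y"
    and scaleC_add_left: "scaleC (a + b) x = scaleC a x + scaleC b x"
    and scaleC_scaleC: "scaleC a (scaleC b x) = scaleC (a * b) x"
    and scaleC_one: "scaleC 1 x = x"
    and scaleR_scaleC: "scaleR r x = scaleC (complex_of_real r) x"
    and norm_scaleC: "norm (scaleC a x) = cmod a * norm x"

instantiation complex :: complex_banach
begin
definition scaleC_complex :: "complex \<Rightarrow> complex \<Rightarrow> complex" where
  "scaleC_complex a x = a * x"
instance
  by standard (auto simp: scaleC_complex_def algebra_simps norm_mult scaleR_conv_of_real)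
end

definition clinear_on :: "'a::complex_banach set \<Rightarrow> ('a \<Rightarrow> 'a) \<Rightarrow> bool" where
  "clinear_on D A \<longleftrightarrow> 0 \<in> D \<and>
     (\<forall>x\<in>D. \<forall>y\<in>D. x + y \<in> D \<and> A (x + y) = A x + A y) \<and>
     (\<forall>c. \<forall>x\<in>D. c *\<^sub>C x \<in> D \<and> A (c *\<^sub>C x) = c *\<^sub>C A x)"

definition closed_operator :: "'a::complex_banach set \<Rightarrow> ('a \<Rightarrow> 'a) \<Rightarrow> bool" where
  "closed_operator D A \<longleftrightarrow> clinear_on D A \<and> closed {(x, A x) | x. x \<in> D}"

definition densely_defined :: "'a::complex_banach set \<Rightarrow> bool" where
  "densely_defined D \<longleftrightarrow> closure D = UNIV"

definition bounded_clinear_op :: "('a::complex_banach \<Rightarrow> 'b::complex_banach) \<Rightarrow> bool" where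
  "bounded_clinear_op T \<longleftrightarrow> bounded_linear T \<and> (\<forall>c x. T (c *\<^sub>C x) = c *\<^sub>C T x)"

definition is_resolvent :: "'a::complex_banach set \<Rightarrow> ('a \<Rightarrow> 'a) \<Rightarrow> complex \<Rightarrow> ('a \<Rightarrow> 'a) \<Rightarrow> bool" where
  "is_resolvent D A lam R \<longleftrightarrow> bounded_clinear_op R \<and>
     (\<forall>x. R x \<in> D \<and> lam *\<^sub>C R x - A (R x) = x) \<and>
     (\<forall>x\<in>D. R (lam *\<^sub>C x - A x) = x)"

definition in_resolvent_set :: "'a::complex_banach set \<Rightarrow> ('a \<Rightarrow> 'a) \<Rightarrow> complex \<Rightarrow> bool" where
  "in_resolvent_set D A lam \<longleftrightarrow> (\<exists>R. is_resolvent D A lam R)"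

definition resolvent :: "'a::complex_banach set \<Rightarrow> ('a \<Rightarrow> 'a) \<Rightarrow> complex \<Rightarrow> 'a \<Rightarrow> 'a" where
  "resolvent D A lam = (THE R. is_resolvent D A lam R)"

definition sector :: "real \<Rightarrow> complex set" where
  "sector s = {z. z \<noteq> 0 \<and> \<bar>Arg z\<bar> < s}"

definition sectorial_of_type :: "'a::complex_banach set \<Rightarrow> ('a \<Rightarrow> 'a) \<Rightarrow> real \<Rightarrow> bool" where
  "sectorial_of_type D A w \<longleftrightarrow> 0 \<le> w \<and> w < pi \<and>
     closed_operator D A \<and> densely_defined D \<and> inj_on A D \<and> closure (A ` D) = UNIV \<and>
     (\<forall>lam. lam \<noteq> 0 \<and> \<bar>Arg lam\<bar> > w \<longrightarrow> in_resolvent_set D A lam) \<and>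
     (\<forall>s. w < s \<and> s < pi \<longrightarrow>
        (\<exists>C. \<forall>lam. lam \<noteq> 0 \<and> \<bar>Arg lam\<bar> \<ge> s \<longrightarrow>
            (\<forall>x. norm (lam *\<^sub>C resolvent D A lam x) \<le> C * norm x)))"

definition sectorial :: "'a::complex_banach set \<Rightarrow> ('a \<Rightarrow> 'a) \<Rightarrow> bool" where
  "sectorial D A \<longleftrightarrow> (\<exists>w. sectorial_of_type D A w)"

definition sect_angle :: "'a::complex_banach set \<Rightarrow> ('a \<Rightarrow> 'a) \<Rightarrow> real" where
  "sect_angle D A = Inf {w. sectorial_of_type D A w}"

definition commuting :: "'a::complex_banach set \<Rightarrow> ('a \<Rightarrow> 'a) \<Rightarrow> 'a set \<Rightarrow> ('a \<Rightarrow> 'a) \<Rightarrow> bool" where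
  "commuting DA A DB B \<longleftrightarrow>
     (\<forall>lam mu. in_resolvent_set DA A lam \<and> in_resolvent_set DB B mu \<longrightarrow>
        resolvent DA A lam \<circ> resolvent DB B mu = resolvent DB B mu \<circ> resolvent DA A lam)"

text \<open>Parametrisation of \<partial>\<Sigma>_\<nu>, from \<infinity>e^{i\<nu>} through 0 to \<infinity>e^{-i\<nu>},
  and its derivative.\<close>
definition bpath :: "real \<Rightarrow> real \<Rightarrow> complex" where
  "bpath nu t = (if t < 0 then complex_of_real (- t) * cis nu else complex_of_real t * cis (- nu))"

definition bpath' :: "real \<Rightarrow> real \<Rightarrow> complex" where
  "bpath' nu t = (if t < 0 then - cis nu else cis (- nu))"

definition fc_int :: "'a::complex_banach set \<Rightarrow> ('a \<Rightarrow> 'a) \<Rightarrow> real \<Rightarrow> (complex \<Rightarrow> complex) \<Rightarrow> 'a \<Rightarrow> 'a" where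
  "fc_int D A nu g x = (1 / (2 * pi * \<i>)) *\<^sub>C
     integral UNIV (\<lambda>t. (g (bpath nu t) * bpath' nu t) *\<^sub>C resolvent D A (bpath nu t) x)"

text \<open>Canonical choice of the contour angle \<nu> strictly between \<omega>(A) and s.\<close>
definition mid_angle :: "real \<Rightarrow> real \<Rightarrow> real" where
  "mid_angle w s = (w + min s pi) / 2"

definition fc :: "'a::complex_banach set \<Rightarrow> ('a \<Rightarrow> 'a) \<Rightarrow> real \<Rightarrow> (complex \<Rightarrow> complex) \<Rightarrow> 'a \<Rightarrow> 'a" where
  "fc D A s g = fc_int D A (mid_angle (sect_angle D A) s) g"

definition decaying :: "real \<Rightarrow> (complex \<Rightarrow> complex) \<Rightarrow> bool" where
  "decaying s g \<longleftrightarrow> g holomorphic_on sector s \<and>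
     (\<exists>C e. e > 0 \<and> (\<forall>z\<in>sector s. cmod (g z) \<le> C * (cmod z / (1 + cmod z ^ 2)) powr e))"

definition Hinf_calculus :: "'a::complex_banach set \<Rightarrow> ('a \<Rightarrow> 'a) \<Rightarrow> real \<Rightarrow> bool" where
  "Hinf_calculus D A s \<longleftrightarrow> sect_angle D A < s \<and>
     (\<exists>C. \<forall>g. decaying s g \<longrightarrow>
        (\<forall>x. norm (fc D A s g x) \<le> C * (SUP z\<in>sector s. cmod (g z)) * norm x))"

definition Hinf :: "real \<Rightarrow> (complex \<Rightarrow> complex) \<Rightarrow> bool" where
  "Hinf s g \<longleftrightarrow> g holomorphic_on sector s \<and> bounded (g ` sector s)"

definition Hinf2 :: "real \<Rightarrow> real \<Rightarrow> (complex \<Rightarrow> complex \<Rightarrow> complex) \<Rightarrow> bool" where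
  "Hinf2 r s f \<longleftrightarrow> (\<forall>w\<in>sector r. f w holomorphic_on sector s) \<and>
     (\<forall>z\<in>sector s. (\<lambda>w. f w z) holomorphic_on sector r) \<and>
     (\<exists>M. \<forall>w\<in>sector r. \<forall>z\<in>sector s. cmod (f w z) \<le> M)"

definition phi :: "nat \<Rightarrow> complex \<Rightarrow> complex" where
  "phi n z = of_nat n / (of_nat n + z) - 1 / (1 + of_nat n * z)"

definition in_H :: "'a::complex_banach set \<Rightarrow> ('a \<Rightarrow> 'a) \<Rightarrow> real \<Rightarrow> (complex \<Rightarrow> complex) \<Rightarrow> bool" where
  "in_H D B s g \<longleftrightarrow> Hinf s g \<and>
     (\<exists>C. \<forall>n\<ge>1. \<forall>x. norm (fc D B s (\<lambda>z. phi n z * g z) x) \<le> C * norm x)"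

definition fcH :: "'a::complex_banach set \<Rightarrow> ('a \<Rightarrow> 'a) \<Rightarrow> real \<Rightarrow> (complex \<Rightarrow> complex) \<Rightarrow> 'a \<Rightarrow> 'a" where
  "fcH D B s g x = lim (\<lambda>n. fc D B s (\<lambda>z. phi n z * g z) x)"

definition fc2_int :: "'a::complex_banach set \<Rightarrow> ('a \<Rightarrow> 'a) \<Rightarrow> 'a set \<Rightarrow> ('a \<Rightarrow> 'a) \<Rightarrow> real \<Rightarrow> real
    \<Rightarrow> (complex \<Rightarrow> complex \<Rightarrow> complex) \<Rightarrow> 'a \<Rightarrow> 'a" where
  "fc2_int DA A DB B nu nu' F x = ((1 / (2 * pi * \<i>)) ^ 2) *\<^sub>C
     integral UNIV (\<lambda>s. integral UNIV (\<lambda>t.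
        (F (bpath nu s) (bpath nu' t) * bpath' nu s * bpath' nu' t) *\<^sub>C
          resolvent DA A (bpath nu s) (resolvent DB B (bpath nu' t) x)))"

definition fc2 :: "'a::complex_banach set \<Rightarrow> ('a \<Rightarrow> 'a) \<Rightarrow> 'a set \<Rightarrow> ('a \<Rightarrow> 'a) \<Rightarrow> real \<Rightarrow> real
    \<Rightarrow> (complex \<Rightarrow> complex \<Rightarrow> complex) \<Rightarrow> 'a \<Rightarrow> 'a" where
  "fc2 DA A DB B r s F = fc2_int DA A DB B
     (mid_angle (sect_angle DA A) r) (mid_angle (sect_angle DB B) s) F"

definition in_H2 :: "'a::complex_banach set \<Rightarrow> ('a \<Rightarrow> 'a) \<Rightarrow> 'a set \<Rightarrow> ('a \<Rightarrow> 'a) \<Rightarrow> real \<Rightarrow> real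
    \<Rightarrow> (complex \<Rightarrow> complex \<Rightarrow> complex) \<Rightarrow> bool" where
  "in_H2 DA A DB B r s f \<longleftrightarrow> Hinf2 r s f \<and>
     (\<exists>C. \<forall>n\<ge>1. \<forall>x. norm (fc2 DA A DB B r s (\<lambda>w z. phi n w * phi n z * f w z) x) \<le> C * norm x)"

definition dual_elem :: "('a::complex_banach \<Rightarrow> complex) \<Rightarrow> bool" where
  "dual_elem l \<longleftrightarrow> (\<forall>x y. l (x + y) = l x + l y) \<and> (\<forall>c x. l (c *\<^sub>C x) = c * l x) \<and>
     (\<exists>K. \<forall>x. cmod (l x) \<le> K * norm x)"

definition U_bounded :: "('a::complex_banach \<Rightarrow> 'a) set \<Rightarrow> bool" where
  "U_bounded F \<longleftrightarrow> (\<exists>C. \<forall>(n::nat) (x::nat \<Rightarrow> 'a) (l::nat \<Rightarrow> 'a \<Rightarrow> complex) (T::nat \<Rightarrow> 'a \<Rightarrow> 'a).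
     (\<forall>k<n. T k \<in> F) \<longrightarrow> (\<forall>k<n. dual_elem (l k)) \<longrightarrow>
     (\<Sum>k<n. cmod (l k (T k (x k)))) \<le>
       C * (SUP e::nat \<Rightarrow> bool. norm (\<Sum>k<n. if e k then x k else - x k))
         * (SUP e::nat \<Rightarrow> bool. onorm (\<lambda>y. \<Sum>k<n. if e k then l k y else - l k y)))"

end

theory Submission
  imports Defs "HOL-Complex_Analysis.Complex_Analysis"
begin

text \<open>Write \<open>F n w = (\<phi>\<^sub>n f(w, \<cdot>))(B) = \<phi>\<^sub>n(B) f(w, B)\<close>, so that \<open>(\<psi>\<^sub>n f)(A, B)\<close> is the contour
  integral of \<open>\<phi>\<^sub>n(\<lambda>) R(\<lambda>, A) F n \<lambda>\<close>, and move the contour to an angle \<open>\<theta>\<close> strictly between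
  \<open>\<sigma>\<close> and \<open>\<rho>\<close>. A dyadic partition of unity \<open>1 = \<Sum>\<^sub>k g(2\<^sup>k z)\<close> with \<open>g = h\<^sup>2 g\<^sub>0\<close>, where
  \<open>h(z) = z / (1 + z)\<^sup>2\<close> and \<open>g\<^sub>0\<close> is rational and decays at \<open>0\<close> and \<open>\<infinity>\<close>, is inserted into the integral.
  Both factors \<open>h(2\<^sup>kA)\<close> are pulled out; after the substitution \<open>\<lambda> = 2\<^bsup>-k\<^esup> \<mu>\<close> one has to bound,
  uniformly in \<open>\<mu>\<close> on the contour, the sums
  \<open>\<Sum>\<^sub>k |\<langle>f(\<lambda>, B) h(2\<^sup>kA) \<lambda> R(\<lambda>, A) x, \<phi>\<^sub>n(B)\<^sup>* h(2\<^sup>kA)\<^sup>* x\<^sup>*\<rangle>|\<close>. U-boundedness reduces this to the unconditional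
  bounds \<open>\<parallel>\<Sum> \<epsilon>\<^sub>k h(2\<^sup>kA)\<parallel> \<le> C\<close> and \<open>\<parallel>\<Sum> \<epsilon>\<^sub>k \<lambda> R(\<lambda>, A) h(2\<^sup>kA)\<parallel> \<le> C\<close>, which follow from the
  \<open>H\<^sup>\<infinity>\<close> calculus of \<open>A\<close> because \<open>\<Sum>\<^sub>k |h(2\<^sup>k z)|\<close> is bounded on \<open>\<Sigma>\<^sub>\<sigma>\<close>. All operators inserted are polynomials
  in resolvents, so the calculus is only multiplied by resolvents, which needs no second contour.\<close>

subsection \<open>Norming functionals\<close>

text \<open>Each dyadic piece has three factors because there are three duties. One
  \<open>hfun\<close> makes the sum over scales unconditional on the side of \<open>x\<close>, one
  does so on the side of the functional, and \<open>bump\<close> stays under the integral sign,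
  where its decay makes the integral over the contour converge uniformly in the scale. The angle
  must exceed \<sigma> because \<lambda> R(\<lambda>, A) enters the calculus as the function
  \<lambda> / (\<lambda> - z), which is bounded on the sector of \<sigma> only when \<lambda> keeps
  an angular distance from it. The operator f(w, B) is a mere strong limit; its product with the
  regularizer in B is a contour integral, hence linear, bounded and analytic in w, and the
  regularizer is therefore kept in front of it. Identities and bounds for vector-valued integrals
  are tested against functionals, so that Cauchy's theorem and dominated convergence are applied to
  complex functions only; this is the purpose of the norming functionals. Cauchy's theorem takes the
  form of turning both rays of the contour, down to angle 0 or up to angle pi, where they
  cancel.\<close>

definition sublin :: "('a::real_vector \<Rightarrow> real) \<Rightarrow> bool" where
  "sublin q \<longleftrightarrow> (\<forall>x y. q (x + y) \<le> q x + q y) \<and> (\<forall>t>0. \<forall>x. q (t *\<^sub>R x) = t * q x)"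

lemma sublinD:
  assumes "sublin q"
  shows "q (x + y) \<le> q x + q y" "t > 0 \<Longrightarrow> q (t *\<^sub>R x) = t * q x" "q 0 = 0" "- q (- x) \<le> q x"
proof -
  show 1: "q (x + y) \<le> q x + q y" for x y using assms by (auto simp: sublin_def)
  show 2: "t > 0 \<Longrightarrow> q (t *\<^sub>R x) = t * q x" for t x using assms by (auto simp: sublin_def)
  show 3: "q 0 = 0" using 2[of 2 0] by simp
  show "- q (- x) \<le> q x" using 1[of x "- x"] 3 by simp
qed

text \<open>The auxiliary functional of the Hahn-Banach argument: \<open>t = 0\<close> shows that it
  lies below \<open>q\<close>, and \<open>t = 1\<close> gives at most \<open>- q y\<close> at the
  point \<open>- y\<close>. A linear functional below it is therefore forced to be large at
  \<open>y\<close>.\<close>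

definition lower_along :: "('a::real_vector \<Rightarrow> real) \<Rightarrow> 'a \<Rightarrow> 'a \<Rightarrow> real" where
  "lower_along q y x = (INF t\<in>{0..}. q (x + t *\<^sub>R y) - t * q y)"

lemma lower_along_le:
  assumes "sublin q" "t \<ge> 0"
  shows "lower_along q y x \<le> q (x + t *\<^sub>R y) - t * q y"
  unfolding lower_along_def
proof (rule cINF_lower)
  show "bdd_below ((\<lambda>t. q (x + t *\<^sub>R y) - t * q y) ` {0..})"
  proof (rule bdd_belowI2)
    fix t :: real assume "t \<in> {0..}"
    then have "t = 0 \<or> t > 0" by auto
    then show "- q (- x) \<le> q (x + t *\<^sub>R y) - t * q y"
      using sublinD(1)[OF assms(1), of "x + t *\<^sub>R y" "- x"] sublinD(2)[OF assms(1), of t y]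
        sublinD(4)[OF assms(1), of x] by auto
  qed
qed (use assms in auto)

lemma lower_along_greatest:
  assumes "\<And>t. t \<ge> 0 \<Longrightarrow> c \<le> q (x + t *\<^sub>R y) - t * q y"
  shows "c \<le> lower_along q y x"
  unfolding lower_along_def by (rule cINF_greatest) (use assms in auto)

lemma sublin_lower_along:
  assumes q: "sublin q"
  shows "sublin (lower_along q y)"
  unfolding sublin_def
proof (intro conjI allI impI)
  fix a b
  have "lower_along q y (a + b) - (q (b + u *\<^sub>R y) - u * q y) \<le> q (a + t *\<^sub>R y) - t * q y"
    if "t \<ge> 0" "u \<ge> 0" for t u
  proof -
    have "lower_along q y (a + b) \<le> q ((a + b) + (t + u) *\<^sub>R y) - (t + u) * q y"
      by (rule lower_along_le[OF q]) (use that in auto)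
    also have "(a + b) + (t + u) *\<^sub>R y = (a + t *\<^sub>R y) + (b + u *\<^sub>R y)"
      by (simp add: algebra_simps)
    finally show ?thesis
      using sublinD(1)[OF q, of "a + t *\<^sub>R y" "b + u *\<^sub>R y"] by (simp add: algebra_simps)
  qed
  then have "lower_along q y (a + b) - (q (b + u *\<^sub>R y) - u * q y) \<le> lower_along q y a"
    if "u \<ge> 0" for u using that by (intro lower_along_greatest) auto
  then have "lower_along q y (a + b) - lower_along q y a \<le> lower_along q y b"
    by (intro lower_along_greatest) (simp add: algebra_simps)
  then show "lower_along q y (a + b) \<le> lower_along q y a + lower_along q y b" by simp
next
  fix s :: real and a
  have *: "lower_along q y (s *\<^sub>R a) \<le> s * lower_along q y a" if "s > 0" for s a
  proof -
    have "lower_along q y (s *\<^sub>R a) / s \<le> lower_along q y a"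
    proof (rule lower_along_greatest)
      fix t :: real assume "t \<ge> 0"
      then have "lower_along q y (s *\<^sub>R a) \<le> q (s *\<^sub>R a + (s * t) *\<^sub>R y) - (s * t) * q y"
        using that by (intro lower_along_le[OF q]) auto
      also have "s *\<^sub>R a + (s * t) *\<^sub>R y = s *\<^sub>R (a + t *\<^sub>R y)" by (simp add: algebra_simps)
      also have "q \<dots> = s * q (a + t *\<^sub>R y)" using that by (rule sublinD(2)[OF q])
      finally show "lower_along q y (s *\<^sub>R a) / s \<le> q (a + t *\<^sub>R y) - t * q y"
        using that by (simp add: field_simps)
    qed
    then show ?thesis using that by (simp add: field_simps)
  qed
  assume "0 < s"
  then show "lower_along q y (s *\<^sub>R a) = s * lower_along q y a"
    using *[of s a] *[of "inverse s" "s *\<^sub>R a"] by (intro antisym) (auto simp: field_simps)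
qed

text \<open>A minimal sublinear functional below \<open>p\<close> cannot be lowered along any direction, which forces
  it to be odd and hence linear.\<close>

lemma sublin_dominates_linear:
  assumes p: "sublin (p :: 'a::real_vector \<Rightarrow> real)"
  obtains l where "linear l" "\<And>x. l x \<le> p x"
proof -
  define Q where "Q = {q :: 'a \<Rightarrow> real. sublin q \<and> (\<forall>x. q x \<le> p x)}"
  define P where "P = (\<lambda>q q' :: 'a \<Rightarrow> real. \<forall>x. q' x \<le> q x)"
  have "\<exists>m\<in>Q. \<forall>a\<in>Q. P m a \<longrightarrow> a = m"
  proof (rule predicate_Zorn)
    show "partial_order_on Q (relation_of P Q)"
    proof (rule partial_order_on_relation_ofI)
      show "P a c" if "P a b" "P b c" for a b c
        using that unfolding P_def by (blast intro: order_trans)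
      show "a = b" if "P a b" "P b a" for a b
        using that unfolding P_def by (intro ext antisym) auto
    qed (auto simp: P_def)
    fix C assume C: "C \<in> Chains (relation_of P Q)"
    then have CQ: "C \<subseteq> Q" by (auto simp: Chains_def relation_of_def)
    show "\<exists>u\<in>Q. \<forall>a\<in>C. P a u"
    proof (cases "C = {}")
      case True then show ?thesis using p by (auto simp: Q_def intro!: exI[of _ p])
    next
      case False
      define u where "u = (\<lambda>x. INF q\<in>C. q x)"
      have le: "u x \<le> q x" if "q \<in> C" for q x
        unfolding u_def
      proof (rule cINF_lower[OF bdd_belowI2])
        fix r assume "r \<in> C"
        then have "sublin r" "r (- x) \<le> p (- x)" using CQ by (auto simp: Q_def)
        then show "- p (- x) \<le> r x" using sublinD(4)[of r x] by linarith
      qed fact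
      have ge: "c \<le> u x" if "\<And>q. q \<in> C \<Longrightarrow> c \<le> q x" for c x
        unfolding u_def by (rule cINF_greatest[OF False]) (use that in auto)
      have sl: "sublin q" if "q \<in> C" for q using CQ that by (auto simp: Q_def)
      have "u (x + y) \<le> u x + u y" for x y
      proof -
        \<comment> \<open>The infima at \<open>x\<close> and at \<open>y\<close> may be approached
          by different members of the chain; comparability lets the smaller of \<open>q\<close> and
          \<open>r\<close> serve at both points.\<close>
        have "u (x + y) - r y \<le> q x" if "q \<in> C" "r \<in> C" for q r
        proof -
          from C that have "P q r \<or> P r q" by (auto simp: Chains_def relation_of_def)
          then have "r x \<le> q x \<or> q y \<le> r y" by (auto simp: P_def)
          then show ?thesis
            using le[OF that(1), of "x + y"] le[OF that(2), of "x + y"]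
              sublinD(1)[OF sl[OF that(1)], of x y] sublinD(1)[OF sl[OF that(2)], of x y]
            by linarith
        qed
        then have "u (x + y) - r y \<le> u x" if "r \<in> C" for r using that by (intro ge) auto
        then have "u (x + y) - u x \<le> u y" by (intro ge) (simp add: algebra_simps)
        then show ?thesis by simp
      qed
      moreover have "u (t *\<^sub>R x) = t * u x" if "t > 0" for t x
      proof (rule antisym)
        have "u (t *\<^sub>R x) / t \<le> q x" if "q \<in> C" for q
          using le[OF that, of "t *\<^sub>R x"] sublinD(2)[OF sl[OF that] \<open>t > 0\<close>, of x] \<open>t > 0\<close>
          by (simp add: field_simps)
        then have "u (t *\<^sub>R x) / t \<le> u x" by (rule ge)
        then show "u (t *\<^sub>R x) \<le> t * u x" using that by (simp add: field_simps)
        have "t * u x \<le> q (t *\<^sub>R x)" if "q \<in> C" for q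
          using le[OF that, of x] sublinD(2)[OF sl[OF that] \<open>t > 0\<close>, of x] \<open>t > 0\<close> by simp
        then show "t * u x \<le> u (t *\<^sub>R x)" by (rule ge)
      qed
      ultimately have "sublin u" by (auto simp: sublin_def)
      moreover have "u x \<le> p x" for x
      proof -
        obtain q where q: "q \<in> C" using False by auto
        then have "q x \<le> p x" using CQ by (auto simp: Q_def)
        then show ?thesis using le[OF q, of x] by simp
      qed
      ultimately show ?thesis using le by (auto simp: Q_def P_def)
    qed
  qed
  then obtain m where mQ: "m \<in> Q" and min: "\<And>a. a \<in> Q \<Longrightarrow> P m a \<Longrightarrow> a = m" by auto
  have m: "sublin m" "\<And>x. m x \<le> p x" using mQ by (auto simp: Q_def)
  have odd: "m (- y) = - m y" for y
  proof -
    have le: "lower_along m y x \<le> m x" for x using lower_along_le[OF m(1), of 0 y x] by simp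
    then have "lower_along m y = m"
      using sublin_lower_along[OF m(1), of y] m(2)
      by (intro min) (auto simp: Q_def P_def intro: order_trans[OF le])
    then have "m (- y) \<le> - m y"
      using lower_along_le[OF m(1), of 1 y "- y"] sublinD(3)[OF m(1)] by simp
    then show ?thesis using sublinD(4)[OF m(1), of y] by simp
  qed
  have "linear m"
  proof (rule linearI)
    show "m (x + y) = m x + m y" for x y
      using sublinD(1)[OF m(1), of x y] sublinD(1)[OF m(1), of "x + y" "- y"] odd[of y] by simp
    show "m (r *\<^sub>R x) = r *\<^sub>R m x" for r x
    proof (cases r "0 :: real" rule: linorder_cases)
      case less
      then show ?thesis using sublinD(2)[OF m(1), of "- r" x] odd[of "r *\<^sub>R x"] by simp
    qed (use sublinD[OF m(1)] in auto)
  qed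
  then show ?thesis using m(2) that by blast
qed

text \<open>A linear functional is taken below \<open>lower_along norm y\<close> instead of below
  \<open>norm\<close>: its value at \<open>- y\<close> is then at most \<open>- norm y\<close>,
  which turns mere domination by the norm into equality at \<open>y\<close>.\<close>

lemma exists_norming_real:
  fixes y :: "'a::real_normed_vector"
  obtains l where "linear l" "l y = norm y" "\<And>x. \<bar>l x\<bar> \<le> norm x"
proof -
  have n: "sublin (norm :: 'a \<Rightarrow> real)" by (auto simp: sublin_def norm_triangle_ineq)
  obtain l where l: "linear l" "\<And>x. l x \<le> lower_along norm y x"
    using sublin_dominates_linear[OF sublin_lower_along[OF n]] by metis
  have le: "l x \<le> norm x" for x
    using l(2)[of x] lower_along_le[OF n, of 0 y x] by simp
  have "l (- y) \<le> - norm y"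
    using l(2)[of "- y"] lower_along_le[OF n, of 1 y "- y"] by simp
  then have "l y = norm y" using le[of y] l(1) by (simp add: linear_neg)
  moreover have "\<bar>l x\<bar> \<le> norm x" for x
    using le[of x] le[of "- x"] l(1) by (simp add: linear_neg abs_le_iff)
  ultimately show ?thesis using l(1) that by blast
qed

section \<open>Complex scalars and the dual space\<close>

interpretation scaleC: vector_space "scaleC :: complex \<Rightarrow> 'a \<Rightarrow> 'a::complex_banach"
  by standard (auto simp: scaleC_add_right scaleC_add_left scaleC_scaleC scaleC_one)

lemma bounded_bilinear_scaleC:
  "bounded_bilinear (scaleC :: complex \<Rightarrow> 'a \<Rightarrow> 'a::complex_banach)"
proof
  show "\<exists>K. \<forall>a (b::'a). norm (a *\<^sub>C b) \<le> norm a * norm b * K"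
    by (rule exI[of _ 1]) (simp add: norm_scaleC)
qed (simp_all add: scaleC_add_right scaleC_add_left scaleC_scaleC scaleR_scaleC[where 'a='a]
    scaleR_conv_of_real mult.commute)

interpretation scaleC: bounded_bilinear "scaleC :: complex \<Rightarrow> 'a \<Rightarrow> 'a::complex_banach"
  by (rule bounded_bilinear_scaleC)

lemma dual_elemD:
  assumes "dual_elem l"
  shows "l (x + y) = l x + l y" "l (c *\<^sub>C x) = c * l x" "l 0 = 0" "l (- x) = - l x"
    "l (x - y) = l x - l y" "bounded_linear l"
proof -
  show 1: "l (x + y) = l x + l y" and 2: "l (c *\<^sub>C x) = c * l x" for x y c
    using assms by (auto simp: dual_elem_def)
  show 0: "l 0 = 0" using 2[of 0 0] by simp
  show 3: "l (- x) = - l x" for x using 1[of x "- x"] 0 by (simp add: eq_neg_iff_add_eq_0 add.commute)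
  show "l (x - y) = l x - l y" using 1[of x "- y"] 3 by simp
  obtain K where K: "\<And>x. cmod (l x) \<le> K * norm x" using assms by (auto simp: dual_elem_def)
  show "bounded_linear l"
  proof (rule bounded_linear_intro)
    show "l (r *\<^sub>R x) = r *\<^sub>R l x" for r x
      by (simp only: scaleR_scaleC 2 scaleC_complex_def)
    show "norm (l x) \<le> norm x * K" for x using K[of x] by (simp add: mult.commute)
  qed (rule 1)
qed

text \<open>A real norming functional \<open>u\<close> is complexified as
  \<open>u x - i u (i x)\<close>. Multiplying \<open>x\<close> by the phase that makes the value
  real and nonnegative reduces the complex bound to the real one; at \<open>y\<close> the real part
  already exhausts the norm, so no imaginary part is left.\<close>

lemma dual_elem_norming:
  fixes y :: "'a::complex_banach"
  obtains l where "dual_elem l" "l y = norm y" "\<And>x. cmod (l x) \<le> norm x"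
proof -
  obtain u where u: "linear u" "u y = norm y" "\<And>x. \<bar>u x\<bar> \<le> norm x"
    using exists_norming_real by metis
  have ua: "u (a + b) = u a + u b" and us: "u (r *\<^sub>R a) = r * u a" for a b r
    using u(1) by (auto simp: linear_add linear_scale)
  define l where "l = (\<lambda>x. Complex (u x) (- u (\<i> *\<^sub>C x)))"
  have add: "l (a + b) = l a + l b" for a b
    by (simp add: l_def ua scaleC_add_right complex_eq_iff)
  have sc: "u (c *\<^sub>C x) = Re c * u x + Im c * u (\<i> *\<^sub>C x)" for c x
  proof -
    have "c *\<^sub>C x = (Re c) *\<^sub>R x + (Im c) *\<^sub>R (\<i> *\<^sub>C x)"
      by (simp add: scaleR_scaleC scaleC_scaleC flip: scaleC_add_left)
        (simp add: complex_eq mult.commute)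
    then show ?thesis by (simp only: ua us)
  qed
  have mul: "l (c *\<^sub>C x) = c * l x" for c x
    using sc[of c x] sc[of "\<i> * c" x] by (simp add: l_def complex_eq_iff scaleC_scaleC)
  have le: "cmod (l x) \<le> norm x" for x
  proof (cases "l x = 0")
    case False
    define c where "c = cnj (l x) / cmod (l x)"
    have c: "cmod c = 1" "c * l x = cmod (l x)"
      using False by (auto simp: c_def norm_divide complex_norm_square[symmetric] power2_eq_square
          mult.commute)
    have "cmod (l x) = Re (l (c *\<^sub>C x))" using c by (simp add: mul)
    also have "\<dots> \<le> norm (c *\<^sub>C x)" using u(3)[of "c *\<^sub>C x"] by (simp add: l_def)
    finally show ?thesis by (simp add: norm_scaleC c)
  qed simp
  have "Re (l y) = norm y" by (simp add: l_def u)
  moreover have "Im (l y) = 0"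
  proof -
    have "(cmod (l y))\<^sup>2 \<le> (norm y)\<^sup>2" using le[of y] by (simp add: power_mono)
    then show ?thesis using \<open>Re (l y) = norm y\<close> by (simp add: cmod_power2)
  qed
  ultimately have "l y = norm y" by (simp add: complex_eq_iff)
  moreover have "dual_elem l" using le by (auto simp: dual_elem_def add mul intro!: exI[of _ 1])
  ultimately show ?thesis using le that by blast
qed

lemma eq_by_dual:
  fixes x y :: "'a::complex_banach"
  assumes "\<And>l. dual_elem l \<Longrightarrow> l x = l y"
  shows "x = y"
proof -
  obtain l where l: "dual_elem l" "l (x - y) = norm (x - y)" using dual_elem_norming by metis
  then show ?thesis using assms[OF l(1)] by (simp add: dual_elemD(5))
qed

lemma norm_le_by_dual:
  fixes x :: "'a::complex_banach"
  assumes "\<And>l. dual_elem l \<Longrightarrow> (\<And>y. cmod (l y) \<le> norm y) \<Longrightarrow> cmod (l x) \<le> c"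
  shows "norm x \<le> c"
proof -
  obtain l where l: "dual_elem l" "l x = norm x" "\<And>y. cmod (l y) \<le> norm y"
    using dual_elem_norming by metis
  then show ?thesis using assms[OF l(1,3)] by simp
qed

subsection \<open>Integrals over the boundary of a sector\<close>

lemma has_integral_arctan: "((\<lambda>t::real. 1 / (1 + t\<^sup>2)) has_integral pi) UNIV"
proof (rule has_integral_monotone_convergence_increasing)
  fix k :: nat
  have "((\<lambda>t::real. 1 / (1 + t\<^sup>2)) has_integral (arctan k - arctan (- real k))) {- real k..real k}"
    by (rule fundamental_theorem_of_calculus)
      (auto intro!: derivative_eq_intros DERIV_subset[OF DERIV_arctan]
        simp: has_real_derivative_iff_has_vector_derivative[symmetric] inverse_eq_divide)
  then show "((\<lambda>t::real. if t \<in> {- real k..real k} then 1 / (1 + t\<^sup>2) else 0) has_integral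
      (2 * arctan k)) UNIV"
    by (subst has_integral_restrict_UNIV) (simp add: arctan_minus)
next
  fix k :: nat and t :: real
  show "(if t \<in> {- real k..real k} then 1 / (1 + t\<^sup>2) else 0)
      \<le> (if t \<in> {- real (Suc k)..real (Suc k)} then 1 / (1 + t\<^sup>2) else 0)"
    by auto
next
  fix t :: real
  obtain N :: nat where N: "\<bar>t\<bar> \<le> real N" using real_arch_simple by blast
  then have "\<forall>\<^sub>F k in sequentially. (if t \<in> {- real k..real k} then 1 / (1 + t\<^sup>2) else 0) = 1 / (1 + t\<^sup>2)"
    by (intro eventually_sequentiallyI[of N]) auto
  then show "(\<lambda>k. if t \<in> {- real k..real k} then 1 / (1 + t\<^sup>2) else 0) \<longlonglongrightarrow> 1 / (1 + t\<^sup>2)"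
    by (rule tendsto_eventually)
next
  have "(\<lambda>k. arctan (real k)) \<longlonglongrightarrow> pi / 2"
    by (rule filterlim_compose[OF tendsto_arctan_at_top filterlim_real_sequentially])
  then show "(\<lambda>k. 2 * arctan (real k)) \<longlonglongrightarrow> pi"
    by (auto dest: tendsto_mult_left[where c = 2])
qed

lemma integrable_const_over_1_plus_square: "(\<lambda>t::real. C / (1 + t\<^sup>2)) integrable_on UNIV"
  using has_integral_mult_right[OF has_integral_arctan, of C] by (auto simp: integrable_on_def)

text \<open>Without second countability there is no Bochner integral, so integrability up to an endpoint
  at which the integrand has no limit is obtained from the fundamental theorem of calculus applied
  to the Lipschitz extension of the primitive.\<close>

lemma integrable_bounded_endpoint:
  fixes k :: "real \<Rightarrow> 'a::banach"
  assumes cont: "continuous_on {0<..b} k" and bnd: "\<And>t. t \<in> {0<..b} \<Longrightarrow> norm (k t) \<le> M" and "0 < b"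
  shows "k integrable_on {0..b}"
proof -
  define F where "F = (\<lambda>t. integral {t..b} k)"
  have int: "k integrable_on {s..t}" if "0 < s" "t \<le> b" for s t
    using that by (intro integrable_continuous_real continuous_on_subset[OF cont]) auto
  have diff: "F s - F t = integral {s..t} k" if "0 < s" "s \<le> t" "t \<le> b" for s t
    using Henstock_Kurzweil_Integration.integral_combine[where a = s and c = t and b = b and f = k] int[of s b] that by (simp add: F_def algebra_simps)
  have lip: "norm (F s - F t) \<le> M * \<bar>s - t\<bar>" if "s \<in> {0<..b}" "t \<in> {0<..b}" for s t
  proof -
    have *: "norm (F s - F t) \<le> M * \<bar>s - t\<bar>" if "0 < s" "s \<le> t" "t \<le> b" for s t
    proof -
      have "norm (integral {s..t} k) \<le> M * (t - s)"
        using that by (intro integral_bound) (auto intro!: continuous_on_subset[OF cont] bnd)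
      then show ?thesis using that by (simp add: diff)
    qed
    show ?thesis using *[of s t] *[of t s] that
      by (cases "s \<le> t") (auto simp: norm_minus_commute abs_minus_commute)
  qed
  have M: "0 \<le> M" using order_trans[OF norm_ge_zero bnd[of b]] \<open>0 < b\<close> by simp
  have "M-lipschitz_on {0<..b} F"
    by (rule lipschitz_onI) (use lip M in \<open>auto simp: dist_norm\<close>)
  then have "uniformly_continuous_on {0<..b} F" by (rule lipschitz_on_uniformly_continuous)
  then obtain G where G: "uniformly_continuous_on (closure {0<..b}) G"
      "\<And>x. x \<in> {0<..b} \<Longrightarrow> F x = G x"
    using uniformly_continuous_on_extension_on_closure by metis
  have "continuous_on {0..b} G"
    using G(1) \<open>0 < b\<close> by (auto dest: uniformly_continuous_imp_continuous)
  moreover have "(G has_vector_derivative - k x) (at x)" if x: "x \<in> {0<..<b}" for x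
  proof -
    have "((\<lambda>u. integral {x/2..u} k) has_vector_derivative k x) (at x within {x/2..b})"
      using x by (intro integral_has_vector_derivative continuous_on_subset[OF cont]) auto
    then have "((\<lambda>u. integral {x/2..u} k) has_vector_derivative k x) (at x)"
      using x at_within_interior[of x "{x/2..b}"] by auto
    then have "((\<lambda>u. F (x/2) - integral {x/2..u} k) has_vector_derivative - k x) (at x)"
      by (auto intro!: derivative_eq_intros)
    moreover have "F (x/2) - integral {x/2..u} k = G u" if "u \<in> {x/2<..<b}" for u
      using diff[of "x/2" u] G(2)[of u] that x by (auto simp: algebra_simps)
    ultimately show ?thesis
      using x by (auto intro: has_vector_derivative_transform_within_open[where S = "{x/2<..<b}"])
  qed
  ultimately have "((\<lambda>x. - k x) has_integral (G b - G 0)) {0..b}"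
    using \<open>0 < b\<close> by (intro fundamental_theorem_of_calculus_interior) simp_all
  then have "(\<lambda>x. - k x) integrable_on {0..b}" by (rule has_integral_integrable)
  then have "(\<lambda>x. - (- k x)) integrable_on {0..b}" by (rule integrable_neg)
  then show ?thesis by simp
qed

text \<open>The integrands on the contour have a corner at \<open>0\<close>, where the resolvent is
  not controlled, so the two half-lines are integrated separately and the value at \<open>0\<close>
  is immaterial. The majorant bounds the integrand near \<open>0\<close> and makes it integrable at
  infinity.\<close>

lemma integrable_on_UNIV_decay:
  fixes k :: "real \<Rightarrow> 'a::banach"
  assumes cont: "continuous_on (- {0}) k" and bnd: "\<And>t. t \<noteq> 0 \<Longrightarrow> norm (k t) \<le> C / (1 + t\<^sup>2)"
  shows "k integrable_on UNIV"
proof -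
  have C: "0 \<le> C" using order_trans[OF norm_ge_zero bnd[of 1]] by simp
  have le: "norm (k t) \<le> C" if "t \<noteq> 0" for t
  proof -
    have "C / (1 + t\<^sup>2) \<le> C / 1" using C by (intro divide_left_mono) (auto simp: add_pos_nonneg)
    then show ?thesis using bnd[OF that] by simp
  qed
  define k' where "k' = (\<lambda>t. if t = 0 then 0 else k t)"
  have pos: "k integrable_on {0..b}" if "b > 0" for b
    using le that by (intro integrable_bounded_endpoint[where M = C] continuous_on_subset[OF cont]) auto
  have "continuous_on {0<..b} (\<lambda>t. k (- t))" for b
    by (rule continuous_on_compose2[OF cont]) (auto intro!: continuous_intros)
  then have "(\<lambda>t. k (- t)) integrable_on {0..b}" if "b > 0" for b
    using le that by (intro integrable_bounded_endpoint[where M = C]) auto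
  then have neg: "k integrable_on {- b..0}" if "b > 0" for b
    using that Henstock_Kurzweil_Integration.integrable_reflect_real[of "\<lambda>t. k (- t)" b 0] by simp
  have "k integrable_on {a..c}" for a c
  proof -
    define m where "m = \<bar>a\<bar> + \<bar>c\<bar> + 1"
    have m: "0 < m" "- m \<le> a" "c \<le> m" by (auto simp: m_def)
    have "k integrable_on {- m..m}"
      by (rule Henstock_Kurzweil_Integration.integrable_combine[OF _ _ neg[OF m(1)] pos[OF m(1)]])
        (use m in simp_all)
    then show ?thesis by (rule integrable_on_subinterval) (use m in simp)
  qed
  then have "k' integrable_on {a..c}" for a c
    by (rule integrable_spike_finite[of "{0}" _ _ k, rotated 2]) (auto simp: k'_def)
  then have "k' integrable_on UNIV"
    using le C bnd
    by (intro integrable_on_all_intervals_integrable_bound[OF _ _ integrable_const_over_1_plus_square[of C]])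
      (auto simp: k'_def)
  then show ?thesis by (rule integrable_spike_finite[of "{0}", rotated 2]) (auto simp: k'_def)
qed

section \<open>Turning the rays of the contour\<close>

lemma has_vector_derivative_of_real_cis:
  "((\<lambda>\<phi>. of_real t * cis \<phi>) has_vector_derivative (of_real t * (\<i> * cis \<phi>))) (at \<phi> within U)"
  unfolding has_vector_derivative_def
  by (auto intro!: derivative_eq_intros simp: algebra_simps scaleR_conv_of_real)

text \<open>The derivative in \<open>\<phi>\<close> of \<open>\<integral> u (t e^{i\<phi>}) e^{i\<phi>} dt\<close> is a boundary term, because
  \<open>\<partial>\<^sub>\<phi> (u (t e^{i\<phi>}) e^{i\<phi>}) = \<partial>\<^sub>t (i t e^{i\<phi>} u (t e^{i\<phi>}))\<close>.\<close>

lemma integral_rotation_bound: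
  fixes u :: "complex \<Rightarrow> complex"
  assumes S: "open S" and hol: "u holomorphic_on S" and ab: "a \<le> b" and "\<phi>1 \<le> \<phi>2"
    and mem: "\<And>t \<phi>. t \<in> {a..b} \<Longrightarrow> \<phi> \<in> {\<phi>1..\<phi>2} \<Longrightarrow> of_real t * cis \<phi> \<in> S"
    and bnd: "\<And>\<phi>. \<phi> \<in> {\<phi>1..\<phi>2} \<Longrightarrow>
      \<bar>a\<bar> * cmod (u (of_real a * cis \<phi>)) + \<bar>b\<bar> * cmod (u (of_real b * cis \<phi>)) \<le> M"
  shows "cmod (integral {a..b} (\<lambda>t. u (of_real t * cis \<phi>2) * cis \<phi>2)
            - integral {a..b} (\<lambda>t. u (of_real t * cis \<phi>1) * cis \<phi>1)) \<le> M * (\<phi>2 - \<phi>1)"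
proof -
  define J where "J = (\<lambda>\<phi>. integral {a..b} (\<lambda>t. u (of_real t * cis \<phi>) * cis \<phi>))"
  define D where "D = (\<lambda>\<phi> t. \<i> * cis \<phi> * (u (of_real t * cis \<phi>)
      + of_real t * cis \<phi> * deriv u (of_real t * cis \<phi>)))"
  have du: "(u has_field_derivative deriv u z) (at z)" if "z \<in> S" for z
    using hol S that by (rule holomorphic_derivI)
  have cu: "continuous_on S u" using hol by (rule holomorphic_on_imp_continuous_on)
  have cdu: "continuous_on S (deriv u)"
    using holomorphic_deriv[OF hol S] by (rule holomorphic_on_imp_continuous_on)
  have J': "(J has_vector_derivative integral {a..b} (D \<phi>)) (at \<phi> within {\<phi>1..\<phi>2})"
    if \<phi>: "\<phi> \<in> {\<phi>1..\<phi>2}" for \<phi>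
    unfolding J_def
  proof (rule leibniz_rule_vector_derivative[where a = a and b = b, unfolded cbox_interval])
    fix x t assume x: "x \<in> {\<phi>1..\<phi>2}" and t: "t \<in> {a..b}"
    have "((u \<circ> (\<lambda>\<phi>. of_real t * cis \<phi>)) has_vector_derivative
        (of_real t * (\<i> * cis x)) * deriv u (of_real t * cis x)) (at x within {\<phi>1..\<phi>2})"
      by (rule field_vector_diff_chain_within[OF has_vector_derivative_of_real_cis])
        (use du[OF mem] x t in \<open>auto intro: has_field_derivative_at_within\<close>)
    then show "((\<lambda>\<phi>. u (of_real t * cis \<phi>) * cis \<phi>) has_vector_derivative D x t) (at x within {\<phi>1..\<phi>2})"
      using has_vector_derivative_of_real_cis[of 1 x]
      by (auto intro!: has_vector_derivative_eq_rhs[OF has_vector_derivative_mult]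
          simp: o_def D_def algebra_simps)
  next
    fix x assume "x \<in> {\<phi>1..\<phi>2}"
    then show "(\<lambda>t. u (of_real t * cis x) * cis x) integrable_on {a..b}"
      using mem by (intro integrable_continuous_real continuous_intros continuous_on_compose2[OF cu]) auto
  next
    show "continuous_on ({\<phi>1..\<phi>2} \<times> {a..b}) (\<lambda>(x, t). D x t)"
      unfolding D_def split_def using mem
      by (intro continuous_intros continuous_on_compose2[OF cu] continuous_on_compose2[OF cdu]) auto
  qed (use \<phi> in auto)
  have ID: "integral {a..b} (D \<phi>) = \<i> * (of_real b * cis \<phi>) * u (of_real b * cis \<phi>)
      - \<i> * (of_real a * cis \<phi>) * u (of_real a * cis \<phi>)" if \<phi>: "\<phi> \<in> {\<phi>1..\<phi>2}" for \<phi>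
  proof (rule integral_unique[OF fundamental_theorem_of_calculus[OF ab]])
    fix t assume t: "t \<in> {a..b}"
    have 1: "((\<lambda>t. of_real t * cis \<phi>) has_vector_derivative cis \<phi>) (at t within {a..b})"
      unfolding has_vector_derivative_def
      by (auto intro!: derivative_eq_intros simp: scaleR_conv_of_real)
    have "((u \<circ> (\<lambda>t. of_real t * cis \<phi>)) has_vector_derivative
        cis \<phi> * deriv u (of_real t * cis \<phi>)) (at t within {a..b})"
      by (rule field_vector_diff_chain_within[OF 1])
        (use du[OF mem] \<phi> t in \<open>auto intro: has_field_derivative_at_within\<close>)
    then have 2: "((\<lambda>t. u (of_real t * cis \<phi>)) has_vector_derivative
        cis \<phi> * deriv u (of_real t * cis \<phi>)) (at t within {a..b})"
      by (simp add: o_def)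
    show "((\<lambda>t. \<i> * (of_real t * cis \<phi>) * u (of_real t * cis \<phi>)) has_vector_derivative D \<phi> t)
        (at t within {a..b})"
      by (rule has_vector_derivative_eq_rhs
          [OF has_vector_derivative_mult[OF has_vector_derivative_mult_right[OF 1, of \<i>] 2]])
        (simp add: D_def algebra_simps)
  qed
  have "cmod (J \<phi>2 - J \<phi>1) \<le> M * norm (\<phi>2 - \<phi>1)"
  proof (rule differentiable_bound[of "{\<phi>1..\<phi>2}"])
    fix \<phi> assume \<phi>: "\<phi> \<in> {\<phi>1..\<phi>2}"
    show "(J has_derivative (\<lambda>h. h *\<^sub>R integral {a..b} (D \<phi>))) (at \<phi> within {\<phi>1..\<phi>2})"
      using J'[OF \<phi>] by (simp add: has_vector_derivative_def)
    have "cmod (integral {a..b} (D \<phi>)) \<le> M"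
      unfolding ID[OF \<phi>] using bnd[OF \<phi>]
      by (intro order_trans[OF norm_triangle_ineq4]) (simp add: norm_mult)
    then show "onorm (\<lambda>h. h *\<^sub>R integral {a..b} (D \<phi>)) \<le> M"
      by (intro onorm_le) (auto simp: mult.commute[of M] intro!: mult_left_mono)
  qed (use \<open>\<phi>1 \<le> \<phi>2\<close> in auto)
  then show ?thesis using \<open>\<phi>1 \<le> \<phi>2\<close> by (simp add: J_def)
qed

text \<open>With a signed parameter \<open>t\<close> each half of the path has the form
  \<open>t * cis \<phi>\<close>, the incoming half with its angle shifted by pi. This is the shape
  to which \<open>integral_rotation_bound\<close> applies.\<close>

lemma bpath_neg: "t < 0 \<Longrightarrow> bpath \<nu> t = of_real t * cis (\<nu> + pi)"
  and bpath'_neg: "t < 0 \<Longrightarrow> bpath' \<nu> t = cis (\<nu> + pi)"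
  and bpath_nonneg: "t \<ge> 0 \<Longrightarrow> bpath \<nu> t = of_real t * cis (- \<nu>)"
  and bpath'_nonneg: "t \<ge> 0 \<Longrightarrow> bpath' \<nu> t = cis (- \<nu>)"
  by (simp_all add: bpath_def bpath'_def flip: minus_cis)

lemma norm_bpath [simp]: "cmod (bpath \<nu> t) = \<bar>t\<bar>" and norm_bpath' [simp]: "cmod (bpath' \<nu> t) = 1"
  by (simp_all add: bpath_def bpath'_def norm_mult)

lemma bpath_eq_0_iff [simp]: "bpath \<nu> t = 0 \<longleftrightarrow> t = 0"
  by (simp add: bpath_def)

lemma bpath_scale: "s > 0 \<Longrightarrow> bpath \<nu> (s * t) = of_real s * bpath \<nu> t"
  and bpath'_scale: "s > 0 \<Longrightarrow> bpath' \<nu> (s * t) = bpath' \<nu> t"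
  by (auto simp: bpath_def bpath'_def mult_less_0_iff zero_less_mult_iff)

lemma nonzero_reals_eq: "- {0 :: real} = {..<0} \<union> {0<..}"
  by auto

lemma continuous_on_bpath: "continuous_on (- {0}) (bpath \<nu>)"
  and continuous_on_bpath': "continuous_on (- {0}) (bpath' \<nu>)"
proof -
  have "continuous_on {..<0} (bpath \<nu>)" "continuous_on {..<0} (bpath' \<nu>)"
    by (auto simp: bpath_neg bpath'_neg intro!: continuous_intros
        intro: continuous_on_eq[of _ "\<lambda>t. of_real t * cis (\<nu> + pi)"]
               continuous_on_eq[of _ "\<lambda>t. cis (\<nu> + pi)"])
  moreover have "continuous_on {0<..} (bpath \<nu>)" "continuous_on {0<..} (bpath' \<nu>)"
    by (auto simp: bpath_nonneg bpath'_nonneg intro!: continuous_intros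
        intro: continuous_on_eq[of _ "\<lambda>t. of_real t * cis (- \<nu>)"]
               continuous_on_eq[of _ "\<lambda>t. cis (- \<nu>)"])
  ultimately show "continuous_on (- {0}) (bpath \<nu>)" "continuous_on (- {0}) (bpath' \<nu>)"
    unfolding nonzero_reals_eq by (auto intro: continuous_on_open_Un)
qed

definition cint :: "real \<Rightarrow> (complex \<Rightarrow> complex) \<Rightarrow> complex" where
  "cint \<nu> u = integral UNIV (\<lambda>t. u (bpath \<nu> t) * bpath' \<nu> t)"

text \<open>Both ends of each ray are cut off, since the boundary terms of a rotation are small near
  \<open>0\<close> and far out. \<open>Suc k\<close> keeps the inner radius positive and at most
  equal to the outer one.\<close>

definition trunc :: "nat \<Rightarrow> real set" where
  "trunc k = {- real (Suc k)..- inverse (real (Suc k))} \<union> {inverse (real (Suc k))..real (Suc k)}"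

text \<open>The standing size condition on integrands: a resolvent is of order
  \<open>1 / |z|\<close> and a \<open>decay1\<close> function of order
  \<open>|z| / (1 + |z|^2)\<close>, so their product is of order \<open>1 / (1 + |z|^2)\<close>. It
  is the majorant for dominated convergence and makes \<open>|z| |u z|\<close> vanish at
  \<open>0\<close> and at infinity.\<close>

locale contour_fun =
  fixes S :: "complex set" and u :: "complex \<Rightarrow> complex" and C :: real and \<nu> :: real
  assumes cont: "continuous_on S u" and bnd: "\<And>z. z \<in> S \<Longrightarrow> cmod (u z) \<le> C / (1 + (cmod z)\<^sup>2)"
    and mem: "\<And>t. t \<noteq> 0 \<Longrightarrow> bpath \<nu> t \<in> S"
begin

lemma norm_le: "t \<noteq> 0 \<Longrightarrow> cmod (u (bpath \<nu> t) * bpath' \<nu> t) \<le> C / (1 + t\<^sup>2)"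
  using bnd[OF mem, of t] by (simp add: norm_mult)

lemma continuous: "continuous_on (- {0}) (\<lambda>t. u (bpath \<nu> t) * bpath' \<nu> t)"
  by (intro continuous_intros continuous_on_bpath continuous_on_bpath' continuous_on_compose2[OF cont])
    (use mem in auto)

lemma integrable: "(\<lambda>t. u (bpath \<nu> t) * bpath' \<nu> t) integrable_on UNIV"
  using integrable_on_UNIV_decay[OF continuous norm_le] .

lemma has_integral: "((\<lambda>t. u (bpath \<nu> t) * bpath' \<nu> t) has_integral cint \<nu> u) UNIV"
  using integrable by (simp add: cint_def integrable_integral)

definition truncated :: "nat \<Rightarrow> complex" where
  "truncated k = integral {- real (Suc k)..- inverse (real (Suc k))} (\<lambda>t. u (of_real t * cis (\<nu> + pi)) * cis (\<nu> + pi))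
    + integral {inverse (real (Suc k))..real (Suc k)} (\<lambda>t. u (of_real t * cis (- \<nu>)) * cis (- \<nu>))"

lemma truncated_tendsto: "truncated \<longlonglongrightarrow> cint \<nu> u"
proof -
  define w where "w = (\<lambda>t. u (bpath \<nu> t) * bpath' \<nu> t)"
  have ioc: "w integrable_on {a..b}" for a b
    using integrable unfolding w_def by (rule integrable_on_subinterval) auto
  have tr: "((\<lambda>t. if t \<in> trunc k then w t else 0) has_integral truncated k) UNIV" for k
  proof -
    define c where "c = inverse (real (Suc k))"
    have c: "c > 0" by (simp add: c_def)
    have neg: "(w has_integral integral {- real (Suc k)..- c} (\<lambda>t. u (of_real t * cis (\<nu> + pi)) * cis (\<nu> + pi)))
        {- real (Suc k)..- c}"
      using c by (intro has_integral_eq_rhs[OF integrable_integral[OF ioc]] integral_cong)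
        (auto simp: w_def bpath_neg bpath'_neg)
    have pos: "(w has_integral integral {c..real (Suc k)} (\<lambda>t. u (of_real t * cis (- \<nu>)) * cis (- \<nu>)))
        {c..real (Suc k)}"
      using c by (intro has_integral_eq_rhs[OF integrable_integral[OF ioc]] integral_cong)
        (auto simp: w_def bpath_nonneg bpath'_nonneg)
    have "{- real (Suc k)..- c} \<inter> {c..real (Suc k)} = {}" using c by auto
    then show ?thesis
      using has_integral_Un[OF neg pos]
      unfolding trunc_def truncated_def c_def[symmetric] has_integral_restrict_UNIV by auto
  qed
  have "(\<lambda>k. integral UNIV (\<lambda>t. if t \<in> trunc k then w t else 0)) \<longlonglongrightarrow> integral UNIV (\<lambda>t. if t = 0 then 0 else w t)"
  proof (rule dominated_convergence(2)[OF _ integrable_const_over_1_plus_square[of C]])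
    show "(\<lambda>t. if t \<in> trunc k then w t else 0) integrable_on UNIV" for k
      using tr by blast
    show "norm (if t \<in> trunc k then w t else 0) \<le> C / (1 + t\<^sup>2)" for k t
    proof -
      have "0 \<le> C" using order_trans[OF norm_ge_zero norm_le[of 1]] by simp
      moreover have "t \<in> trunc k \<Longrightarrow> t \<noteq> 0" by (auto simp: trunc_def field_simps)
      ultimately show ?thesis using norm_le[of t] by (auto simp: w_def)
    qed
    show "(\<lambda>k. if t \<in> trunc k then w t else 0) \<longlonglongrightarrow> (if t = 0 then 0 else w t)" for t
    proof (cases "t = 0")
      case True
      then have "t \<notin> trunc k" for k by (auto simp: trunc_def field_simps)
      then show ?thesis using True by simp
    next
      case False
      obtain N :: nat where N: "max \<bar>t\<bar> (inverse \<bar>t\<bar>) \<le> real N" using real_arch_simple by blast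
      have "t \<in> trunc k" if "k \<ge> N" for k
      proof -
        have 1: "\<bar>t\<bar> \<le> real (Suc k)" and "inverse \<bar>t\<bar> \<le> real (Suc k)" using N that by auto
        then have "inverse (real (Suc k)) \<le> inverse (inverse \<bar>t\<bar>)"
          using False by (intro le_imp_inverse_le) auto
        then show ?thesis using 1 False by (cases "t > 0") (auto simp: trunc_def)
      qed
      then have "\<forall>\<^sub>F k in sequentially. (if t \<in> trunc k then w t else 0) = (if t = 0 then 0 else w t)"
        using False by (intro eventually_sequentiallyI[of N]) auto
      then show ?thesis by (rule tendsto_eventually)
    qed
  qed
  moreover have "integral UNIV (\<lambda>t. if t = 0 then 0 else w t) = integral UNIV w"
    by (rule integral_spike[of "{0}"]) auto
  ultimately show ?thesis
    using tr[THEN integral_unique] by (simp add: cint_def w_def)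
qed

text \<open>The path runs in and out along one and the same ray, so the truncated integrals cancel.
  It is applied at angle \<open>0\<close> and at angle \<open>pi\<close>, and replaces the closing
  of the contour in Cauchy's theorem.\<close>

lemma cint_eq_0_if_rays_coincide:
  assumes "cis \<nu> = cis (- \<nu>)"
  shows "cint \<nu> u = 0"
proof -
  have "truncated k = 0" for k
  proof -
    have "integral {- real (Suc k)..- inverse (real (Suc k))} (\<lambda>t. u (of_real t * cis (\<nu> + pi)) * cis (\<nu> + pi))
        = integral {- real (Suc k)..- inverse (real (Suc k))} (\<lambda>t. - (u (of_real (- t) * cis (- \<nu>)) * cis (- \<nu>)))"
      by (simp add: assms flip: minus_cis)
    also have "\<dots> = integral {inverse (real (Suc k))..real (Suc k)} (\<lambda>t. - (u (of_real t * cis (- \<nu>)) * cis (- \<nu>)))"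
      by (rule Henstock_Kurzweil_Integration.integral_reflect_real)
    finally show ?thesis by (simp add: truncated_def)
  qed
  then have "truncated = (\<lambda>k. 0)" by auto
  then show ?thesis using truncated_tendsto by (simp add: LIMSEQ_const_iff)
qed

text \<open>Substitution of \<open>s * z\<close> for \<open>z\<close>, which preserves both rays.
  The change of variables is made in the Lebesgue integral, to which the gauge integral reduces
  because the majorant makes the integrand absolutely integrable; the value at \<open>0\<close> is
  set to \<open>0\<close> since the majorant says nothing there.\<close>

lemma cint_scale:
  assumes "s > 0"
  shows "cint \<nu> u = of_real s * integral UNIV (\<lambda>t. u (of_real s * bpath \<nu> t) * bpath' \<nu> t)"
    and "(\<lambda>t. u (of_real s * bpath \<nu> t) * bpath' \<nu> t) integrable_on UNIV"
proof -
  define w where "w = (\<lambda>t. if t = 0 then 0 else u (bpath \<nu> t) * bpath' \<nu> t)"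
  define v where "v = (\<lambda>t. u (of_real s * bpath \<nu> t) * bpath' \<nu> t)"
  have weq: "integral UNIV w = cint \<nu> u"
    unfolding cint_def by (rule integral_spike[of "{0}"]) (auto simp: w_def)
  have veq: "integral UNIV (\<lambda>t. w (s * t)) = integral UNIV v"
    using assms by (intro integral_spike[of "{0}"]) (auto simp: w_def v_def bpath_scale bpath'_scale)
  have "0 \<le> C" using order_trans[OF norm_ge_zero norm_le[of 1]] by simp
  moreover have "w integrable_on UNIV"
    by (rule integrable_spike_finite[OF _ _ integrable, of "{0}"]) (auto simp: w_def)
  ultimately have "w absolutely_integrable_on UNIV"
    using norm_le by (intro absolutely_integrable_integrable_bound[OF _ _ integrable_const_over_1_plus_square[of C]])
      (auto simp: w_def)
  then have wi: "Bochner_Integration.integrable lebesgue w" by (simp add: set_integrable_def)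
  have vi: "Bochner_Integration.integrable lebesgue (\<lambda>t. w (s * t))"
    using wi assms lebesgue_integrable_real_affine[where c = s and t = 0 and f = w] by simp
  have abs: "(\<lambda>t. w (s * t)) absolutely_integrable_on UNIV" using vi by (simp add: set_integrable_def)
  have eq: "integral\<^sup>L lebesgue f = integral UNIV f" if "Bochner_Integration.integrable lebesgue f"
    for f :: "real \<Rightarrow> complex"
    using set_lebesgue_integral_eq_integral(2)[of UNIV f] that
    by (simp add: set_integrable_def set_lebesgue_integral_def)
  have "integral\<^sup>L lebesgue w = s *\<^sub>R integral\<^sup>L lebesgue (\<lambda>t. w (s * t))"
    using lebesgue_integral_real_affine[where c = s and t = 0 and f = w] assms by simp
  then show "cint \<nu> u = of_real s * integral UNIV (\<lambda>t. u (of_real s * bpath \<nu> t) * bpath' \<nu> t)"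
    by (simp add: eq wi vi weq veq v_def[symmetric] scaleR_conv_of_real)
  have "(\<lambda>t. w (s * t)) integrable_on UNIV"
    using abs set_lebesgue_integral_eq_integral(1) by blast
  then have "v integrable_on UNIV"
    by (rule integrable_spike_finite[of "{0}", rotated 2])
      (use assms in \<open>auto simp: w_def v_def bpath_scale bpath'_scale\<close>)
  then show "(\<lambda>t. u (of_real s * bpath \<nu> t) * bpath' \<nu> t) integrable_on UNIV" by (simp add: v_def)
qed

end

text \<open>Cauchy's theorem for a wedge. On truncated rays the derivative in the angle consists of
  boundary terms at the radii \<open>n\<close> and \<open>1 / n\<close>, and
  \<open>|z| |u z| \<le> C / n\<close> at both; two rays with two ends each give the factor
  \<open>4\<close>, and the whole tends to \<open>0\<close>.\<close>

lemma cint_rotate: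
  assumes "open S" "u holomorphic_on S" and bnd: "\<And>z. z \<in> S \<Longrightarrow> cmod (u z) \<le> C / (1 + (cmod z)\<^sup>2)"
    and "\<nu>1 \<le> \<nu>2" and mem: "\<And>r \<phi>. r > 0 \<Longrightarrow> \<phi> \<in> {\<nu>1..\<nu>2} \<Longrightarrow> of_real r * cis \<phi> \<in> S"
      "\<And>r \<phi>. r > 0 \<Longrightarrow> \<phi> \<in> {\<nu>1..\<nu>2} \<Longrightarrow> of_real r * cis (- \<phi>) \<in> S"
  shows "cint \<nu>1 u = cint \<nu>2 u"
proof -
  have cont: "continuous_on S u" using assms(2) by (rule holomorphic_on_imp_continuous_on)
  have mem3: "of_real t * cis (\<phi> + pi) \<in> S" if "t < 0" "\<phi> \<in> {\<nu>1..\<nu>2}" for t \<phi>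
    using mem(1)[of "- t" \<phi>] that by (simp flip: minus_cis)
  have bp: "bpath \<nu> t \<in> S" if "t \<noteq> 0" "\<nu> \<in> {\<nu>1..\<nu>2}" for t \<nu>
    using that mem(2)[of t \<nu>] mem3[of t \<nu>] by (cases "t < 0") (auto simp: bpath_neg bpath_nonneg)
  interpret c1: contour_fun S u C \<nu>1
    by standard (use bnd bp cont assms in auto)
  interpret c2: contour_fun S u C \<nu>2
    by standard (use bnd bp cont assms in auto)
  have C: "0 \<le> C" using order_trans[OF norm_ge_zero c1.norm_le[of 1]] by simp
  have le: "cmod (c2.truncated k - c1.truncated k) \<le> 4 * C * (\<nu>2 - \<nu>1) * inverse (real (Suc k))" for k
  proof -
    define n where "n = real (Suc k)"
    have n: "n \<ge> 1" by (simp add: n_def)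
    have nn: "1 \<le> n * n" using mult_mono[of 1 n 1 n] n by simp
    have n': "inverse n \<le> n" "0 < inverse n" using n nn by (auto simp: field_simps)
    have le: "\<bar>t\<bar> * cmod (u z) \<le> C * inverse n"
      if "z \<in> S" "cmod z = \<bar>t\<bar>" "\<bar>t\<bar> = n \<or> \<bar>t\<bar> = inverse n" for t z
    proof -
      have "\<bar>t\<bar> / (1 + t\<^sup>2) \<le> inverse n"
        using that(3)
      proof
        assume "\<bar>t\<bar> = n"
        then have "t\<^sup>2 = n\<^sup>2" by (metis power2_abs)
        then show ?thesis using \<open>\<bar>t\<bar> = n\<close> n nn by (simp add: field_simps power2_eq_square add_pos_nonneg)
      next
        assume a: "\<bar>t\<bar> = inverse n"
        have "\<bar>t\<bar> / (1 + t\<^sup>2) \<le> \<bar>t\<bar> / 1" by (intro divide_left_mono) (auto simp: add_pos_nonneg)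
        then show ?thesis using a by simp
      qed
      then have "C * (\<bar>t\<bar> / (1 + t\<^sup>2)) \<le> C * inverse n" using C by (intro mult_left_mono) auto
      moreover have "\<bar>t\<bar> * cmod (u z) \<le> \<bar>t\<bar> * (C / (1 + t\<^sup>2))"
        using bnd[OF that(1)] that(2) by (intro mult_left_mono) auto
      ultimately show ?thesis by (simp add: mult.commute)
    qed
    have 1: "cmod (integral {- n..- inverse n} (\<lambda>t. u (of_real t * cis (\<nu>2 + pi)) * cis (\<nu>2 + pi))
      - integral {- n..- inverse n} (\<lambda>t. u (of_real t * cis (\<nu>1 + pi)) * cis (\<nu>1 + pi)))
      \<le> (2 * C * inverse n) * (\<nu>2 + pi - (\<nu>1 + pi))"
    proof (rule integral_rotation_bound[OF assms(1,2)])
      have m: "of_real t * cis \<phi> \<in> S" if "t < 0" "\<phi> \<in> {\<nu>1 + pi..\<nu>2 + pi}" for t \<phi>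
        using mem3[of t "\<phi> - pi"] that by auto
      show "of_real t * cis \<phi> \<in> S" if "t \<in> {- n..- inverse n}" "\<phi> \<in> {\<nu>1 + pi..\<nu>2 + pi}" for t \<phi>
      proof (rule m)
        show "t < 0" using that n'(2) unfolding atLeastAtMost_iff by linarith
      qed (use that in auto)
      show "\<bar>- n\<bar> * cmod (u (of_real (- n) * cis \<phi>)) + \<bar>- inverse n\<bar> * cmod (u (of_real (- inverse n) * cis \<phi>))
          \<le> 2 * C * inverse n" if "\<phi> \<in> {\<nu>1 + pi..\<nu>2 + pi}" for \<phi>
      proof -
        have "\<bar>- n\<bar> * cmod (u (of_real (- n) * cis \<phi>)) \<le> C * inverse n"
          using n by (intro le m that) (simp_all add: norm_mult)
        moreover have "\<bar>- inverse n\<bar> * cmod (u (of_real (- inverse n) * cis \<phi>)) \<le> C * inverse n"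
          using n by (intro le m that) (simp_all add: norm_mult norm_inverse)
        ultimately show ?thesis by linarith
      qed
    qed (use n' assms in auto)
    have 2: "cmod (integral {inverse n..n} (\<lambda>t. u (of_real t * cis (- \<nu>1)) * cis (- \<nu>1))
      - integral {inverse n..n} (\<lambda>t. u (of_real t * cis (- \<nu>2)) * cis (- \<nu>2)))
      \<le> (2 * C * inverse n) * (- \<nu>1 - (- \<nu>2))"
    proof (rule integral_rotation_bound[OF assms(1,2)])
      have m: "of_real t * cis \<phi> \<in> S" if "0 < t" "\<phi> \<in> {- \<nu>2..- \<nu>1}" for t \<phi>
        using mem(2)[of t "- \<phi>"] that by auto
      show "of_real t * cis \<phi> \<in> S" if "t \<in> {inverse n..n}" "\<phi> \<in> {- \<nu>2..- \<nu>1}" for t \<phi>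
      proof (rule m)
        show "0 < t" using that n'(2) unfolding atLeastAtMost_iff by linarith
      qed (use that in auto)
      show "\<bar>inverse n\<bar> * cmod (u (of_real (inverse n) * cis \<phi>)) + \<bar>n\<bar> * cmod (u (of_real n * cis \<phi>))
          \<le> 2 * C * inverse n" if "\<phi> \<in> {- \<nu>2..- \<nu>1}" for \<phi>
      proof -
        have "\<bar>n\<bar> * cmod (u (of_real n * cis \<phi>)) \<le> C * inverse n"
          using n by (intro le m that) (simp_all add: norm_mult)
        moreover have "\<bar>inverse n\<bar> * cmod (u (of_real (inverse n) * cis \<phi>)) \<le> C * inverse n"
          using n by (intro le m that) (simp_all add: norm_mult norm_inverse)
        ultimately show ?thesis by linarith
      qed
    qed (use n' assms in auto)
    have "c2.truncated k - c1.truncated k =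
      (integral {- n..- inverse n} (\<lambda>t. u (of_real t * cis (\<nu>2 + pi)) * cis (\<nu>2 + pi))
        - integral {- n..- inverse n} (\<lambda>t. u (of_real t * cis (\<nu>1 + pi)) * cis (\<nu>1 + pi)))
      - (integral {inverse n..n} (\<lambda>t. u (of_real t * cis (- \<nu>1)) * cis (- \<nu>1))
        - integral {inverse n..n} (\<lambda>t. u (of_real t * cis (- \<nu>2)) * cis (- \<nu>2)))"
      by (simp add: c1.truncated_def c2.truncated_def n_def)
    also have "cmod \<dots> \<le> (2 * C * inverse n) * (\<nu>2 + pi - (\<nu>1 + pi)) + (2 * C * inverse n) * (- \<nu>1 - (- \<nu>2))"
      by (rule order_trans[OF norm_triangle_ineq4 add_mono[OF 1 2]])
    finally show ?thesis by (simp add: n_def algebra_simps)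
  qed
  have "(\<lambda>k. 4 * C * (\<nu>2 - \<nu>1) * inverse (real (Suc k))) \<longlonglongrightarrow> 0"
    by (rule tendsto_mult_right_zero[OF LIMSEQ_inverse_real_of_nat])
  then have "(\<lambda>k. c2.truncated k - c1.truncated k) \<longlonglongrightarrow> 0"
    by (rule Lim_null_comparison[OF always_eventually, rotated]) (use le in blast)
  moreover have "(\<lambda>k. c2.truncated k - c1.truncated k) \<longlonglongrightarrow> cint \<nu>2 u - cint \<nu>1 u"
    by (intro tendsto_diff c1.truncated_tendsto c2.truncated_tendsto)
  ultimately have "cint \<nu>2 u - cint \<nu>1 u = 0" by (rule LIMSEQ_unique[symmetric])
  then show ?thesis by simp
qed

section \<open>Sectors, their complements and the distance between them\<close>

lemma polar: "z = of_real (cmod z) * cis (Arg z)"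
  using rcis_cmod_Arg[of z] by (simp add: rcis_def)

lemma Arg_polar: "r > 0 \<Longrightarrow> - pi < \<phi> \<Longrightarrow> \<phi> \<le> pi \<Longrightarrow> Arg (of_real r * cis \<phi>) = \<phi>"
  by (simp add: Arg_cis)

lemma polar_in_sector:
  "r > 0 \<Longrightarrow> \<bar>\<phi>\<bar> < s \<Longrightarrow> \<bar>\<phi>\<bar> < pi \<Longrightarrow> of_real r * cis \<phi> \<in> sector s"
  using Arg_cis[of \<phi>] by (auto simp: sector_def abs_less_iff)

lemma abs_Arg_le_pi: "\<bar>Arg z\<bar> \<le> pi"
  using mpi_less_Arg[of z] Arg_le_pi[of z] by linarith

lemma abs_Arg_minus: "z \<noteq> 0 \<Longrightarrow> \<bar>Arg (- z)\<bar> = pi - \<bar>Arg z\<bar>"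
  using mpi_less_Arg[of z] Arg_le_pi[of z] by (auto simp: Arg_minus)

lemma abs_Arg_bpath: "t \<noteq> 0 \<Longrightarrow> 0 \<le> \<nu> \<Longrightarrow> \<nu> < pi \<Longrightarrow> \<bar>Arg (bpath \<nu> t)\<bar> = \<nu>"
  using Arg_polar[of "- t" \<nu>] Arg_polar[of t "- \<nu>"] by (auto simp: bpath_def not_less)

lemma bpath_in_sector: "t \<noteq> 0 \<Longrightarrow> 0 \<le> \<nu> \<Longrightarrow> \<nu> < pi \<Longrightarrow> \<nu> < s \<Longrightarrow> bpath \<nu> t \<in> sector s"
  by (simp add: sector_def abs_Arg_bpath)

lemma sector_mono: "s \<le> s' \<Longrightarrow> sector s \<subseteq> sector s'"
  by (auto simp: sector_def)

lemma open_sector: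
  assumes "s \<le> pi"
  shows "open (sector s)"
proof -
  have "sector s = - \<real>\<^sub>\<le>\<^sub>0 \<inter> Arg -` {- s<..<s}"
  proof (intro set_eqI iffI)
    fix z assume z: "z \<in> sector s"
    have "z \<notin> \<real>\<^sub>\<le>\<^sub>0"
    proof
      assume "z \<in> \<real>\<^sub>\<le>\<^sub>0"
      then obtain r where "z = of_real r" "r \<le> 0" by (auto simp: nonpos_Reals_def)
      then show False using z assms by (auto simp: sector_def split: if_splits)
    qed
    then show "z \<in> - \<real>\<^sub>\<le>\<^sub>0 \<inter> Arg -` {- s<..<s}" using z by (auto simp: sector_def abs_less_iff)
  qed (auto simp: sector_def)
  also have "open \<dots>"
    by (rule continuous_open_preimage[OF continuous_on_Arg]) (auto simp: open_Compl)
  finally show ?thesis .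
qed

text \<open>The region where the resolvent of an operator of angle below \<open>w\<close> is
  defined. For \<open>w < pi\<close> it contains the negative half-line, so it crosses the cut of
  \<open>Arg\<close>.\<close>

definition cosector :: "real \<Rightarrow> complex set" where
  "cosector w = {z. z \<noteq> 0 \<and> w < \<bar>Arg z\<bar>}"

text \<open>Reflection at the origin moves the cut of \<open>Arg\<close> out of the way: openness,
  and membership of points with angle near pi, are read off from a sector around the positive
  half-line.\<close>

lemma cosector_iff_minus: "z \<in> cosector w \<longleftrightarrow> - z \<in> sector (pi - w)"
  by (auto simp: cosector_def sector_def abs_Arg_minus)

lemma open_cosector: "0 \<le> w \<Longrightarrow> open (cosector w)"
proof -
  assume "0 \<le> w"
  moreover have "cosector w = uminus -` sector (pi - w)" by (auto simp: cosector_iff_minus)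
  ultimately show ?thesis by (simp add: open_vimage open_sector continuous_on_minus)
qed

lemma polar_in_cosector:
  assumes "r > 0" "\<bar>\<phi> - pi\<bar> < pi - w" "0 \<le> w"
  shows "of_real r * cis \<phi> \<in> cosector w" "of_real r * cis (- \<phi>) \<in> cosector w"
proof -
  show "of_real r * cis \<phi> \<in> cosector w"
    using polar_in_sector[of r "\<phi> - pi" "pi - w"] assms
    by (simp add: cosector_iff_minus flip: minus_cis')
  have "cis (- \<phi>) = - cis (pi - \<phi>)" using minus_cis[of "- \<phi>"] by (simp add: minus_equation_iff[of "cis (pi - \<phi>)"] eq_commute)
  then show "of_real r * cis (- \<phi>) \<in> cosector w"
    using polar_in_sector[of r "pi - \<phi>" "pi - w"] assms by (simp add: cosector_iff_minus abs_minus_commute)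
qed

lemma bpath_in_cosector: "t \<noteq> 0 \<Longrightarrow> 0 \<le> \<nu> \<Longrightarrow> \<nu> < pi \<Longrightarrow> w < \<nu> \<Longrightarrow> bpath \<nu> t \<in> cosector w"
  by (simp add: cosector_def abs_Arg_bpath)

lemma minus_real_in_cosector: "s > 0 \<Longrightarrow> w < pi \<Longrightarrow> - of_real s \<in> cosector w"
  by (simp add: cosector_def flip: of_real_minus)

lemma norm_diff_polar: "(cmod (of_real a * cis s - of_real b * cis t))\<^sup>2 = (a + b)\<^sup>2 - 4 * a * b * (cos ((s - t) / 2))\<^sup>2"
proof -
  have "cos (s - t) = 2 * (cos ((s - t) / 2))\<^sup>2 - 1"
    using cos_double_cos[of "(s - t) / 2"] unfolding mult_2 field_sum_of_halves .
  then have 1: "4 * a * b * (cos ((s - t) / 2))\<^sup>2 = 2 * a * b * (cos (s - t) + 1)" by simp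
  have "(cmod (of_real a * cis s - of_real b * cis t))\<^sup>2
      = a\<^sup>2 * ((sin s)\<^sup>2 + (cos s)\<^sup>2) + b\<^sup>2 * ((sin t)\<^sup>2 + (cos t)\<^sup>2) - 2 * a * b * (cos s * cos t + sin s * sin t)"
    unfolding cmod_power2
    by (simp add: power2_eq_square algebra_simps
        del: sin_cos_squared_add sin_cos_squared_add2 sin_cos_squared_add3)
  also have "\<dots> = a\<^sup>2 + b\<^sup>2 - 2 * a * b * cos (s - t)" by (simp add: cos_diff)
  finally show ?thesis unfolding 1 by (simp add: power2_eq_square algebra_simps)
qed

lemma sin_ge_min:
  assumes "0 \<le> a" "a \<le> x" "x \<le> b" "b \<le> pi"
  shows "min (sin a) (sin b) \<le> sin x"
proof (cases "x \<le> pi / 2")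
  case True
  then have "sin a \<le> sin x" using assms by (intro sin_monotone_2pi_le) auto
  then show ?thesis by simp
next
  case False
  then have "sin (pi - b) \<le> sin (pi - x)" using assms by (intro sin_monotone_2pi_le) auto
  then show ?thesis by simp
qed

text \<open>By the law of cosines \<open>|\<mu> - z|^2\<close> is at least
  \<open>sin^2 (\<psi> / 2) (|\<mu>| + |z|)^2\<close>, where \<psi> is the difference of the
  arguments. Half of its modulus stays between \<open>(\<beta> - \<rho>) / 2\<close> and
  \<open>(pi + \<rho>) / 2\<close>, both strictly inside \<open>(0, pi)\<close>; the difference is
  not reduced modulo \<open>2 pi\<close>, which is why the upper end may exceed
  \<open>pi / 2\<close>.\<close>

lemma sector_separation:
  assumes "0 \<le> \<rho>" "\<rho> < \<beta>" "\<beta> \<le> pi"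
  obtains c where "c > 0"
    "\<And>\<mu> z. \<beta> \<le> \<bar>Arg \<mu>\<bar> \<Longrightarrow> \<bar>Arg z\<bar> \<le> \<rho> \<Longrightarrow> c * (cmod \<mu> + cmod z) \<le> cmod (\<mu> - z)"
proof
  define c where "c = min (sin ((\<beta> - \<rho>) / 2)) (sin ((pi + \<rho>) / 2))"
  show c: "c > 0" unfolding c_def using assms by (auto intro!: sin_gt_zero)
  fix \<mu> z assume \<mu>: "\<beta> \<le> \<bar>Arg \<mu>\<bar>" and z: "\<bar>Arg z\<bar> \<le> \<rho>"
  define \<psi> where "\<psi> = Arg \<mu> - Arg z"
  have \<psi>: "\<beta> - \<rho> \<le> \<bar>\<psi>\<bar>" "\<bar>\<psi>\<bar> \<le> pi + \<rho>" using \<mu> z abs_Arg_le_pi[of \<mu>] by (auto simp: \<psi>_def)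
  have "c \<le> sin (\<bar>\<psi>\<bar> / 2)"
    unfolding c_def using \<psi> assms by (intro sin_ge_min) auto
  then have "c\<^sup>2 \<le> (sin (\<bar>\<psi>\<bar> / 2))\<^sup>2" using c by (intro power_mono) auto
  also have "\<dots> = (sin (\<psi> / 2))\<^sup>2" by (cases "\<psi> \<ge> 0") auto
  also have "\<dots> = 1 - (cos (\<psi> / 2))\<^sup>2" by (simp add: sin_squared_eq)
  finally have c2: "c\<^sup>2 \<le> 1 - (cos (\<psi> / 2))\<^sup>2" .
  define a b where "a = cmod \<mu>" and "b = cmod z"
  have "(c * (a + b))\<^sup>2 \<le> (1 - (cos (\<psi> / 2))\<^sup>2) * (a + b)\<^sup>2"
    unfolding power_mult_distrib using c2 by (intro mult_right_mono) auto
  also have "\<dots> \<le> (a + b)\<^sup>2 - 4 * a * b * (cos (\<psi> / 2))\<^sup>2"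
  proof -
    have "4 * a * b \<le> (a + b)\<^sup>2" using zero_le_power2[of "a - b"] by (simp add: power2_eq_square algebra_simps)
    then have "4 * a * b * (cos (\<psi> / 2))\<^sup>2 \<le> (a + b)\<^sup>2 * (cos (\<psi> / 2))\<^sup>2"
      by (intro mult_right_mono) auto
    then show ?thesis by (simp add: algebra_simps)
  qed
  also have "\<dots> = (cmod (\<mu> - z))\<^sup>2"
    using norm_diff_polar[of a "Arg \<mu>" b "Arg z"] polar[of \<mu>] polar[of z] by (simp add: a_def b_def \<psi>_def)
  finally show "c * (cmod \<mu> + cmod z) \<le> cmod (\<mu> - z)"
    unfolding a_def b_def by (rule power2_le_imp_le) auto
qed

subsection \<open>The contour calculus of a resolvent family\<close>

lemma bounded_clinear_opD:
  assumes "bounded_clinear_op T"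
  shows "bounded_linear T" "T (c *\<^sub>C x) = c *\<^sub>C T x" "T (x + y) = T x + T y" "T (x - y) = T x - T y"
    "T 0 = 0" "T (- x) = - T x" "T (\<Sum>i\<in>I. X i) = (\<Sum>i\<in>I. T (X i))"
proof -
  show b: "bounded_linear T" and "T (c *\<^sub>C x) = c *\<^sub>C T x" using assms by (auto simp: bounded_clinear_op_def)
  interpret T: bounded_linear T by (rule b)
  show "T (x + y) = T x + T y" "T (x - y) = T x - T y" "T 0 = 0" "T (- x) = - T x"
    "T (\<Sum>i\<in>I. X i) = (\<Sum>i\<in>I. T (X i))"
    by (simp_all add: T.add T.diff T.zero T.sum linear_neg[OF T.linear])
qed

lemma bounded_clinear_op_add:
  "bounded_clinear_op S \<Longrightarrow> bounded_clinear_op T \<Longrightarrow> bounded_clinear_op (\<lambda>x. a *\<^sub>C S x + b *\<^sub>C T x)"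
  unfolding bounded_clinear_op_def
  by (auto intro!: bounded_linear_add bounded_linear_compose[OF scaleC.bounded_linear_right]
      simp: scaleC_add_right scaleC_scaleC mult.commute)

lemma bounded_clinear_op_compose:
  "bounded_clinear_op S \<Longrightarrow> bounded_clinear_op T \<Longrightarrow> bounded_clinear_op (\<lambda>x. S (T x))"
  unfolding bounded_clinear_op_def by (auto intro: bounded_linear_compose)

lemma dual_elem_comp:
  assumes l: "dual_elem l" and T: "bounded_clinear_op T"
  shows "dual_elem (\<lambda>x. l (T x))"
proof -
  have "bounded_linear (\<lambda>x. l (T x))"
    using bounded_linear_compose[OF dual_elemD(6)[OF l] bounded_clinear_opD(1)[OF T]] .
  then obtain K where "\<And>x. cmod (l (T x)) \<le> norm x * K" using bounded_linear.bounded by blast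
  then show ?thesis
    unfolding dual_elem_def
    by (auto simp: dual_elemD[OF l] bounded_clinear_opD[OF T] intro!: exI[of _ K] simp: mult.commute)
qed

lemma dual_elem_sum:
  assumes "dual_elem l"
  shows "l (\<Sum>i\<in>I. X i) = (\<Sum>i\<in>I. l (X i))"
  using bounded_linear.linear[OF dual_elemD(6)[OF assms]] by (rule linear_sum)

text \<open>Analyticity is asked for weakly, since the contour arguments are carried out after a
  functional has been applied; norm continuity is kept separately because it gives integrability of
  the vector-valued integrand.\<close>

definition bdd_analytic :: "complex set \<Rightarrow> (complex \<Rightarrow> 'a::complex_banach) \<Rightarrow> bool" where
  "bdd_analytic S V \<longleftrightarrow> continuous_on S V \<and> (\<forall>l. dual_elem l \<longrightarrow> (\<lambda>z. l (V z)) holomorphic_on S) \<and>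
     (\<exists>M. \<forall>z\<in>S. norm (V z) \<le> M)"

lemma bdd_analytic_const: "bdd_analytic S (\<lambda>_. x)"
  by (auto simp: bdd_analytic_def)

lemma bdd_analytic_cong:
  assumes "bdd_analytic S V" "\<And>z. z \<in> S \<Longrightarrow> V z = W z"
  shows "bdd_analytic S W"
proof -
  have "continuous_on S W" using assms by (auto simp: bdd_analytic_def cong: continuous_on_cong)
  moreover have "(\<lambda>z. l (W z)) holomorphic_on S" if "dual_elem l" for l
    using assms that by (auto simp: bdd_analytic_def cong: holomorphic_cong)
  ultimately show ?thesis using assms by (auto simp: bdd_analytic_def)
qed

lemma bdd_analytic_subset: "bdd_analytic S V \<Longrightarrow> T \<subseteq> S \<Longrightarrow> bdd_analytic T V"
  unfolding bdd_analytic_def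
  by (meson continuous_on_subset holomorphic_on_subset subset_iff)

text \<open>The exponent \<open>e = 1\<close> of \<open>decaying\<close>, written without
  \<open>powr\<close>. It covers every function that will be inserted, and it is stable under
  bounded multipliers such as \<open>1 / (\<mu> - z)\<close> with \<mu> outside the closed
  sector.\<close>

definition decay1 :: "real \<Rightarrow> (complex \<Rightarrow> complex) \<Rightarrow> bool" where
  "decay1 \<rho> g \<longleftrightarrow> g holomorphic_on sector \<rho> \<and>
     (\<exists>C. \<forall>z\<in>sector \<rho>. cmod (g z) \<le> C * (cmod z / (1 + (cmod z)\<^sup>2)))"

lemma decay1I:
  "g holomorphic_on sector \<rho> \<Longrightarrow> (\<And>z. z \<in> sector \<rho> \<Longrightarrow> cmod (g z) \<le> C * (cmod z / (1 + (cmod z)\<^sup>2))) \<Longrightarrow> decay1 \<rho> g"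
  by (auto simp: decay1_def)

lemma decay1E:
  assumes "decay1 \<rho> g"
  obtains C where "C \<ge> 0" "\<And>z. z \<in> sector \<rho> \<Longrightarrow> cmod (g z) \<le> C * (cmod z / (1 + (cmod z)\<^sup>2))"
proof -
  from assms obtain C where C: "\<forall>z\<in>sector \<rho>. cmod (g z) \<le> C * (cmod z / (1 + (cmod z)\<^sup>2))"
    by (auto simp: decay1_def)
  have "cmod (g z) \<le> \<bar>C\<bar> * (cmod z / (1 + (cmod z)\<^sup>2))" if "z \<in> sector \<rho>" for z
    using C that by (intro order_trans[OF bspec[OF C that]] mult_right_mono) auto
  then show ?thesis using that[of "\<bar>C\<bar>"] by auto
qed

lemma decay1_holomorphic: "decay1 \<rho> g \<Longrightarrow> g holomorphic_on sector \<rho>"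
  by (simp add: decay1_def)

lemma decay1_mult_bounded:
  assumes "decay1 \<rho> g" "u holomorphic_on sector \<rho>" "\<And>z. z \<in> sector \<rho> \<Longrightarrow> cmod (u z) \<le> M"
  shows "decay1 \<rho> (\<lambda>z. u z * g z)"
proof -
  obtain C where C: "C \<ge> 0" "\<And>z. z \<in> sector \<rho> \<Longrightarrow> cmod (g z) \<le> C * (cmod z / (1 + (cmod z)\<^sup>2))"
    using decay1E[OF assms(1)] by metis
  show ?thesis
  proof (rule decay1I[of _ _ "\<bar>M\<bar> * C"])
    show "(\<lambda>z. u z * g z) holomorphic_on sector \<rho>"
      using assms(2) decay1_holomorphic[OF assms(1)] by (rule holomorphic_on_mult)
    show "cmod (u z * g z) \<le> \<bar>M\<bar> * C * (cmod z / (1 + (cmod z)\<^sup>2))" if "z \<in> sector \<rho>" for z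
      unfolding norm_mult mult.assoc using assms(3)[OF that] C(2)[OF that]
      by (intro mult_mono) auto
  qed
qed

lemma decay1_mult:
  assumes h: "decay1 \<rho> h" and g: "decay1 \<rho> g"
  shows "decay1 \<rho> (\<lambda>z. h z * g z)"
proof -
  obtain c where c: "c \<ge> 0" "\<And>z. z \<in> sector \<rho> \<Longrightarrow> cmod (h z) \<le> c * (cmod z / (1 + (cmod z)\<^sup>2))"
    using decay1E[OF h] by metis
  have "cmod (h z) \<le> c" if "z \<in> sector \<rho>" for z
  proof -
    have "0 \<le> (cmod z - 1)\<^sup>2 + (cmod z)\<^sup>2 + 1" by simp
    then have "cmod z \<le> 1 + (cmod z)\<^sup>2" by (simp add: power2_eq_square algebra_simps)
    then have "cmod z / (1 + (cmod z)\<^sup>2) \<le> 1" by (simp add: divide_le_eq_1 add_pos_nonneg)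
    from mult_left_mono[OF this c(1)] show ?thesis using c(2)[OF that] by simp
  qed
  then show ?thesis by (rule decay1_mult_bounded[OF g decay1_holomorphic[OF h]])
qed

lemma decay1_add:
  assumes "decay1 \<rho> g" "decay1 \<rho> h"
  shows "decay1 \<rho> (\<lambda>z. g z + h z)"
proof -
  obtain C where C: "C \<ge> 0" "\<And>z. z \<in> sector \<rho> \<Longrightarrow> cmod (g z) \<le> C * (cmod z / (1 + (cmod z)\<^sup>2))"
    using decay1E[OF assms(1)] by metis
  obtain D where D: "D \<ge> 0" "\<And>z. z \<in> sector \<rho> \<Longrightarrow> cmod (h z) \<le> D * (cmod z / (1 + (cmod z)\<^sup>2))"
    using decay1E[OF assms(2)] by metis
  show ?thesis
  proof (rule decay1I[of _ _ "C + D"])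
    show "(\<lambda>z. g z + h z) holomorphic_on sector \<rho>"
      using assms by (auto simp: decay1_def intro: holomorphic_on_add)
    show "cmod (g z + h z) \<le> (C + D) * (cmod z / (1 + (cmod z)\<^sup>2))" if "z \<in> sector \<rho>" for z
      unfolding distrib_right using C(2)[OF that] D(2)[OF that]
      by (intro order_trans[OF norm_triangle_ineq add_mono]) auto
  qed
qed

lemma decay1_cmult: "decay1 \<rho> g \<Longrightarrow> decay1 \<rho> (\<lambda>z. c * g z)"
  using decay1_mult_bounded[of \<rho> g "\<lambda>_. c" "cmod c"] by simp

lemma decay1_0: "decay1 \<rho> (\<lambda>z. 0)"
  by (rule decay1I[of _ _ 0]) auto

lemma decay1_sum: "(\<And>i. i \<in> I \<Longrightarrow> decay1 \<rho> (g i)) \<Longrightarrow> decay1 \<rho> (\<lambda>z. \<Sum>i\<in>I. g i z)"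
  by (induction I rule: infinite_finite_induct) (auto intro: decay1_add decay1_0)

lemma decay1_decaying:
  assumes "decay1 \<rho> g"
  shows "decaying \<rho> g"
proof -
  obtain C where C: "\<And>z. z \<in> sector \<rho> \<Longrightarrow> cmod (g z) \<le> C * (cmod z / (1 + (cmod z)\<^sup>2))"
    using decay1E[OF assms] by metis
  have "cmod (g z) \<le> C * (cmod z / (1 + (cmod z)\<^sup>2)) powr 1" if "z \<in> sector \<rho>" for z
    using C[OF that] by (simp add: divide_nonneg_nonneg)
  then show ?thesis
    unfolding decaying_def using decay1_holomorphic[OF assms] zero_less_one by blast
qed

text \<open>There is no singularity inside the sector, so the rays can be turned down to the
  positive half-line, where they cancel.\<close>

lemma cint_sector_eq_0:
  assumes "0 \<le> \<nu>" "\<nu> < \<rho>" "\<rho> \<le> pi" and hol: "u holomorphic_on sector \<rho>"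
    and bnd: "\<And>z. z \<in> sector \<rho> \<Longrightarrow> cmod (u z) \<le> C / (1 + (cmod z)\<^sup>2)"
  shows "cint \<nu> u = 0"
proof -
  have rays: "of_real r * cis \<phi> \<in> sector \<rho>" "of_real r * cis (- \<phi>) \<in> sector \<rho>"
    if "r > 0" "\<phi> \<in> {0..\<nu>}" for r \<phi>
    using that assms by (auto intro!: polar_in_sector)
  interpret contour_fun "sector \<rho>" u C 0
    using bnd holomorphic_on_imp_continuous_on[OF hol] assms
    by unfold_locales (auto intro!: bpath_in_sector)
  have "cint 0 u = cint \<nu> u"
    by (rule cint_rotate[OF open_sector[OF assms(3)] hol _ _ rays]) (use assms bnd in auto)
  then show ?thesis using cint_eq_0_if_rays_coincide by simp
qed

lemma pole_bound:
  assumes "0 \<le> \<rho>" "\<mu> \<noteq> 0" "\<rho> < \<bar>Arg \<mu>\<bar>"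
  obtains c where "c > 0" "\<And>z. z \<in> sector \<rho> \<Longrightarrow> c \<le> cmod (\<mu> - z) \<and> c * cmod z \<le> cmod (\<mu> - z) \<and> \<mu> - z \<noteq> 0"
proof -
  obtain c where c: "c > 0"
    "\<And>\<nu> z. \<bar>Arg \<mu>\<bar> \<le> \<bar>Arg \<nu>\<bar> \<Longrightarrow> \<bar>Arg z\<bar> \<le> \<rho> \<Longrightarrow> c * (cmod \<nu> + cmod z) \<le> cmod (\<nu> - z)"
    using sector_separation[OF assms(1,3) abs_Arg_le_pi] by metis
  show ?thesis
  proof (rule that[of "min c (c * cmod \<mu>)"])
    show pos: "0 < min c (c * cmod \<mu>)" using c(1) assms by simp
    fix z assume z: "z \<in> sector \<rho>"
    have le: "c * cmod \<mu> + c * cmod z \<le> cmod (\<mu> - z)"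
      using c(2)[of \<mu> z] z by (simp add: sector_def distrib_left)
    have "0 \<le> c * cmod z" "0 < c * cmod \<mu>" using c(1) assms by auto
    moreover have "min c (c * cmod \<mu>) * cmod z \<le> c * cmod z" by (intro mult_right_mono) auto
    ultimately have "min c (c * cmod \<mu>) \<le> cmod (\<mu> - z)" "min c (c * cmod \<mu>) * cmod z \<le> cmod (\<mu> - z)"
      using le by linarith+
    moreover have "\<mu> - z \<noteq> 0" using calculation(1) pos by auto
    ultimately show "min c (c * cmod \<mu>) \<le> cmod (\<mu> - z) \<and> min c (c * cmod \<mu>) * cmod z \<le> cmod (\<mu> - z) \<and> \<mu> - z \<noteq> 0"
      by blast
  qed
qed

lemma decay1_div:
  assumes "decay1 \<rho> g" "0 \<le> \<rho>" "\<mu> \<noteq> 0" "\<rho> < \<bar>Arg \<mu>\<bar>"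
  shows "decay1 \<rho> (\<lambda>z. g z / (\<mu> - z))"
proof -
  obtain c where c: "c > 0" "\<And>z. z \<in> sector \<rho> \<Longrightarrow> c \<le> cmod (\<mu> - z) \<and> c * cmod z \<le> cmod (\<mu> - z) \<and> \<mu> - z \<noteq> 0"
    using pole_bound[OF assms(2-4)] by metis
  have "decay1 \<rho> (\<lambda>z. inverse (\<mu> - z) * g z)"
  proof (rule decay1_mult_bounded[OF assms(1)])
    show "(\<lambda>z. inverse (\<mu> - z)) holomorphic_on sector \<rho>"
      using c by (intro holomorphic_intros) auto
    show "cmod (inverse (\<mu> - z)) \<le> inverse c" if "z \<in> sector \<rho>" for z
      using c(1) c(2)[OF that] by (simp add: norm_inverse le_imp_inverse_le)
  qed
  then show ?thesis by (simp add: divide_inverse mult.commute)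
qed

text \<open>What the contour calculus uses of an operator: its domain does not appear, only the
  resolvent identity and the bound \<open>K / |z|\<close>. That bound is guaranteed only strictly
  beyond the angle of the operator, so \<alpha> will be chosen larger than
  \<open>sect_angle\<close>.\<close>

locale resolvent_family =
  fixes R :: "complex \<Rightarrow> 'a::complex_banach \<Rightarrow> 'a" and \<alpha> K :: real
  assumes \<alpha>: "0 \<le> \<alpha>" "\<alpha> < pi"
    and R_lin: "\<And>z. z \<in> cosector \<alpha> \<Longrightarrow> bounded_clinear_op (R z)"
    and R_ident: "\<And>z w x. z \<in> cosector \<alpha> \<Longrightarrow> w \<in> cosector \<alpha> \<Longrightarrow> R z x - R w x = (w - z) *\<^sub>C R z (R w x)"
    and R_bound: "\<And>z x. z \<in> cosector \<alpha> \<Longrightarrow> norm (R z x) \<le> K / cmod z * norm x"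
    and K: "0 \<le> K"
begin

lemma R_commute:
  assumes "z \<in> cosector \<alpha>" "w \<in> cosector \<alpha>"
  shows "R z (R w x) = R w (R z x)"
proof (cases "z = w")
  case False
  have "(w - z) *\<^sub>C R z (R w x) = - ((z - w) *\<^sub>C R w (R z x))"
    using R_ident[OF assms, of x] R_ident[OF assms(2,1), of x] by (metis minus_diff_eq)
  also have "\<dots> = (w - z) *\<^sub>C R w (R z x)"
    by (metis minus_diff_eq scaleC.minus_left)
  finally show ?thesis using False by simp
qed simp

lemma R_continuous:
  assumes S: "S \<subseteq> cosector \<alpha>" and V: "continuous_on S V"
  shows "continuous_on S (\<lambda>z. R z (V z))"
  unfolding continuous_on_def
proof
  fix w assume w: "w \<in> S"
  have w0: "w \<noteq> 0" using w S by (auto simp: cosector_def)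
  have lim: "(V \<longlongrightarrow> V w) (at w within S)" using V w by (simp add: continuous_on_def)
  define b where "b = (\<lambda>z. K / cmod z * norm (V z - V w) + cmod (w - z) * (K / cmod z * norm (R w (V w))))"
  have "(b \<longlongrightarrow> K / cmod w * norm (V w - V w) + cmod (w - w) * (K / cmod w * norm (R w (V w)))) (at w within S)"
    unfolding b_def using w0 by (intro tendsto_intros lim) auto
  then have b: "(b \<longlongrightarrow> 0) (at w within S)" by simp
  have "\<forall>\<^sub>F z in at w within S. norm (R z (V z) - R w (V w)) \<le> b z"
    unfolding eventually_at_filter
  proof (intro always_eventually allI impI)
    fix z assume "z \<in> S"
    then have z: "z \<in> cosector \<alpha>" and wo: "w \<in> cosector \<alpha>" using S w by auto
    have "R z (V z) - R w (V w) = R z (V z - V w) + (R z (V w) - R w (V w))"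
      by (simp add: bounded_clinear_opD[OF R_lin[OF z]])
    also have "R z (V w) - R w (V w) = (w - z) *\<^sub>C R z (R w (V w))" by (rule R_ident[OF z wo])
    finally show "norm (R z (V z) - R w (V w)) \<le> b z"
      unfolding b_def
      using R_bound[OF z, of "V z - V w"] mult_left_mono[OF R_bound[OF z, of "R w (V w)"], of "cmod (w - z)"]
      by (simp only: norm_scaleC norm_ge_zero order_trans[OF norm_triangle_ineq] add_mono)
  qed
  then have "((\<lambda>z. R z (V z) - R w (V w)) \<longlongrightarrow> 0) (at w within S)"
    by (rule Lim_null_comparison) (rule b)
  then show "((\<lambda>z. R z (V z)) \<longlongrightarrow> R w (V w)) (at w within S)"
    by (simp add: Lim_null[symmetric])
qed

text \<open>The difference quotient is split at \<open>R w (V z)\<close>. The resolvent identity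
  turns one part into \<open>- l (R z (R w (V z)))\<close>, which converges by continuity; the other
  is the difference quotient of \<open>V\<close> under the functional \<open>l\<close> after
  \<open>R w\<close>, which converges by weak analyticity.\<close>

lemma R_holomorphic:
  assumes S: "S \<subseteq> cosector \<alpha>" "open S" and V: "bdd_analytic S V" and l: "dual_elem l"
  shows "(\<lambda>z. l (R z (V z))) holomorphic_on S"
  unfolding holomorphic_on_def
proof
  fix w assume w: "w \<in> S"
  then have wo: "w \<in> cosector \<alpha>" using S by auto
  have cV: "continuous_on S V" using V by (simp add: bdd_analytic_def)
  have "(\<lambda>z. l (R w (V z))) holomorphic_on S"
    using V dual_elem_comp[OF l R_lin[OF wo]] by (auto simp: bdd_analytic_def)
  then obtain D where "((\<lambda>z. l (R w (V z))) has_field_derivative D) (at w)"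
    using S(2) w by (meson holomorphic_on_imp_differentiable_at field_differentiable_def)
  then have lim1: "((\<lambda>z. (l (R w (V z)) - l (R w (V w))) / (z - w)) \<longlongrightarrow> D) (at w)"
    by (simp add: has_field_derivative_iff)
  have "continuous_on S (\<lambda>z. R w (V z))"
    using bounded_clinear_opD(1)[OF R_lin[OF wo]] cV by (rule bounded_linear.continuous_on)
  then have "continuous_on S (\<lambda>z. R z (R w (V z)))" by (rule R_continuous[OF S(1)])
  then have "continuous_on S (\<lambda>z. l (R z (R w (V z))))"
    by (rule bounded_linear.continuous_on[OF dual_elemD(6)[OF l]])
  then have lim2: "((\<lambda>z. l (R z (R w (V z)))) \<longlongrightarrow> l (R w (R w (V w)))) (at w)"
    using S(2) w by (simp add: continuous_on_eq_continuous_at isCont_def)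
  have "((\<lambda>z. (l (R z (V z)) - l (R w (V w))) / (z - w)) \<longlongrightarrow> - l (R w (R w (V w))) + D) (at w)"
  proof (rule Lim_transform_within_open[OF tendsto_add[OF tendsto_minus[OF lim2] lim1] S(2) w])
    fix z assume z: "z \<in> S" "z \<noteq> w"
    then have zo: "z \<in> cosector \<alpha>" using S by auto
    have "l (R z (V z)) - l (R w (V z)) = (w - z) * l (R z (R w (V z)))"
      using R_ident[OF zo wo, of "V z"] by (metis dual_elemD(2,5)[OF l])
    then have "l (R z (V z)) - l (R w (V w)) = - (z - w) * l (R z (R w (V z))) + (l (R w (V z)) - l (R w (V w)))"
      by (simp add: algebra_simps)
    then show "- l (R z (R w (V z))) + (l (R w (V z)) - l (R w (V w))) / (z - w)
        = (l (R z (V z)) - l (R w (V w))) / (z - w)"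
      using z(2) by (simp add: field_simps)
  qed
  then have "((\<lambda>z. l (R z (V z))) has_field_derivative - l (R w (R w (V w))) + D) (at w)"
    by (simp add: has_field_derivative_iff)
  then show "(\<lambda>z. l (R z (V z))) field_differentiable (at w within S)"
    by (meson field_differentiable_def field_differentiable_at_within)
qed

text \<open>The calculus with a vector function under the resolvent. A constant \<open>V\<close>
  gives the usual \<open>g(A) x\<close>; taking for \<open>V z\<close> the regularized
  \<open>f(z, B) x\<close> turns the double contour integral into a single one.\<close>

definition I :: "real \<Rightarrow> (complex \<Rightarrow> complex) \<Rightarrow> (complex \<Rightarrow> 'a) \<Rightarrow> 'a" where
  "I \<nu> g V = (1 / (2 * pi * \<i>)) *\<^sub>C
     integral UNIV (\<lambda>t. (g (bpath \<nu> t) * bpath' \<nu> t) *\<^sub>C R (bpath \<nu> t) (V (bpath \<nu> t)))"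

context
  fixes \<nu> \<rho> :: real
  assumes \<nu>: "\<alpha> < \<nu>" "\<nu> < \<rho>" "\<rho> \<le> pi"
begin

lemma I_integrand_bound:
  assumes g: "decay1 \<rho> g" and V: "bdd_analytic (sector \<rho>) V"
  obtains C where "C \<ge> 0" "\<And>z. z \<in> sector \<rho> \<inter> cosector \<alpha> \<Longrightarrow> norm (g z *\<^sub>C R z (V z)) \<le> C / (1 + (cmod z)\<^sup>2)"
proof -
  obtain C where C: "C \<ge> 0" "\<And>z. z \<in> sector \<rho> \<Longrightarrow> cmod (g z) \<le> C * (cmod z / (1 + (cmod z)\<^sup>2))"
    using decay1E[OF g] by metis
  obtain M where M: "\<And>z. z \<in> sector \<rho> \<Longrightarrow> norm (V z) \<le> M" using V by (auto simp: bdd_analytic_def)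
  show ?thesis
  proof (rule that[of "C * K * \<bar>M\<bar>"])
    fix z assume z: "z \<in> sector \<rho> \<inter> cosector \<alpha>"
    then have z0: "z \<noteq> 0" by (auto simp: cosector_def)
    have "norm (g z *\<^sub>C R z (V z)) \<le> (C * (cmod z / (1 + (cmod z)\<^sup>2))) * (K / cmod z * norm (V z))"
      unfolding norm_scaleC using C z R_bound[of z "V z"] by (intro mult_mono) auto
    also have "\<dots> = C * K / (1 + (cmod z)\<^sup>2) * norm (V z)" using z0 by (simp add: field_simps)
    also have "\<dots> \<le> C * K / (1 + (cmod z)\<^sup>2) * \<bar>M\<bar>"
      using M[of z] z C K by (intro mult_left_mono) (auto simp: divide_nonneg_nonneg)
    finally show "norm (g z *\<^sub>C R z (V z)) \<le> C * K * \<bar>M\<bar> / (1 + (cmod z)\<^sup>2)" by simp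
  qed (use C K in auto)
qed

lemma bpath_mem: "t \<noteq> 0 \<Longrightarrow> bpath \<nu> t \<in> sector \<rho> \<inter> cosector \<alpha>"
  using \<nu> \<alpha> bpath_in_sector[of t \<nu> \<rho>] bpath_in_cosector[of t \<nu> \<alpha>] by auto

lemma I_integrable:
  assumes g: "decay1 \<rho> g" and V: "bdd_analytic (sector \<rho>) V"
  shows "(\<lambda>t. (g (bpath \<nu> t) * bpath' \<nu> t) *\<^sub>C R (bpath \<nu> t) (V (bpath \<nu> t))) integrable_on UNIV"
proof -
  obtain C where C: "\<And>z. z \<in> sector \<rho> \<inter> cosector \<alpha> \<Longrightarrow> norm (g z *\<^sub>C R z (V z)) \<le> C / (1 + (cmod z)\<^sup>2)"
    using I_integrand_bound[OF g V] by metis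
  show ?thesis
  proof (rule integrable_on_UNIV_decay[of _ C])
    have "continuous_on (sector \<rho> \<inter> cosector \<alpha>) V"
      using V by (auto simp: bdd_analytic_def intro: continuous_on_subset)
    then have "continuous_on (sector \<rho> \<inter> cosector \<alpha>) (\<lambda>z. R z (V z))" by (intro R_continuous) auto
    then have c1: "continuous_on (- {0}) (\<lambda>t. R (bpath \<nu> t) (V (bpath \<nu> t)))"
      by (rule continuous_on_compose2[OF _ continuous_on_bpath]) (use bpath_mem in auto)
    have c2: "continuous_on (- {0}) (\<lambda>t. g (bpath \<nu> t))"
      by (rule continuous_on_compose2[OF holomorphic_on_imp_continuous_on[OF decay1_holomorphic[OF g]] continuous_on_bpath])
        (use bpath_mem in auto)
    show "continuous_on (- {0}) (\<lambda>t. (g (bpath \<nu> t) * bpath' \<nu> t) *\<^sub>C R (bpath \<nu> t) (V (bpath \<nu> t)))"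
      by (intro scaleC.continuous_on continuous_on_mult c1 c2 continuous_on_bpath')
    show "norm ((g (bpath \<nu> t) * bpath' \<nu> t) *\<^sub>C R (bpath \<nu> t) (V (bpath \<nu> t))) \<le> C / (1 + t\<^sup>2)"
      if "t \<noteq> 0" for t
      using C[OF bpath_mem[OF that]] by (simp add: norm_scaleC norm_mult)
  qed
qed

lemma dual_I:
  assumes g: "decay1 \<rho> g" and V: "bdd_analytic (sector \<rho>) V" and l: "dual_elem l"
  shows "l (I \<nu> g V) = 1 / (2 * pi * \<i>) * cint \<nu> (\<lambda>z. g z * l (R z (V z)))"
proof -
  have "l (integral UNIV (\<lambda>t. (g (bpath \<nu> t) * bpath' \<nu> t) *\<^sub>C R (bpath \<nu> t) (V (bpath \<nu> t))))
      = integral UNIV (l \<circ> (\<lambda>t. (g (bpath \<nu> t) * bpath' \<nu> t) *\<^sub>C R (bpath \<nu> t) (V (bpath \<nu> t))))"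
    by (rule integral_linear[symmetric, OF I_integrable[OF g V] dual_elemD(6)[OF l]])
  also have "\<dots> = cint \<nu> (\<lambda>z. g z * l (R z (V z)))"
    by (simp add: cint_def o_def dual_elemD[OF l] mult.assoc mult.commute[of "bpath' _ _"])
  finally show ?thesis by (simp add: I_def dual_elemD[OF l])
qed

lemma contour_fun_I:
  assumes g: "decay1 \<rho> g" and V: "bdd_analytic (sector \<rho>) V" and l: "dual_elem l"
  obtains C where "contour_fun (sector \<rho> \<inter> cosector \<alpha>) (\<lambda>z. g z * l (R z (V z))) C \<nu>"
    "(\<lambda>z. g z * l (R z (V z))) holomorphic_on sector \<rho> \<inter> cosector \<alpha>"
proof -
  obtain C where C: "\<And>z. z \<in> sector \<rho> \<inter> cosector \<alpha> \<Longrightarrow> norm (g z *\<^sub>C R z (V z)) \<le> C / (1 + (cmod z)\<^sup>2)"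
    using I_integrand_bound[OF g V] by metis
  obtain L where L: "L \<ge> 0" "\<And>x. cmod (l x) \<le> norm x * L"
    using bounded_linear.nonneg_bounded[OF dual_elemD(6)[OF l]] by auto
  have op: "open (sector \<rho> \<inter> cosector \<alpha>)" using open_sector open_cosector \<alpha> \<nu> by auto
  have hol: "(\<lambda>z. g z * l (R z (V z))) holomorphic_on sector \<rho> \<inter> cosector \<alpha>"
    by (intro holomorphic_on_mult holomorphic_on_subset[OF decay1_holomorphic[OF g]] R_holomorphic op l
        bdd_analytic_subset[OF V]) auto
  have "contour_fun (sector \<rho> \<inter> cosector \<alpha>) (\<lambda>z. g z * l (R z (V z))) (C * L) \<nu>"
  proof
    fix z assume z: "z \<in> sector \<rho> \<inter> cosector \<alpha>"
    have "cmod (g z * l (R z (V z))) = cmod (l (g z *\<^sub>C R z (V z)))" by (simp add: dual_elemD[OF l])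
    also have "\<dots> \<le> norm (g z *\<^sub>C R z (V z)) * L" by (rule L)
    also have "\<dots> \<le> C / (1 + (cmod z)\<^sup>2) * L" using C[OF z] L by (intro mult_right_mono) auto
    finally show "cmod (g z * l (R z (V z))) \<le> C * L / (1 + (cmod z)\<^sup>2)" by simp
  qed (use bpath_mem hol in \<open>auto intro: holomorphic_on_imp_continuous_on\<close>)
  then show ?thesis using that hol by blast
qed

lemma I_lincomb:
  assumes g: "decay1 \<rho> g" and h: "decay1 \<rho> h" and V: "bdd_analytic (sector \<rho>) V"
  shows "I \<nu> (\<lambda>z. a * g z + b * h z) V = a *\<^sub>C I \<nu> g V + b *\<^sub>C I \<nu> h V"
proof -
  let ?k = "\<lambda>g t. (g (bpath \<nu> t) * bpath' \<nu> t) *\<^sub>C R (bpath \<nu> t) (V (bpath \<nu> t))"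
  have sc: "(\<lambda>t. c *\<^sub>C k t) integrable_on UNIV" "integral UNIV (\<lambda>t. c *\<^sub>C k t) = c *\<^sub>C integral UNIV k"
    if "k integrable_on UNIV" for k :: "real \<Rightarrow> 'a" and c
    using integrable_linear[OF that scaleC.bounded_linear_right] integral_linear[OF that scaleC.bounded_linear_right]
    by (simp_all add: o_def)
  have "?k (\<lambda>z. a * g z + b * h z) t = a *\<^sub>C ?k g t + b *\<^sub>C ?k h t" for t
    by (simp add: scaleC_add_left distrib_right scaleC_scaleC mult.assoc)
  then have "integral UNIV (?k (\<lambda>z. a * g z + b * h z)) = integral UNIV (\<lambda>t. a *\<^sub>C ?k g t + b *\<^sub>C ?k h t)"
    by presburger
  also have "\<dots> = a *\<^sub>C integral UNIV (?k g) + b *\<^sub>C integral UNIV (?k h)"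
    using Henstock_Kurzweil_Integration.integral_add[OF sc(1)[OF I_integrable[OF g V]] sc(1)[OF I_integrable[OF h V]]]
    unfolding sc(2)[OF I_integrable[OF g V]] sc(2)[OF I_integrable[OF h V]] .
  finally show ?thesis by (simp add: I_def scaleC_add_right scaleC_scaleC mult.commute)
qed

text \<open>The resolvent identity splits the integrand, after division by \<open>\<mu> - z\<close>,
  into one part with \<open>R z (V z)\<close> and one with \<open>R \<mu> (V z)\<close>. The second
  is holomorphic throughout the sector and integrates to \<open>0\<close>. The multiplication rules
  for \<open>J\<close>, \<open>H\<close> and \<open>P\<close> are all derived from this one.\<close>

lemma I_resolvent:
  assumes g: "decay1 \<rho> g" and V: "bdd_analytic (sector \<rho>) V" and \<mu>: "\<mu> \<noteq> 0" "\<rho> < \<bar>Arg \<mu>\<bar>"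
  shows "R \<mu> (I \<nu> g V) = I \<nu> (\<lambda>z. g z / (\<mu> - z)) V"
proof (rule eq_by_dual)
  fix l :: "'a \<Rightarrow> complex" assume l: "dual_elem l"
  have \<mu>o: "\<mu> \<in> cosector \<alpha>" using \<mu> \<nu> by (auto simp: cosector_def)
  have \<rho>0: "0 \<le> \<rho>" using \<nu> \<alpha> by linarith
  have l': "dual_elem (\<lambda>x. l (R \<mu> x))" by (rule dual_elem_comp[OF l R_lin[OF \<mu>o]])
  have gd: "decay1 \<rho> (\<lambda>z. g z / (\<mu> - z))" by (rule decay1_div[OF g \<rho>0 \<mu>])
  obtain c where c: "c > 0" "\<And>z. z \<in> sector \<rho> \<Longrightarrow> c \<le> cmod (\<mu> - z) \<and> c * cmod z \<le> cmod (\<mu> - z) \<and> \<mu> - z \<noteq> 0"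
    using pole_bound[OF \<rho>0 \<mu>] by metis
  define v where "v = (\<lambda>z. g z / (\<mu> - z) * l (R \<mu> (V z)))"
  have vhol: "v holomorphic_on sector \<rho>"
    unfolding v_def using V l'
    by (intro holomorphic_on_mult decay1_holomorphic[OF gd]) (auto simp: bdd_analytic_def)
  obtain C where C: "C \<ge> 0" "\<And>z. z \<in> sector \<rho> \<Longrightarrow> cmod (g z) \<le> C * (cmod z / (1 + (cmod z)\<^sup>2))"
    using decay1E[OF g] by metis
  obtain M where M: "\<And>z. z \<in> sector \<rho> \<Longrightarrow> norm (V z) \<le> M" using V by (auto simp: bdd_analytic_def)
  obtain L where L: "L \<ge> 0" "\<And>x. cmod (l (R \<mu> x)) \<le> norm x * L"
    using bounded_linear.nonneg_bounded[OF dual_elemD(6)[OF l']] by auto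
  have vbd: "cmod (v z) \<le> C * \<bar>M\<bar> * L / c / (1 + (cmod z)\<^sup>2)" if z: "z \<in> sector \<rho>" for z
  proof -
    have z0: "z \<noteq> 0" using z by (auto simp: sector_def)
    have "cmod (v z) = cmod (g z) / cmod (\<mu> - z) * cmod (l (R \<mu> (V z)))" by (simp add: v_def norm_mult norm_divide)
    also have "\<dots> \<le> (C * (cmod z / (1 + (cmod z)\<^sup>2))) / (c * cmod z) * (\<bar>M\<bar> * L)"
    proof (intro mult_mono frac_le)
      have "norm (V z) * L \<le> \<bar>M\<bar> * L" using M[OF z] L by (intro mult_right_mono) auto
      then show "cmod (l (R \<mu> (V z))) \<le> \<bar>M\<bar> * L" using L(2)[of "V z"] by linarith
    qed (use C c z z0 in auto)
    also have "\<dots> = C * \<bar>M\<bar> * L / c / (1 + (cmod z)\<^sup>2)" using z0 c(1) by (simp add: ac_simps)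
    finally show ?thesis .
  qed
  have pos: "0 < \<nu>" "\<nu> < pi" using \<nu> \<alpha> by auto
  have v0: "cint \<nu> v = 0"
    by (rule cint_sector_eq_0[OF _ \<nu>(2,3) vhol vbd]) (use pos in auto)
  have vint: "(\<lambda>t. v (bpath \<nu> t) * bpath' \<nu> t) integrable_on UNIV"
  proof -
    interpret contour_fun "sector \<rho>" v "C * \<bar>M\<bar> * L / c" \<nu>
      using vbd holomorphic_on_imp_continuous_on[OF vhol] \<nu> pos
      by unfold_locales (auto intro!: bpath_in_sector)
    show ?thesis by (rule integrable)
  qed
  define w where "w = (\<lambda>z. g z / (\<mu> - z) * l (R z (V z)))"
  have wint: "(\<lambda>t. w (bpath \<nu> t) * bpath' \<nu> t) integrable_on UNIV"
    unfolding w_def using contour_fun_I[OF gd V l] contour_fun.integrable by blast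
  have eq: "g z * l (R \<mu> (R z (V z))) = w z - v z" if z: "z \<in> sector \<rho> \<inter> cosector \<alpha>" for z
  proof -
    have zo: "z \<in> cosector \<alpha>" using z by simp
    have "R \<mu> (R z (V z)) = R z (R \<mu> (V z))" by (rule R_commute[OF \<mu>o zo])
    then have "R z (V z) - R \<mu> (V z) = (\<mu> - z) *\<^sub>C R \<mu> (R z (V z))" using R_ident[OF zo \<mu>o] by simp
    then have "l (R z (V z)) - l (R \<mu> (V z)) = (\<mu> - z) * l (R \<mu> (R z (V z)))"
      by (metis dual_elemD(2,5)[OF l])
    then have "w z - v z = g z / (\<mu> - z) * ((\<mu> - z) * l (R \<mu> (R z (V z))))"
      unfolding w_def v_def by (simp only: right_diff_distrib[symmetric])
    then show ?thesis using c(2)[of z] z by simp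
  qed
  have "cint \<nu> (\<lambda>z. g z * l (R \<mu> (R z (V z)))) = integral UNIV (\<lambda>t. w (bpath \<nu> t) * bpath' \<nu> t - v (bpath \<nu> t) * bpath' \<nu> t)"
    unfolding cint_def using eq[OF bpath_mem] by (intro integral_spike[of "{0}"]) (auto simp: left_diff_distrib)
  also have "\<dots> = cint \<nu> w - cint \<nu> v"
    unfolding cint_def by (rule Henstock_Kurzweil_Integration.integral_diff[OF wint vint])
  finally have "cint \<nu> (\<lambda>z. g z * l (R \<mu> (R z (V z)))) = cint \<nu> w" by (simp add: v0)
  then show "l (R \<mu> (I \<nu> g V)) = l (I \<nu> (\<lambda>z. g z / (\<mu> - z)) V)"
    unfolding dual_I[OF g V l'] dual_I[OF gd V l] w_def by simp
qed

end

end

section \<open>A residue on the real axis and rational functions of the operator\<close>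

lemma inverse_1_plus_square_le:
  fixes r s :: real
  assumes "s > 0" "r \<ge> 0"
  shows "1 / (s + r)\<^sup>2 \<le> (1 / min 1 (s\<^sup>2)) / (1 + r\<^sup>2)"
proof -
  define m where "m = min 1 (s\<^sup>2)"
  have m: "m > 0" "m \<le> 1" "m \<le> s\<^sup>2" using assms by (auto simp: m_def)
  have "m * r\<^sup>2 \<le> 1 * r\<^sup>2" using m by (intro mult_right_mono) auto
  moreover have "s\<^sup>2 + r\<^sup>2 \<le> (s + r)\<^sup>2" using assms by (simp add: power2_eq_square algebra_simps)
  ultimately have "m * (1 + r\<^sup>2) \<le> (s + r)\<^sup>2" using m(3) by (simp add: distrib_left)
  moreover have "0 < m * (1 + r\<^sup>2)" using m by (simp add: add_pos_nonneg)
  ultimately have "1 / (s + r)\<^sup>2 \<le> 1 / (m * (1 + r\<^sup>2))" by (intro frac_le) simp_all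
  then show ?thesis by (simp add: m_def)
qed

text \<open>The residue \<open>1\<close> at \<open>s\<close>, obtained by hand: the rays are turned
  to the imaginary axis and \<open>s\<close> is scaled away, which leaves the integral of
  \<open>2 i / (1 + t^2)\<close>. The pole at \<open>- s\<close> lies outside the contour and is
  subtracted to obtain quadratic decay.\<close>

lemma cint_two_poles:
  assumes \<nu>: "0 < \<nu>" "\<nu> < pi" and s: "s > 0"
  shows "((\<lambda>t. (1 / (bpath \<nu> t - of_real s) - 1 / (of_real s + bpath \<nu> t)) * bpath' \<nu> t) has_integral 2 * pi * \<i>) UNIV"
proof -
  define u where "u = (\<lambda>z. 1 / (z - of_real s) - 1 / (of_real s + z) :: complex)"
  \<comment> \<open>The wedge has to contain both the given angle and \<open>pi / 2\<close> while
    avoiding the two poles on the real axis.\<close>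
  define a b where "a = min \<nu> (pi / 2)" and "b = max \<nu> (pi / 2)"
  define \<beta> \<rho> where "\<beta> = a / 2" and "\<rho> = (b + pi) / 2"
  have ab: "0 < \<beta>" "\<beta> < a" "a \<le> b" "b < \<rho>" "\<rho> < pi" "\<beta> < pi"
    using \<nu> by (auto simp: a_def b_def \<beta>_def \<rho>_def min_def max_def)
  define S where "S = sector \<rho> \<inter> cosector \<beta>"
  have "open S" using ab by (auto simp: S_def open_sector open_cosector)
  obtain c where c: "c > 0"
    "\<And>\<mu> z. \<beta> \<le> \<bar>Arg \<mu>\<bar> \<Longrightarrow> \<bar>Arg z\<bar> \<le> 0 \<Longrightarrow> c * (cmod \<mu> + cmod z) \<le> cmod (\<mu> - z)"
    using sector_separation[of 0 \<beta>] ab by auto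
  obtain d where d: "d > 0"
    "\<And>\<mu> z. pi \<le> \<bar>Arg \<mu>\<bar> \<Longrightarrow> \<bar>Arg z\<bar> \<le> \<rho> \<Longrightarrow> d * (cmod \<mu> + cmod z) \<le> cmod (\<mu> - z)"
    using sector_separation[of \<rho> pi] ab by auto
  have le1: "c * (s + cmod z) \<le> cmod (z - of_real s)" and le2: "d * (s + cmod z) \<le> cmod (of_real s + z)"
    if "z \<in> S" for z
  proof -
    have z: "\<beta> \<le> \<bar>Arg z\<bar>" "\<bar>Arg z\<bar> \<le> \<rho>" using that by (auto simp: S_def sector_def cosector_def)
    show "c * (s + cmod z) \<le> cmod (z - of_real s)" using c(2)[OF z(1), of "of_real s"] s by (simp add: add.commute)
    have "\<bar>Arg (- of_real s)\<bar> = pi" using s by (simp flip: of_real_minus)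
    then show "d * (s + cmod z) \<le> cmod (of_real s + z)"
      using d(2)[of "- of_real s" z] z s by (simp add: norm_minus_commute add.commute flip: norm_minus_cancel[of "_ - _"])
  qed
  have ne: "z - of_real s \<noteq> 0" "of_real s + z \<noteq> 0" if "z \<in> S" for z
  proof -
    have "0 < c * (s + cmod z)" "0 < d * (s + cmod z)" using c(1) d(1) s by (auto intro!: mult_pos_pos add_pos_nonneg)
    then show "z - of_real s \<noteq> 0" "of_real s + z \<noteq> 0" using le1[OF that] le2[OF that] by auto
  qed
  have hol: "u holomorphic_on S" unfolding u_def using ne by (intro holomorphic_intros) auto
  define C where "C = 2 * s / (c * d) * (1 / min 1 (s\<^sup>2))"
  have bnd: "cmod (u z) \<le> C / (1 + (cmod z)\<^sup>2)" if z: "z \<in> S" for z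
  proof -
    have "u z = of_real (2 * s) / ((z - of_real s) * (of_real s + z))"
      using ne[OF z] by (simp add: u_def field_simps)
    then have "cmod (u z) = 2 * s / (cmod (z - of_real s) * cmod (of_real s + z))"
      using s by (simp add: norm_divide norm_mult)
    also have "\<dots> \<le> 2 * s / ((c * (s + cmod z)) * (d * (s + cmod z)))"
    proof -
      have "0 < s + cmod z" using s by (simp add: add_pos_nonneg)
      then show ?thesis
        using le1[OF z] le2[OF z] s c(1) d(1) by (intro frac_le mult_mono mult_pos_pos) simp_all
    qed
    also have "\<dots> = 2 * s / (c * d) * (1 / (s + cmod z)\<^sup>2)" by (simp add: power2_eq_square ac_simps)
    also have "\<dots> \<le> 2 * s / (c * d) * ((1 / min 1 (s\<^sup>2)) / (1 + (cmod z)\<^sup>2))"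
      using inverse_1_plus_square_le[OF s, of "cmod z"] c(1) d(1) s by (intro mult_left_mono) auto
    finally show ?thesis by (simp add: C_def)
  qed
  have rays: "of_real r * cis \<phi> \<in> S" "of_real r * cis (- \<phi>) \<in> S" if "r > 0" "\<phi> \<in> {a..b}" for r \<phi>
  proof -
    have "\<bar>Arg (of_real r * cis \<phi>)\<bar> = \<phi>" "\<bar>Arg (of_real r * cis (- \<phi>))\<bar> = \<phi>"
      using that ab Arg_polar[of r \<phi>] Arg_polar[of r "- \<phi>"] by auto
    then show "of_real r * cis \<phi> \<in> S" "of_real r * cis (- \<phi>) \<in> S"
      using that ab by (auto simp: S_def sector_def cosector_def)
  qed
  have bp: "bpath \<phi> t \<in> S" if "t \<noteq> 0" "\<phi> \<in> {a..b}" for t \<phi>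
    using that rays[of t \<phi>] rays[of "- t" \<phi>] by (auto simp: bpath_def)
  have "cint a u = cint b u"
    by (rule cint_rotate[OF \<open>open S\<close> hol bnd _ rays]) (use ab in auto)
  then have eq: "cint \<nu> u = cint (pi / 2) u" by (auto simp: a_def b_def min_def max_def split: if_splits)
  have \<nu>ab: "\<nu> \<in> {a..b}" "pi / 2 \<in> {a..b}" by (auto simp: a_def b_def)
  interpret h: contour_fun S u C "pi / 2"
    using bnd bp \<nu>ab holomorphic_on_imp_continuous_on[OF hol] by unfold_locales auto
  interpret n: contour_fun S u C \<nu>
    using bnd bp \<nu>ab holomorphic_on_imp_continuous_on[OF hol] by unfold_locales auto
  have "cint (pi / 2) u = of_real s * integral UNIV (\<lambda>t. u (of_real s * bpath (pi / 2) t) * bpath' (pi / 2) t)"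
    by (rule h.cint_scale(1)[OF s])
  also have "(\<lambda>t. u (of_real s * bpath (pi / 2) t) * bpath' (pi / 2) t) = (\<lambda>t. (2 * \<i> / of_real s) * of_real (1 / (1 + t\<^sup>2)))"
  proof
    fix t :: real
    have b: "bpath (pi / 2) t = - \<i> * of_real t" "bpath' (pi / 2) t = - \<i>" by (simp_all add: bpath_def bpath'_def)
    have ne: "of_real t * \<i> \<noteq> (1 :: complex)" "of_real t * \<i> \<noteq> (- 1 :: complex)" by (auto simp: complex_eq_iff)
    have "1 + (of_real t)\<^sup>2 \<noteq> (0 :: complex)"
    proof
      assume "1 + (of_real t)\<^sup>2 = (0 :: complex)"
      then have "of_real (1 + t\<^sup>2) = (0 :: complex)" by simp
      then show False unfolding of_real_eq_0_iff using zero_le_power2[of t] by linarith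
    qed
    have n1: "- (\<i> * of_real t) - 1 \<noteq> (0 :: complex)" "1 - \<i> * of_real t \<noteq> (0 :: complex)" by (auto simp: complex_eq_iff)
    have "u (of_real s * bpath (pi / 2) t) = (1 / of_real s) * (1 / (- (\<i> * of_real t) - 1) - 1 / (1 - \<i> * of_real t))"
    proof -
      have "of_real s * bpath (pi / 2) t - of_real s = of_real s * (- (\<i> * of_real t) - 1)"
        "of_real s + of_real s * bpath (pi / 2) t = of_real s * (1 - \<i> * of_real t)"
        by (simp_all add: b algebra_simps)
      then show ?thesis unfolding u_def by (simp add: right_diff_distrib del: mult_minus_right)
    qed
    also have "1 / (- (\<i> * of_real t) - 1) - 1 / (1 - \<i> * of_real t) = - 2 / (1 + (of_real t)\<^sup>2)"
    proof -
      have "1 / x - 1 / y = (y - x) / (x * y)" if "x \<noteq> 0" "y \<noteq> 0" for x y :: complex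
        using that by (simp add: field_simps)
      then have "1 / (- (\<i> * of_real t) - 1) - 1 / (1 - \<i> * of_real t)
          = (1 - \<i> * of_real t - (- (\<i> * of_real t) - 1)) / ((- (\<i> * of_real t) - 1) * (1 - \<i> * of_real t) :: complex)"
        using n1 by blast
      also have "(- (\<i> * of_real t) - 1) * (1 - \<i> * of_real t) = - (1 + (of_real t)\<^sup>2 :: complex)"
        by (simp add: algebra_simps power2_eq_square)
      also have "1 - \<i> * of_real t - (- (\<i> * of_real t) - 1) = (2 :: complex)" by simp
      finally show ?thesis by (simp only: minus_divide_right[symmetric] minus_divide_left)
    qed
    finally show "u (of_real s * bpath (pi / 2) t) * bpath' (pi / 2) t = (2 * \<i> / of_real s) * of_real (1 / (1 + t\<^sup>2))"
      by (simp add: b)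
  qed
  also have "integral UNIV (\<lambda>t. (2 * \<i> / of_real s) * of_real (1 / (1 + t\<^sup>2))) = (2 * \<i> / of_real s) * of_real pi"
    by (rule integral_unique[OF has_integral_mult_right[OF has_integral_of_real[OF has_integral_arctan]]])
  finally have "cint \<nu> u = 2 * pi * \<i>" using s eq by simp
  then show ?thesis using n.has_integral by (simp add: u_def)
qed

text \<open>This is \<open>h (z / s)\<close> for the \<open>h\<close> of the overview, so the
  operator \<open>h(2^k A)\<close> there corresponds to the parameter
  \<open>s = 2^(-k)\<close>.\<close>

definition hfun :: "real \<Rightarrow> complex \<Rightarrow> complex" where
  "hfun s z = of_real s * z / (of_real s + z)\<^sup>2"

lemma norm_plus_real_ge:
  assumes "0 \<le> \<rho>" "\<rho> < pi"
  obtains c where "c > 0" "c \<le> 1" "\<And>s z. s > 0 \<Longrightarrow> \<bar>Arg z\<bar> \<le> \<rho> \<Longrightarrow> c * (s + cmod z) \<le> cmod (of_real s + z)"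
proof -
  obtain d where d: "d > 0"
    "\<And>\<mu> z. pi \<le> \<bar>Arg \<mu>\<bar> \<Longrightarrow> \<bar>Arg z\<bar> \<le> \<rho> \<Longrightarrow> d * (cmod \<mu> + cmod z) \<le> cmod (\<mu> - z)"
    using sector_separation[of \<rho> pi] assms by auto
  show ?thesis
  proof (rule that[of "min d 1"])
    fix s :: real and z :: complex
    assume s: "s > 0" and z: "\<bar>Arg z\<bar> \<le> \<rho>"
    have "\<bar>Arg (- of_real s)\<bar> = pi" using s by (simp flip: of_real_minus)
    then have "d * (s + cmod z) \<le> cmod (- of_real s - z)" using d(2)[of "- of_real s" z] z s by simp
    also have "\<dots> = cmod (of_real s + z)" using norm_minus_cancel[of "of_real s + z"] by simp
    finally show "min d 1 * (s + cmod z) \<le> cmod (of_real s + z)"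
      using s mult_right_mono[of "min d 1" d "s + cmod z"] by simp
  qed (use d in auto)
qed

lemma hfun_holomorphic:
  assumes "s > 0" "\<rho> < pi"
  shows "hfun s holomorphic_on sector \<rho>"
proof -
  have "of_real s + z \<noteq> 0" if "z \<in> sector \<rho>" for z
  proof
    assume "of_real s + z = 0"
    then have "z = of_real (- s)" by (simp add: eq_neg_iff_add_eq_0 add.commute)
    then show False using that assms by (simp add: sector_def del: of_real_minus)
  qed
  then show ?thesis unfolding hfun_def by (intro holomorphic_intros) auto
qed

lemma hfun_bound:
  assumes "c > 0" "s > 0" and c: "c * (s + cmod z) \<le> cmod (of_real s + z)"
  shows "cmod (hfun s z) \<le> (1 / c\<^sup>2) * (s * cmod z / (s + cmod z)\<^sup>2)"
proof -
  have pos: "0 < c * (s + cmod z)" using assms(1,2) by (auto intro!: mult_pos_pos add_pos_nonneg)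
  have "cmod (hfun s z) = s * cmod z / (cmod (of_real s + z))\<^sup>2"
    using assms(2) by (simp add: hfun_def norm_divide norm_mult norm_power)
  also have "\<dots> \<le> s * cmod z / (c * (s + cmod z))\<^sup>2"
    using c assms(2) pos less_imp_le[OF pos] by (intro frac_le power_mono zero_less_power) simp_all
  finally show ?thesis by (simp add: power_mult_distrib)
qed

lemma decay1_hfun:
  assumes s: "s > 0" and \<rho>: "0 \<le> \<rho>" "\<rho> < pi"
  shows "decay1 \<rho> (hfun s)"
proof -
  obtain c where c: "c > 0" "\<And>s z. s > 0 \<Longrightarrow> \<bar>Arg z\<bar> \<le> \<rho> \<Longrightarrow> c * (s + cmod z) \<le> cmod (of_real s + z)"
    using norm_plus_real_ge[OF \<rho>] by metis
  show ?thesis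
  proof (rule decay1I[OF hfun_holomorphic[OF s \<rho>(2)]])
    fix z assume "z \<in> sector \<rho>"
    then have z: "\<bar>Arg z\<bar> \<le> \<rho>" by (simp add: sector_def)
    have "cmod (hfun s z) \<le> (1 / c\<^sup>2) * (s * cmod z) * (1 / (s + cmod z)\<^sup>2)"
      using hfun_bound[OF c(1) s c(2)[OF s z]] by simp
    also have "\<dots> \<le> (1 / c\<^sup>2) * (s * cmod z) * ((1 / min 1 (s\<^sup>2)) / (1 + (cmod z)\<^sup>2))"
      using inverse_1_plus_square_le[OF s, of "cmod z"] s by (intro mult_left_mono) auto
    finally show "cmod (hfun s z) \<le> ((1 / c\<^sup>2) * s * (1 / min 1 (s\<^sup>2))) * (cmod z / (1 + (cmod z)\<^sup>2))" by (simp add: mult_ac)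
  qed
qed

context resolvent_family
begin

lemma I_rotate:
  assumes \<nu>: "\<alpha> < \<nu>" "\<nu> \<le> \<theta>" "\<theta> < \<rho>" "\<rho> \<le> pi" and g: "decay1 \<rho> g" and V: "bdd_analytic (sector \<rho>) V"
  shows "I \<nu> g V = I \<theta> g V"
proof (rule eq_by_dual)
  fix l :: "'a \<Rightarrow> complex" assume l: "dual_elem l"
  have 1: "\<alpha> < \<nu>" "\<nu> < \<rho>" "\<rho> \<le> pi" "\<alpha> < \<theta>" using \<nu> by auto
  obtain C where C: "contour_fun (sector \<rho> \<inter> cosector \<alpha>) (\<lambda>z. g z * l (R z (V z))) C \<nu>"
    "(\<lambda>z. g z * l (R z (V z))) holomorphic_on sector \<rho> \<inter> cosector \<alpha>"
    using contour_fun_I[OF 1(1-3) g V l] by metis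
  interpret contour_fun "sector \<rho> \<inter> cosector \<alpha>" "\<lambda>z. g z * l (R z (V z))" C \<nu> by (rule C)
  have rays: "of_real r * cis \<phi> \<in> sector \<rho> \<inter> cosector \<alpha>" "of_real r * cis (- \<phi>) \<in> sector \<rho> \<inter> cosector \<alpha>"
    if "r > 0" "\<phi> \<in> {\<nu>..\<theta>}" for r \<phi>
  proof -
    have "\<bar>Arg (of_real r * cis \<phi>)\<bar> = \<phi>" "\<bar>Arg (of_real r * cis (- \<phi>))\<bar> = \<phi>"
      using that \<nu> \<alpha> Arg_polar[of r \<phi>] Arg_polar[of r "- \<phi>"] by auto
    then show "of_real r * cis \<phi> \<in> sector \<rho> \<inter> cosector \<alpha>" "of_real r * cis (- \<phi>) \<in> sector \<rho> \<inter> cosector \<alpha>"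
      using that \<nu> by (auto simp: sector_def cosector_def)
  qed
  have "cint \<nu> (\<lambda>z. g z * l (R z (V z))) = cint \<theta> (\<lambda>z. g z * l (R z (V z)))"
    by (rule cint_rotate[OF _ C(2) bnd \<nu>(2) rays]) (use open_sector open_cosector \<alpha> \<nu> in auto)
  then show "l (I \<nu> g V) = l (I \<theta> g V)"
    by (simp add: dual_I[OF 1(1-3) g V l] dual_I[OF 1(4) \<nu>(3,4) g V l])
qed

text \<open>This is \<open>(s + A)^(-1)\<close>.\<close>

definition J :: "real \<Rightarrow> 'a \<Rightarrow> 'a" where
  "J s x = - R (- of_real s) x"

text \<open>Since \<open>A J s = 1 - s J s\<close>, this is \<open>s A (s + A)^(-2)\<close>, that
  is, \<open>hfun s\<close> applied to \<open>A\<close>, written as a polynomial in one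
  resolvent.\<close>

definition H :: "real \<Rightarrow> 'a \<Rightarrow> 'a" where
  "H s x = of_real s *\<^sub>C J s x - (of_real s)\<^sup>2 *\<^sub>C J s (J s x)"

text \<open>This is \<open>phi n\<close> applied to \<open>A\<close>, because
  \<open>1 / (1 + n z) = (1 / n) / (1 / n + z)\<close>.\<close>

definition P :: "nat \<Rightarrow> 'a \<Rightarrow> 'a" where
  "P n x = of_nat n *\<^sub>C J (real n) x - (1 / of_nat n) *\<^sub>C J (1 / real n) x"

lemma J_lin: "s > 0 \<Longrightarrow> bounded_clinear_op (J s)"
  using bounded_clinear_op_add[OF R_lin R_lin, of "- of_real s" "- of_real s" "-1" 0]
  by (simp add: minus_real_in_cosector \<alpha> J_def[abs_def])

lemma H_lin: "s > 0 \<Longrightarrow> bounded_clinear_op (H s)"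
  using bounded_clinear_op_add[OF J_lin bounded_clinear_op_compose[OF J_lin J_lin], of s s s "of_real s" "- (of_real s)\<^sup>2"]
  by (simp add: H_def[abs_def])

lemma P_lin: "n \<ge> 1 \<Longrightarrow> bounded_clinear_op (P n)"
  using bounded_clinear_op_add[OF J_lin J_lin, of n "1 / n" "of_nat n" "- (1 / of_nat n)"]
  by (simp add: P_def[abs_def])

lemma J_R: "s > 0 \<Longrightarrow> z \<in> cosector \<alpha> \<Longrightarrow> (of_real s + z) *\<^sub>C R z (J s x) = R z x + J s x"
  using R_ident[of z "- of_real s" x] minus_real_in_cosector[of s \<alpha>] \<alpha>
  by (simp add: J_def bounded_clinear_opD[OF R_lin[of z]] scaleC.scale_left_diff_distrib scaleC_add_left)

lemma I_J:
  assumes \<nu>: "\<alpha> < \<nu>" "\<nu> < \<rho>" "\<rho> < pi" and g: "decay1 \<rho> g" and V: "bdd_analytic (sector \<rho>) V" and s: "s > 0"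
  shows "J s (I \<nu> g V) = I \<nu> (\<lambda>z. g z / (of_real s + z)) V" "decay1 \<rho> (\<lambda>z. g z / (of_real s + z))"
proof -
  have m: "- of_real s \<noteq> (0 :: complex)" "\<rho> < \<bar>Arg (- of_real s)\<bar>" using s \<nu> by (auto simp flip: of_real_minus)
  have \<nu>': "\<rho> \<le> pi" "0 \<le> \<rho>" using \<nu> \<alpha> by auto
  \<comment> \<open>The term \<open>0 * 0\<close> brings the function into the two-term shape of
    \<open>I_lincomb\<close>.\<close>
  have eq: "(\<lambda>z. g z / (of_real s + z)) = (\<lambda>z. - 1 * (g z / (- of_real s - z)) + 0 * 0)"
    by (auto simp: fun_eq_iff minus_divide_right simp del: minus_divide_right[symmetric])
  have d: "decay1 \<rho> (\<lambda>z. g z / (- of_real s - z))" by (rule decay1_div[OF g \<nu>'(2) m])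
  show "decay1 \<rho> (\<lambda>z. g z / (of_real s + z))"
    unfolding eq by (intro decay1_add decay1_cmult d decay1_0)
  show "J s (I \<nu> g V) = I \<nu> (\<lambda>z. g z / (of_real s + z)) V"
    unfolding eq I_lincomb[OF \<nu>(1,2) \<nu>'(1) d decay1_0 V] J_def I_resolvent[OF \<nu>(1,2) \<nu>'(1) g V m]
    by simp
qed

lemma I_H:
  assumes \<nu>: "\<alpha> < \<nu>" "\<nu> < \<rho>" "\<rho> < pi" and g: "decay1 \<rho> g" and V: "bdd_analytic (sector \<rho>) V" and s: "s > 0"
  shows "H s (I \<nu> g V) = I \<nu> (\<lambda>z. hfun s z * g z) V"
proof -
  note 1 = I_J[OF \<nu> g V s]
  note 2 = I_J[OF \<nu> 1(2) V s]
  have "hfun s z * g z = of_real s * (g z / (of_real s + z)) + (- (of_real s)\<^sup>2) * (g z / (of_real s + z) / (of_real s + z))" for z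
  proof -
    define w where "w = of_real s + z"
    \<comment> \<open>With \<open>z = w - s\<close> this is the partial fraction decomposition of
      \<open>hfun\<close>; at \<open>w = 0\<close> all quotients are \<open>0\<close>, so the
      identity holds for every \<open>z\<close>.\<close>
    have "of_real s * (w - of_real s) / w\<^sup>2 * g z = of_real s * (g z / w) + (- (of_real s)\<^sup>2) * (g z / w / w)"
      by (cases "w = 0") (simp_all add: power2_eq_square diff_divide_distrib right_diff_distrib left_diff_distrib)
    moreover have "hfun s z = of_real s * (w - of_real s) / w\<^sup>2" by (simp add: hfun_def w_def)
    ultimately show ?thesis by (simp only: w_def[symmetric])
  qed
  then have "I \<nu> (\<lambda>z. hfun s z * g z) V = of_real s *\<^sub>C J s (I \<nu> g V) + (- (of_real s)\<^sup>2) *\<^sub>C J s (J s (I \<nu> g V))"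
    using I_lincomb[OF \<nu>(1,2) less_imp_le[OF \<nu>(3)] 1(2) 2(2) V, of "of_real s" "- (of_real s)\<^sup>2"] by (simp add: 1(1) 2(1))
  then show ?thesis by (simp add: H_def)
qed

lemma I_P:
  assumes \<nu>: "\<alpha> < \<nu>" "\<nu> < \<rho>" "\<rho> < pi" and g: "decay1 \<rho> g" and V: "bdd_analytic (sector \<rho>) V" and n: "n \<ge> 1"
  shows "P n (I \<nu> g V) = I \<nu> (\<lambda>z. phi n z * g z) V"
proof -
  have n0: "real n > 0" "1 / real n > 0" using n by auto
  note 1 = I_J[OF \<nu> g V n0(1)]
  note 2 = I_J[OF \<nu> g V n0(2)]
  have "phi n z * g z = of_nat n * (g z / (of_real (real n) + z)) + (- (1 / of_nat n)) * (g z / (of_real (1 / real n) + z))" for z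
  proof -
    have "of_nat n * (of_real (1 / real n) + z) = 1 + of_nat n * z" using n by (simp add: distrib_left)
    then have "1 / (1 + of_nat n * z) = (1 / of_nat n) * (1 / (of_real (1 / real n) + z))"
      by (metis times_divide_times_eq mult_1_left)
    then show ?thesis by (simp add: phi_def left_diff_distrib)
  qed
  then have "I \<nu> (\<lambda>z. phi n z * g z) V = of_nat n *\<^sub>C J n (I \<nu> g V) + (- (1 / of_nat n)) *\<^sub>C J (1 / n) (I \<nu> g V)"
    using I_lincomb[OF \<nu>(1,2) less_imp_le[OF \<nu>(3)] 1(2) 2(2) V, of "of_nat n" "- (1 / of_nat n)"] by (simp add: 1(1) 2(1))
  then show ?thesis by (simp add: P_def)
qed

end

subsection \<open>Regularization\<close>

text \<open>Over a common denominator \<open>phi n z\<close> is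
  \<open>(n^2 - 1) z / ((n + z) (1 + n z))\<close>. The supremum is bounded uniformly in
  \<open>n\<close>, whereas the constant of the decay is allowed to grow with \<open>n\<close>; only
  the former may enter the final estimate.\<close>

lemma phi_bounds:
  assumes \<rho>: "0 \<le> \<rho>" "\<rho> < pi"
  obtains C where "C \<ge> 0" "\<And>n z. n \<ge> 1 \<Longrightarrow> z \<in> sector \<rho> \<Longrightarrow> cmod (phi n z) \<le> C"
    "\<And>n. n \<ge> 1 \<Longrightarrow> decay1 \<rho> (phi n)"
proof -
  obtain c where c: "c > 0" "\<And>s z. s > 0 \<Longrightarrow> \<bar>Arg z\<bar> \<le> \<rho> \<Longrightarrow> c * (s + cmod z) \<le> cmod (of_real s + z)"
    using norm_plus_real_ge[OF \<rho>] by metis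
  have n1: "c * (real n + cmod z) \<le> cmod (of_nat n + z)" and n2: "c * (1 + real n * cmod z) \<le> cmod (1 + of_nat n * z)"
    if "n \<ge> 1" "z \<in> sector \<rho>" for n z
  proof -
    have z: "\<bar>Arg z\<bar> \<le> \<rho>" using that by (simp add: sector_def)
    show "c * (real n + cmod z) \<le> cmod (of_nat n + z)" using c(2)[of "real n" z] that z by simp
    have "\<bar>Arg (of_real (real n) * z)\<bar> \<le> \<rho>" using z that Arg_times_of_real[of "real n" z] by simp
    then show "c * (1 + real n * cmod z) \<le> cmod (1 + of_nat n * z)"
      using c(2)[of 1 "of_nat n * z"] by (simp add: norm_mult)
  qed
  have pos: "0 < c * (real n + cmod z)" "0 < c * (1 + real n * cmod z)" if "n \<ge> 1" for n z
    using c(1) that by (auto intro!: mult_pos_pos add_pos_nonneg)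
  have ne: "of_nat n + z \<noteq> 0" "1 + of_nat n * z \<noteq> 0" if "n \<ge> 1" "z \<in> sector \<rho>" for n z
    using n1[OF that] n2[OF that] pos[OF that(1), of z] by auto
  show ?thesis
  proof (rule that[of "2 / c"])
    show "0 \<le> 2 / c" using c by simp
    fix n :: nat assume n: "n \<ge> 1"
    show "cmod (phi n z) \<le> 2 / c" if z: "z \<in> sector \<rho>" for z
    proof -
      have "c * real n \<le> cmod (of_nat n + z)" "c \<le> cmod (1 + of_nat n * z)"
      proof -
        have "c * real n \<le> c * (real n + cmod z)" "c * 1 \<le> c * (1 + real n * cmod z)"
          using c(1) by (intro mult_left_mono; simp)+
        then show "c * real n \<le> cmod (of_nat n + z)" "c \<le> cmod (1 + of_nat n * z)"
          using n1[OF n z] n2[OF n z] by auto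
      qed
      then have "real n / cmod (of_nat n + z) \<le> real n / (c * real n)" "1 / cmod (1 + of_nat n * z) \<le> 1 / c"
        using c(1) n by (intro frac_le; simp)+
      moreover have "real n / (c * real n) = 1 / c" using n by simp
      ultimately have "cmod (of_nat n / (of_nat n + z)) + cmod (1 / (1 + of_nat n * z)) \<le> 1 / c + 1 / c"
        by (simp add: norm_divide)
      then show ?thesis unfolding phi_def by (intro order_trans[OF norm_triangle_ineq4]) simp
    qed
    show "decay1 \<rho> (phi n)"
    proof (rule decay1I)
      show "phi n holomorphic_on sector \<rho>"
        unfolding phi_def[abs_def] using ne[OF n] by (intro holomorphic_intros) auto
      fix z assume z: "z \<in> sector \<rho>"
      define r where "r = cmod z"
      have r: "r \<ge> 0" by (simp add: r_def)
      have "phi n z = (of_nat n * (1 + of_nat n * z) - (of_nat n + z)) / ((of_nat n + z) * (1 + of_nat n * z))"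
        unfolding phi_def using ne[OF n z] by (subst diff_frac_eq) auto
      also have "of_nat n * (1 + of_nat n * z) - (of_nat n + z) = of_real ((real n)\<^sup>2 - 1) * z"
        by (simp add: algebra_simps power2_eq_square)
      finally have "cmod (phi n z) = \<bar>(real n)\<^sup>2 - 1\<bar> * r / (cmod (of_nat n + z) * cmod (1 + of_nat n * z))"
        by (simp only: norm_divide norm_mult norm_of_real r_def)
      also have "\<dots> \<le> \<bar>(real n)\<^sup>2 - 1\<bar> * r / (c\<^sup>2 * (1 + r\<^sup>2))"
      proof (rule frac_le)
        have "1 + r\<^sup>2 \<le> (real n + r) * (1 + real n * r)"
        proof -
          have "1 * r\<^sup>2 \<le> real n * r\<^sup>2" using n by (intro mult_right_mono) auto
          moreover have "(real n + r) * (1 + real n * r) = real n + real n * real n * r + r + real n * r\<^sup>2"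
            by (simp add: algebra_simps power2_eq_square)
          moreover have "0 \<le> real n * real n * r" "1 \<le> real n" using n r by auto
          ultimately show ?thesis using r by linarith
        qed
        then have "c\<^sup>2 * (1 + r\<^sup>2) \<le> c\<^sup>2 * ((real n + r) * (1 + real n * r))" by (intro mult_left_mono) auto
        also have "\<dots> = (c * (real n + r)) * (c * (1 + real n * r))" by (simp add: power2_eq_square)
        also have "\<dots> \<le> cmod (of_nat n + z) * cmod (1 + of_nat n * z)"
          using n1[OF n z] n2[OF n z] pos[OF n, of z] by (intro mult_mono) (auto simp: r_def)
        finally show "c\<^sup>2 * (1 + r\<^sup>2) \<le> cmod (of_nat n + z) * cmod (1 + of_nat n * z)" .
        show "0 < c\<^sup>2 * (1 + r\<^sup>2)" using c(1) by (intro mult_pos_pos) (auto intro: add_pos_nonneg)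
      qed (use r in auto)
      finally show "cmod (phi n z) \<le> (\<bar>(real n)\<^sup>2 - 1\<bar> / c\<^sup>2) * (cmod z / (1 + (cmod z)\<^sup>2))"
        by (simp add: r_def)
    qed
  qed
qed

context resolvent_family
begin

lemma I_compose:
  assumes \<nu>: "\<alpha> < \<nu>" "\<nu> < \<rho>" "\<rho> \<le> pi" and g: "decay1 \<rho> g" and V: "bdd_analytic (sector \<rho>) V"
    and T: "bounded_clinear_op T" and comm: "\<And>z x. z \<in> cosector \<alpha> \<Longrightarrow> T (R z x) = R z (T x)"
  shows "T (I \<nu> g V) = I \<nu> g (\<lambda>z. T (V z))"
proof -
  let ?k = "\<lambda>V t. (g (bpath \<nu> t) * bpath' \<nu> t) *\<^sub>C R (bpath \<nu> t) (V (bpath \<nu> t))"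
  have "T (integral UNIV (?k V)) = integral UNIV (T \<circ> ?k V)"
    by (rule integral_linear[symmetric, OF I_integrable[OF \<nu> g V] bounded_clinear_opD(1)[OF T]])
  also have "\<dots> = integral UNIV (?k (\<lambda>z. T (V z)))"
    using comm bpath_mem[OF \<nu>] by (intro integral_spike[of "{0}"]) (auto simp: bounded_clinear_opD(2)[OF T])
  finally show ?thesis by (simp add: I_def bounded_clinear_opD(2)[OF T])
qed

lemma I_norm_le:
  assumes \<nu>: "\<alpha> < \<nu>" "\<nu> < \<rho>" "\<rho> \<le> pi" and g: "decay1 \<rho> g" and V: "bdd_analytic (sector \<rho>) V"
    and bnd: "\<And>z. z \<in> sector \<rho> \<inter> cosector \<alpha> \<Longrightarrow> norm (g z *\<^sub>C R z (V z)) \<le> C / (1 + (cmod z)\<^sup>2)"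
  shows "norm (I \<nu> g V) \<le> C"
proof -
  let ?k = "\<lambda>t. (g (bpath \<nu> t) * bpath' \<nu> t) *\<^sub>C R (bpath \<nu> t) (V (bpath \<nu> t))"
  let ?restr = "\<lambda>t. if t = 0 then 0 else ?k t"
  have le: "norm (?restr t) \<le> C / (1 + t\<^sup>2)" for t
  proof (cases "t = 0")
    case True
    have "0 \<le> C" using order_trans[OF norm_ge_zero bnd[OF bpath_mem[OF \<nu>, of 1]]] by simp
    then show ?thesis using True by simp
  next
    case False
    then show ?thesis using bnd[OF bpath_mem[OF \<nu> False]] by (simp add: norm_scaleC norm_mult)
  qed
  have int0: "?restr integrable_on UNIV"
    by (rule integrable_spike_finite[OF _ _ I_integrable[OF \<nu> g V], of "{0}"]) auto
  have eq: "integral UNIV ?k = integral UNIV ?restr" by (rule integral_spike[of "{0}"]) auto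
  have n1: "norm (integral UNIV ?restr) \<le> integral UNIV (\<lambda>t. C / (1 + t\<^sup>2))"
    by (rule integral_norm_bound_integral[OF int0 integrable_const_over_1_plus_square le])
  have n2: "integral UNIV (\<lambda>t::real. C / (1 + t\<^sup>2)) = C * pi"
    using integral_unique[OF has_integral_mult_right[OF has_integral_arctan, of C]] by simp
  have "norm (integral UNIV ?k) \<le> C * pi" by (subst eq) (rule n1[unfolded n2])
  then have "norm (I \<nu> g V) \<le> 1 / (2 * pi) * (C * pi)"
    unfolding I_def norm_scaleC by (intro mult_mono) (auto simp: norm_divide norm_mult)
  also have "\<dots> \<le> C" using order_trans[OF norm_ge_zero bnd[OF bpath_mem[OF \<nu>, of 1]]] by simp
  finally show ?thesis .
qed

lemma I_const_norm:
  assumes \<nu>: "\<alpha> < \<nu>" "\<nu> < \<rho>" "\<rho> \<le> pi" and g: "decay1 \<rho> g"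
    and C: "0 \<le> C" "\<And>z. z \<in> sector \<rho> \<Longrightarrow> cmod (g z) \<le> C * (cmod z / (1 + (cmod z)\<^sup>2))"
  shows "norm (I \<nu> g (\<lambda>_. x)) \<le> norm x * (C * K)"
proof (rule I_norm_le[OF \<nu> g bdd_analytic_const])
  fix z assume z: "z \<in> sector \<rho> \<inter> cosector \<alpha>"
  then have z0: "z \<noteq> 0" by (auto simp: cosector_def)
  have "norm (g z *\<^sub>C R z x) \<le> (C * (cmod z / (1 + (cmod z)\<^sup>2))) * (K / cmod z * norm x)"
    unfolding norm_scaleC using C z R_bound[of z x] by (intro mult_mono) auto
  also have "\<dots> = norm x * (C * K) / (1 + (cmod z)\<^sup>2)" using z0 by (simp add: ac_simps)
  finally show "norm (g z *\<^sub>C R z x) \<le> norm x * (C * K) / (1 + (cmod z)\<^sup>2)" .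
qed

lemma I_const_lin:
  assumes \<nu>: "\<alpha> < \<nu>" "\<nu> < \<rho>" "\<rho> \<le> pi" and g: "decay1 \<rho> g"
  shows "bounded_clinear_op (\<lambda>x. I \<nu> g (\<lambda>_. x))"
proof -
  let ?k = "\<lambda>x t. (g (bpath \<nu> t) * bpath' \<nu> t) *\<^sub>C R (bpath \<nu> t) x"
  have int: "?k x integrable_on UNIV" for x using I_integrable[OF \<nu> g bdd_analytic_const, of x] .
  note lin = bounded_clinear_opD[OF R_lin]
  have mem: "bpath \<nu> t \<in> cosector \<alpha>" if "t \<noteq> 0" for t using bpath_mem[OF \<nu> that] by simp
  have add: "I \<nu> g (\<lambda>_. x + y) = I \<nu> g (\<lambda>_. x) + I \<nu> g (\<lambda>_. y)" for x y
  proof -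
    have "integral UNIV (?k (x + y)) = integral UNIV (\<lambda>t. ?k x t + ?k y t)"
      using mem by (intro integral_spike[of "{0}"]) (auto simp: lin scaleC_add_right)
    also have "\<dots> = integral UNIV (?k x) + integral UNIV (?k y)"
      by (rule Henstock_Kurzweil_Integration.integral_add[OF int int])
    finally show ?thesis by (simp add: I_def scaleC_add_right)
  qed
  have sc: "I \<nu> g (\<lambda>_. c *\<^sub>C x) = c *\<^sub>C I \<nu> g (\<lambda>_. x)" for c x
  proof -
    have "integral UNIV (?k (c *\<^sub>C x)) = integral UNIV ((\<lambda>y. c *\<^sub>C y) \<circ> ?k x)"
      using mem by (intro integral_spike[of "{0}"]) (auto simp: lin mult_ac)
    also have "\<dots> = c *\<^sub>C integral UNIV (?k x)"
      by (rule integral_linear[OF int scaleC.bounded_linear_right])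
    finally show ?thesis by (simp add: I_def mult.commute)
  qed
  obtain C where C: "C \<ge> 0" "\<And>z. z \<in> sector \<rho> \<Longrightarrow> cmod (g z) \<le> C * (cmod z / (1 + (cmod z)\<^sup>2))"
    using decay1E[OF g] by metis
  note bnd = I_const_norm[OF \<nu> g C]
  have "bounded_linear (\<lambda>x. I \<nu> g (\<lambda>_. x))"
    by (rule bounded_linear_intro[OF add _ bnd]) (simp add: scaleR_scaleC sc)
  then show ?thesis by (simp add: bounded_clinear_op_def sc)
qed

lemma J_commute_R: "s > 0 \<Longrightarrow> z \<in> cosector \<alpha> \<Longrightarrow> J s (R z x) = R z (J s x)"
  using R_commute[of "- of_real s" z x] minus_real_in_cosector[of s \<alpha>] \<alpha>
  by (simp add: J_def bounded_clinear_opD[OF R_lin[of z]])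

lemma H_commute_R: "s > 0 \<Longrightarrow> z \<in> cosector \<alpha> \<Longrightarrow> H s (R z x) = R z (H s x)"
  by (simp add: H_def J_commute_R bounded_clinear_opD[OF R_lin[of z]])

lemma P_commute_R: "n \<ge> 1 \<Longrightarrow> z \<in> cosector \<alpha> \<Longrightarrow> P n (R z x) = R z (P n x)"
  by (simp add: P_def J_commute_R bounded_clinear_opD[OF R_lin[of z]])

lemma norm_J: "s > 0 \<Longrightarrow> norm (J s x) \<le> K / s * norm x"
  using R_bound[of "- of_real s" x] minus_real_in_cosector[of s \<alpha>] \<alpha> by (simp add: J_def)

lemma norm_P: "n \<ge> 1 \<Longrightarrow> norm (P n x) \<le> 2 * K * norm x"
proof -
  assume n: "n \<ge> 1"
  have "norm (P n x) \<le> real n * norm (J n x) + (1 / real n) * norm (J (1 / n) x)"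
    unfolding P_def by (intro order_trans[OF norm_triangle_ineq4]) (simp add: norm_scaleC norm_divide)
  also have "\<dots> \<le> real n * (K / real n * norm x) + (1 / real n) * (K / (1 / real n) * norm x)"
    using n by (intro add_mono mult_left_mono norm_J) auto
  finally show ?thesis using n by simp
qed

text \<open>With \<open>v = x - s J x\<close> and \<open>J = (s + A)\<^sup>-\<^sup>1\<close>, the integrand is \<open>s\<close> times the sum of
  \<open>R(z) J v - J v / (z - s)\<close>, which has no pole outside the sector, of \<open>J v\<close> times the two-pole kernel,
  and of \<open>s J x / (s + z)\<^sup>2\<close>, which has no pole inside the sector.\<close>

lemma I_hfun:
  assumes \<nu>: "\<alpha> < \<nu>" "\<nu> < pi" and s: "s > 0"
  shows "I \<nu> (hfun s) (\<lambda>_. x) = H s x"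
proof (rule eq_by_dual)
  fix l :: "'a \<Rightarrow> complex" assume l: "dual_elem l"
  note ll = dual_elemD[OF l] and JJ = bounded_clinear_opD[OF J_lin[OF s]]
  define \<beta> \<rho> where "\<beta> = (\<alpha> + \<nu>) / 2" and "\<rho> = (\<nu> + pi) / 2"
  have b: "0 < \<beta>" "\<alpha> < \<beta>" "\<beta> < \<nu>" "\<nu> < \<rho>" "\<rho> < pi" "0 < \<nu>" "0 \<le> \<rho>" using \<nu> \<alpha> by (auto simp: \<beta>_def \<rho>_def)
  have sub: "cosector \<beta> \<subseteq> cosector \<alpha>" using b by (auto simp: cosector_def)
  obtain L where L: "L \<ge> 0" "\<And>x. cmod (l x) \<le> norm x * L"
    using bounded_linear.nonneg_bounded[OF ll(6)] by auto
  define sc where "sc = complex_of_real s"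
  have sc0: "sc \<noteq> 0" using s by (simp add: sc_def)
  define v where "v = x - sc *\<^sub>C J s x"
  define p q where "p = l (J s v)" and "q = l (J s x)"
  define u where "u = (\<lambda>z. l (R z (J s v)) - p / (z - sc))"
  \<comment> \<open>With \<open>y = (1 - s J) (1 - 2 s J) x\<close> the function \<open>u z\<close>
    becomes \<open>l (R z y) / (z - s)\<close>. The factor \<open>1 - s J = A J\<close> turns
    \<open>R z y\<close> into \<open>z R z (J y0) - J y0\<close>, which stays bounded at
    \<open>0\<close>; the plain resolvent bound together with \<open>1 / (z - s)\<close> gives
    quadratic decay at infinity.\<close>
  define y0 where "y0 = x - (2 * sc) *\<^sub>C J s x"
  define y where "y = v - (2 * sc) *\<^sub>C J s v"
  have y: "y = y0 - sc *\<^sub>C J s y0"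
    by (simp add: y_def y0_def v_def JJ algebra_simps scaleC_scaleC scaleC.scale_right_diff_distrib)
  obtain c where c: "c > 0"
    "\<And>\<mu> z. \<beta> \<le> \<bar>Arg \<mu>\<bar> \<Longrightarrow> \<bar>Arg z\<bar> \<le> 0 \<Longrightarrow> c * (cmod \<mu> + cmod z) \<le> cmod (\<mu> - z)"
    using sector_separation[of 0 \<beta>] b by auto
  have far: "c * (cmod z + s) \<le> cmod (z - sc)" "z - sc \<noteq> 0" if "z \<in> cosector \<beta>" for z
  proof -
    show le: "c * (cmod z + s) \<le> cmod (z - sc)" using c(2)[of z sc] that s by (simp add: cosector_def sc_def)
    have "0 < c * (cmod z + s)" using c(1) s by (auto intro!: mult_pos_pos add_nonneg_pos)
    then show "z - sc \<noteq> 0" using le by auto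
  qed
  have uhol: "u holomorphic_on cosector \<beta>"
    unfolding u_def using far(2) b sub \<alpha>
    by (intro holomorphic_on_diff R_holomorphic bdd_analytic_const l open_cosector holomorphic_intros) auto
  define E1 E2 where "E1 = (K + 1) * norm (J s y0) / (c * s)" and "E2 = K * norm y / c"
  have nn: "0 \<le> E1" "0 \<le> E2" using K c(1) s by (auto simp: E1_def E2_def)
  define C where "C = L * (2 * E2 + 2 * E1)"
  have ubd: "cmod (u z) \<le> C / (1 + (cmod z)\<^sup>2)" if z: "z \<in> cosector \<beta>" for z
  proof -
    have zo: "z \<in> cosector \<alpha>" using z sub by auto
    note RR = bounded_clinear_opD[OF R_lin[OF zo]]
    define r where "r = cmod z"
    have r: "r > 0" using z by (auto simp: r_def cosector_def)
    have "(sc + z) * l (R z (J s v)) = l (R z v) + p"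
      using J_R[OF s zo, of v] ll unfolding p_def sc_def by metis
    then have "(z - sc) * l (R z (J s v)) - p = l (R z y)"
      by (simp add: y_def RR ll algebra_simps)
    then have ueq: "u z = l (R z y) / (z - sc)" using far(2)[OF z] by (simp add: u_def field_simps)
    have "(sc + z) *\<^sub>C R z (J s y0) = R z y0 + J s y0" using J_R[OF s zo] by (simp add: sc_def)
    then have Ry: "R z y = z *\<^sub>C R z (J s y0) - J s y0"
      by (simp add: y RR scaleC_add_left algebra_simps)
    have "norm (R z (J s y0)) \<le> K / r * norm (J s y0)" using R_bound[OF zo] by (simp add: r_def)
    then have "r * norm (R z (J s y0)) \<le> r * (K / r * norm (J s y0))" using r by (intro mult_left_mono) auto
    then have "norm (R z y) \<le> (K + 1) * norm (J s y0)"
      unfolding Ry using r by (intro order_trans[OF norm_triangle_ineq4]) (simp add: norm_scaleC r_def distrib_right)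
    moreover have "norm (R z y) \<le> K / r * norm y" using R_bound[OF zo] by (simp add: r_def)
    ultimately have N: "norm (R z y) / (c * (r + s)) \<le> (2 * E2 + 2 * E1) / (1 + r\<^sup>2)"
    proof -
      assume 1: "norm (R z y) \<le> (K + 1) * norm (J s y0)" and 2: "norm (R z y) \<le> K / r * norm y"
      have pos: "0 < 1 + r\<^sup>2" by (simp add: add_pos_nonneg)
      show ?thesis
      proof (cases "r \<le> 1")
        case True
        then have r1: "r\<^sup>2 \<le> 1" using r by (simp add: power_le_one)
        have "norm (R z y) / (c * (r + s)) \<le> E1"
          unfolding E1_def using 1 c(1) s r K by (intro frac_le mult_left_mono) auto
        then have "norm (R z y) / (c * (r + s)) * (1 + r\<^sup>2) \<le> E1 * (1 + r\<^sup>2)"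
          using pos by (intro mult_right_mono) auto
        also have "\<dots> \<le> E1 * 2" using nn r1 by (intro mult_left_mono) auto
        also have "\<dots> \<le> 2 * E2 + 2 * E1" using nn by simp
        finally show ?thesis using pos by (simp only: pos_le_divide_eq)
      next
        case False
        have "norm (R z y) / (c * (r + s)) \<le> (K / r * norm y) / (c * r)"
          using 2 c(1) s r K by (intro frac_le mult_left_mono) auto
        also have "\<dots> = E2 * (1 / r\<^sup>2)" by (simp add: power2_eq_square E2_def)
        also have "\<dots> \<le> E2 * (2 / (1 + r\<^sup>2))"
        proof -
          have "1 \<le> r\<^sup>2" using False one_le_power[of r 2] by simp
          then have "2 / (2 * r\<^sup>2) \<le> 2 / (1 + r\<^sup>2)" using pos by (intro frac_le) auto
          then have "1 / r\<^sup>2 \<le> 2 / (1 + r\<^sup>2)" by simp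
          then show ?thesis using nn by (intro mult_left_mono) auto
        qed
        also have "\<dots> = (2 * E2) / (1 + r\<^sup>2)" by simp
        also have "\<dots> \<le> (2 * E2 + 2 * E1) / (1 + r\<^sup>2)"
          using nn pos by (intro divide_right_mono) auto
        finally show ?thesis .
      qed
    qed
    have "cmod (u z) \<le> norm (R z y) * L / (c * (r + s))"
      unfolding ueq norm_divide using L far[OF z] c(1) s r
      by (intro frac_le) (auto simp: r_def intro!: mult_pos_pos add_nonneg_pos)
    also have "\<dots> = L * (norm (R z y) / (c * (r + s)))" by simp
    also have "\<dots> \<le> L * ((2 * E2 + 2 * E1) / (1 + r\<^sup>2))"
      using N L by (intro mult_left_mono)
    finally show ?thesis by (simp add: C_def r_def)
  qed
  have rays: "of_real r * cis \<phi> \<in> cosector \<beta>" "of_real r * cis (- \<phi>) \<in> cosector \<beta>"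
    if "r > 0" "\<phi> \<in> {\<nu>..pi}" for r \<phi>
    using polar_in_cosector[of r \<phi> \<beta>] that b by auto
  have bp: "bpath \<phi> t \<in> cosector \<beta>" if "t \<noteq> 0" "\<phi> \<in> {\<nu>..pi}" for t \<phi>
    using that rays[of t \<phi>] rays[of "- t" \<phi>] by (auto simp: bpath_def)
  interpret n: contour_fun "cosector \<beta>" u C \<nu>
    using ubd bp holomorphic_on_imp_continuous_on[OF uhol] \<nu> by unfold_locales auto
  interpret h: contour_fun "cosector \<beta>" u C pi
    using ubd bp holomorphic_on_imp_continuous_on[OF uhol] \<nu> by unfold_locales auto
  \<comment> \<open>The rays are opened up to the negative half-line, where they cancel; the
    quotient by \<open>z - s\<close> is harmless because \<open>cosector \<beta>\<close> omits the
    positive half-line.\<close>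
  have "cint \<nu> u = cint pi u"
    by (rule cint_rotate[OF open_cosector uhol ubd _ rays]) (use b in auto)
  then have u0: "((\<lambda>t. u (bpath \<nu> t) * bpath' \<nu> t) has_integral 0) UNIV"
    using n.has_integral h.cint_eq_0_if_rays_coincide by (simp add: cis_cnj[symmetric])
  obtain d where d: "d > 0" "\<And>s z. s > 0 \<Longrightarrow> \<bar>Arg z\<bar> \<le> \<rho> \<Longrightarrow> d * (s + cmod z) \<le> cmod (of_real s + z)"
    using norm_plus_real_ge[OF b(7,5)] by metis
  define k where "k = (\<lambda>z. 1 / (sc + z)\<^sup>2)"
  have dle: "d * (s + cmod z) \<le> cmod (sc + z)" "sc + z \<noteq> 0" if "z \<in> sector \<rho>" for z
  proof -
    show le: "d * (s + cmod z) \<le> cmod (sc + z)" using d(2)[OF s] that by (simp add: sector_def sc_def)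
    have "0 < d * (s + cmod z)" using d(1) s by (auto intro!: mult_pos_pos add_pos_nonneg)
    then show "sc + z \<noteq> 0" using le by auto
  qed
  have khol: "k holomorphic_on sector \<rho>" unfolding k_def using dle by (intro holomorphic_intros) auto
  have kbd: "cmod (k z) \<le> ((1 / d\<^sup>2) * (1 / min 1 (s\<^sup>2))) / (1 + (cmod z)\<^sup>2)" if z: "z \<in> sector \<rho>" for z
  proof -
    have pos: "0 < d * (s + cmod z)" using d(1) s by (auto intro!: mult_pos_pos add_pos_nonneg)
    have "cmod (k z) = 1 / (cmod (sc + z))\<^sup>2" by (simp add: k_def norm_divide norm_power)
    also have "\<dots> \<le> 1 / (d * (s + cmod z))\<^sup>2"
      using dle(1)[OF z] pos less_imp_le[OF pos] by (intro frac_le power_mono zero_less_power) simp_all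
    also have "\<dots> = (1 / d\<^sup>2) * (1 / (s + cmod z)\<^sup>2)" by (simp add: power_mult_distrib)
    also have "\<dots> \<le> (1 / d\<^sup>2) * ((1 / min 1 (s\<^sup>2)) / (1 + (cmod z)\<^sup>2))"
      using inverse_1_plus_square_le[OF s, of "cmod z"] by (intro mult_left_mono) auto
    finally show ?thesis by simp
  qed
  interpret k: contour_fun "sector \<rho>" k "(1 / d\<^sup>2) * (1 / min 1 (s\<^sup>2))" \<nu>
    using kbd holomorphic_on_imp_continuous_on[OF khol] b by unfold_locales (auto intro!: bpath_in_sector)
  have "cint \<nu> k = 0" by (rule cint_sector_eq_0[OF _ b(4) less_imp_le[OF b(5)] khol kbd]) (use b in auto)
  then have k0: "((\<lambda>t. k (bpath \<nu> t) * bpath' \<nu> t) has_integral 0) UNIV" using k.has_integral by simp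
  have p0: "((\<lambda>t. (1 / (bpath \<nu> t - sc) - 1 / (sc + bpath \<nu> t)) * bpath' \<nu> t) has_integral 2 * pi * \<i>) UNIV"
    unfolding sc_def by (rule cint_two_poles[OF b(6) \<nu>(2) s])
  define m where "m = (\<lambda>t. sc * (u (bpath \<nu> t) * bpath' \<nu> t + p * ((1 / (bpath \<nu> t - sc) - 1 / (sc + bpath \<nu> t)) * bpath' \<nu> t)
      + (sc * q) * (k (bpath \<nu> t) * bpath' \<nu> t)))"
  have "(m has_integral sc * (0 + p * (2 * pi * \<i>) + (sc * q) * 0)) UNIV"
    unfolding m_def by (intro has_integral_mult_right has_integral_add u0 p0 k0)
  then have mi: "integral UNIV m = 2 * pi * \<i> * (sc * p)" by (simp add: integral_unique mult_ac)
  have eq: "hfun s z * l (R z x) = sc * (u z + p * (1 / (z - sc) - 1 / (sc + z)) + (sc * q) * k z)"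
    if z: "z \<in> sector \<rho>" and zo: "z \<in> cosector \<alpha>" for z
  proof -
    note RR = bounded_clinear_opD[OF R_lin[OF zo]]
    define w X Y A where "w = sc + z" and "X = l (R z x)" and "Y = l (R z (J s x))" and "A = l (R z (J s v))"
    have w: "w \<noteq> 0" using dle(2)[OF z] by (simp add: w_def)
    have "w * A = l (R z v) + p" using J_R[OF s zo, of v] ll unfolding p_def sc_def w_def A_def by metis
    moreover have "l (R z v) = X - sc * Y" by (simp add: v_def RR ll X_def Y_def)
    moreover have wY: "w * Y = X + q" using J_R[OF s zo, of x] ll unfolding q_def sc_def w_def X_def Y_def by metis
    ultimately have wA: "w * A = X - sc * Y + p" by simp
    then have "w * (w * A - p) = w * (X - sc * Y)" by simp
    also have "\<dots> = w * X - sc * (w * Y)" by (simp add: algebra_simps)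
    finally have "w * (w * A - p) = w * X - sc * (X + q)" by (simp only: wY)
    then have "w * (w * A - p) + sc * q = (w - sc) * X" by (simp add: algebra_simps)
    then have "(w * (w * A - p) + sc * q) / w\<^sup>2 = (w - sc) * X / w\<^sup>2" by simp
    moreover have "(w * (w * A - p) + sc * q) / w\<^sup>2 = A - p / w + sc * q / w\<^sup>2"
      using w by (simp add: field_simps power2_eq_square)
    moreover have "hfun s z = sc * (w - sc) / w\<^sup>2" by (simp add: hfun_def w_def sc_def)
    moreover have "u z + p * (1 / (z - sc) - 1 / (sc + z)) + (sc * q) * k z = A - p / w + sc * q / w\<^sup>2"
      by (simp add: u_def A_def w_def k_def right_diff_distrib)
    ultimately show ?thesis by (simp add: X_def)
  qed
  have "cint \<nu> (\<lambda>z. hfun s z * l (R z x)) = integral UNIV m"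
    unfolding cint_def
  proof (rule integral_spike[of "{0}"])
    fix t :: real assume "t \<in> UNIV - {0}"
    then have "bpath \<nu> t \<in> sector \<rho>" "bpath \<nu> t \<in> cosector \<alpha>" using bpath_mem[of \<nu> \<rho> t] b \<nu> by auto
    from eq[OF this] show "m t = hfun s (bpath \<nu> t) * l (R (bpath \<nu> t) x) * bpath' \<nu> t"
      unfolding m_def by (simp only: ring_distribs mult.assoc)
  qed simp
  then have "l (I \<nu> (hfun s) (\<lambda>_. x)) = sc * p"
    using b \<nu> by (subst dual_I[OF \<nu>(1) b(4) _ decay1_hfun[OF s b(7,5)] bdd_analytic_const l]) (simp_all add: mi)
  also have "\<dots> = l (H s x)"
    by (simp add: p_def v_def H_def JJ ll sc_def algebra_simps power2_eq_square)
  finally show "l (I \<nu> (hfun s) (\<lambda>_. x)) = l (H s x)" .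
qed

end

section \<open>Strong convergence of the regularizing operators\<close>

lemma tendsto_0_of_dense:
  fixes T :: "nat \<Rightarrow> 'a::real_normed_vector \<Rightarrow> 'b::real_normed_vector"
  assumes S: "closure S = UNIV" and lim: "\<And>x. x \<in> S \<Longrightarrow> (\<lambda>n. T n x) \<longlonglongrightarrow> 0"
    and diff: "\<And>n x y. n \<ge> 1 \<Longrightarrow> T n (x - y) = T n x - T n y"
    and bnd: "\<And>n x. n \<ge> 1 \<Longrightarrow> norm (T n x) \<le> M * norm x"
  shows "(\<lambda>n. T n x) \<longlonglongrightarrow> 0"
proof (rule LIMSEQ_I)
  fix e :: real assume e: "e > 0"
  define M' where "M' = \<bar>M\<bar> + 1"
  have M': "M' > 0" "M \<le> M'" by (auto simp: M'_def)
  have "x \<in> closure S" using S by simp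
  moreover have "e / 2 / M' > 0" using e M' by simp
  ultimately obtain y where y: "y \<in> S" "dist y x < e / 2 / M'" unfolding closure_approachable by blast
  obtain N where N: "\<And>n. n \<ge> N \<Longrightarrow> norm (T n y) < e / 2"
    using LIMSEQ_D[OF lim[OF y(1)], of "e / 2"] e by auto
  have "norm (T n x - 0) < e" if n: "n \<ge> max N 1" for n
  proof -
    have "T n x = T n (x - y) + T n y" using n by (simp add: diff)
    then have "norm (T n x) \<le> norm (T n (x - y)) + norm (T n y)" by (metis norm_triangle_ineq)
    also have "norm (T n (x - y)) \<le> M * norm (x - y)" using n by (intro bnd) simp
    also have "\<dots> \<le> M' * norm (x - y)" using M' by (intro mult_right_mono) auto
    also have "\<dots> < e / 2" using y(2) M' by (simp add: dist_norm norm_minus_commute field_simps)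
    finally show ?thesis using N[of n] n by simp
  qed
  then show "\<exists>N. \<forall>n\<ge>N. norm (T n x - 0) < e" by blast
qed

context resolvent_family
begin

text \<open>Each term of \<open>P n\<close> needs its own dense set. On the domain
  \<open>n J n y - y = - J n (A y)\<close> is of order \<open>1 / n\<close>; on the range
  \<open>J s (A y) = y - s J s y\<close> is bounded in \<open>s\<close>, so the factor
  \<open>1 / n\<close> makes the second term vanish. Uniform bounds extend both limits to the whole
  space.\<close>

lemma P_tendsto:
  assumes dense: "closure D = UNIV" "closure (A ` D) = UNIV"
    and inv: "\<And>z x. z \<in> cosector \<alpha> \<Longrightarrow> x \<in> D \<Longrightarrow> R z (z *\<^sub>C x - A x) = x"
  shows "(\<lambda>n. P n x) \<longlonglongrightarrow> x"
proof -
  have JA: "J s (A y) = y - of_real s *\<^sub>C J s y" if "s > 0" "y \<in> D" for s y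
  proof -
    have m: "- of_real s \<in> cosector \<alpha>" using minus_real_in_cosector[of s \<alpha>] that \<alpha> by simp
    show ?thesis using inv[OF m that(2)]
      by (simp add: J_def bounded_clinear_opD[OF R_lin[OF m]] algebra_simps)
  qed
  have sJ: "norm (of_real s *\<^sub>C J s y) \<le> K * norm y" if "s > 0" for s y
    using mult_left_mono[OF norm_J[OF that, of y], of s] that by (simp add: norm_scaleC)
  have c: "norm (of_nat n *\<^sub>C J (real n) y) \<le> K * norm y" "norm ((1 / of_nat n) *\<^sub>C J (1 / real n) y) \<le> K * norm y"
    if "n \<ge> 1" for n y
    using sJ[of "real n" y] sJ[of "1 / real n" y] that by simp_all
  have lim0: "(\<lambda>n. X * (1 / real n)) \<longlonglongrightarrow> 0" for X
    using tendsto_mult_right_zero[OF lim_1_over_n] by simp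
  have 1: "(\<lambda>n. of_nat n *\<^sub>C J (real n) x - x) \<longlonglongrightarrow> 0"
  proof (rule tendsto_0_of_dense[where T = "\<lambda>n x. of_nat n *\<^sub>C J (real n) x - x", OF dense(1)])
    fix y assume y: "y \<in> D"
    have "norm (of_nat n *\<^sub>C J (real n) y - y) \<le> K * norm (A y) * (1 / real n)" if "n \<ge> 1" for n
      using norm_J[of "real n" "A y"] JA[of "real n" y] y that by (simp add: norm_minus_commute)
    then have "\<forall>\<^sub>F n in sequentially. norm (of_nat n *\<^sub>C J (real n) y - y) \<le> K * norm (A y) * (1 / real n)"
      by (intro eventually_sequentiallyI[of 1]) auto
    then show "(\<lambda>n. of_nat n *\<^sub>C J (real n) y - y) \<longlonglongrightarrow> 0"
      by (rule Lim_null_comparison) (rule lim0)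
  next
    show "norm (of_nat n *\<^sub>C J (real n) y - y) \<le> (K + 1) * norm y" if "n \<ge> 1" for n y
      using c(1)[OF that, of y] norm_triangle_ineq4[of "of_nat n *\<^sub>C J (real n) y" y] by (simp add: distrib_right)
  qed (simp add: bounded_clinear_opD[OF J_lin] scaleC.scale_right_diff_distrib)
  have 2: "(\<lambda>n. (1 / of_nat n) *\<^sub>C J (1 / real n) x) \<longlonglongrightarrow> 0"
  proof (rule tendsto_0_of_dense[where T = "\<lambda>n x. (1 / of_nat n) *\<^sub>C J (1 / real n) x", OF dense(2)])
    fix w assume "w \<in> A ` D"
    then obtain y where y: "y \<in> D" "w = A y" by auto
    have "norm ((1 / of_nat n) *\<^sub>C J (1 / real n) w) \<le> (K + 1) * norm y * (1 / real n)" if "n \<ge> 1" for n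
    proof -
      have "norm (J (1 / real n) w) \<le> (K + 1) * norm y"
        using JA[of "1 / real n" y] y that sJ[of "1 / real n" y]
          norm_triangle_ineq4[of y "of_real (1 / real n) *\<^sub>C J (1 / real n) y"] by (simp add: distrib_right)
      then have "(1 / real n) * norm (J (1 / real n) w) \<le> (1 / real n) * ((K + 1) * norm y)"
        by (intro mult_left_mono) auto
      then show ?thesis by (simp add: norm_scaleC norm_divide)
    qed
    then have "\<forall>\<^sub>F n in sequentially. norm ((1 / of_nat n) *\<^sub>C J (1 / real n) w) \<le> (K + 1) * norm y * (1 / real n)"
      by (intro eventually_sequentiallyI[of 1]) auto
    then show "(\<lambda>n. (1 / of_nat n) *\<^sub>C J (1 / real n) w) \<longlonglongrightarrow> 0"
      by (rule Lim_null_comparison) (rule lim0)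
  qed (auto simp: bounded_clinear_opD[OF J_lin] scaleC.scale_right_diff_distrib intro!: c(2))
  have "(\<lambda>n. (of_nat n *\<^sub>C J (real n) x - x) - (1 / of_nat n) *\<^sub>C J (1 / real n) x + x) \<longlonglongrightarrow> 0 - 0 + x"
    by (intro tendsto_intros 1 2)
  then show ?thesis by (simp add: P_def)
qed

text \<open>\<open>G n = (\<phi>\<^sub>n g)(A)\<close> satisfies \<open>P m \<circ> G n = P n \<circ> G m\<close>, so \<open>G n\<close> converges on the
  dense union of the ranges of the \<open>P m\<close>.\<close>

lemma regularized_limit:
  assumes \<nu>: "\<alpha> < \<nu>" "\<nu> < \<rho>" "\<rho> < pi" and g: "g holomorphic_on sector \<rho>" "\<And>z. z \<in> sector \<rho> \<Longrightarrow> cmod (g z) \<le> B"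
    and Ptend: "\<And>x. (\<lambda>n. P n x) \<longlonglongrightarrow> x"
    and bnd: "\<And>n x. n \<ge> 1 \<Longrightarrow> norm (I \<nu> (\<lambda>z. phi n z * g z) (\<lambda>_. x)) \<le> C * norm x"
    and m: "m \<ge> 1"
  shows "P m (lim (\<lambda>n. I \<nu> (\<lambda>z. phi n z * g z) (\<lambda>_. x))) = I \<nu> (\<lambda>z. phi m z * g z) (\<lambda>_. x)"
proof -
  have \<nu>': "\<rho> \<le> pi" "0 \<le> \<rho>" using \<nu> \<alpha> by auto
  define G where "G = (\<lambda>n x. I \<nu> (\<lambda>z. phi n z * g z) (\<lambda>_. x))"
  have dphi: "decay1 \<rho> (phi n)" if "n \<ge> 1" for n using phi_bounds[OF \<nu>'(2) \<nu>(3)] that by metis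
  have d: "decay1 \<rho> (\<lambda>z. phi n z * g z)" if "n \<ge> 1" for n
    using decay1_mult_bounded[OF dphi[OF that] g] by (simp add: mult.commute)
  note const = bdd_analytic_const[of "sector \<rho>"]
  have PG: "P m (G n x) = P n (G m x)" if "m \<ge> 1" "n \<ge> 1" for m n x
    using I_P[OF \<nu> d[OF that(1)] const that(2), of x] I_P[OF \<nu> d[OF that(2)] const that(1), of x]
    by (simp add: G_def mult.left_commute)
  have GP: "G n (P m x) = P m (G n x)" if "m \<ge> 1" "n \<ge> 1" for m n x
    using I_compose[OF \<nu>(1,2) \<nu>'(1) d[OF that(2)] const P_lin[OF that(1)] P_commute_R[OF that(1)], of x] by (simp add: G_def)
  have Gdiff: "G n (x - y) = G n x - G n y" if "n \<ge> 1" for n x y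
    unfolding G_def by (rule bounded_clinear_opD(4)[OF I_const_lin[OF \<nu>(1,2) \<nu>'(1) d[OF that]]])
  have GPlim: "(\<lambda>n. G n (P m x)) \<longlonglongrightarrow> G m x" if "m \<ge> 1" for m x
  proof (rule Lim_transform_eventually[OF Ptend])
    show "\<forall>\<^sub>F n in sequentially. P n (G m x) = G n (P m x)"
      using GP PG that by (intro eventually_sequentiallyI[of 1]) simp
  qed
  have C0: "C * norm x \<le> (\<bar>C\<bar> + 1) * norm x" for x by (intro mult_right_mono) auto
  have "Cauchy (\<lambda>n. G n x)"
  proof (rule metric_CauchyI)
    fix e :: real assume e: "e > 0"
    define M where "M = \<bar>C\<bar> + 1"
    have M: "M > 0" by (simp add: M_def)
    obtain N where "\<And>n. n \<ge> N \<Longrightarrow> norm (P n x - x) < e / 3 / M"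
      using LIMSEQ_D[OF Ptend[of x], of "e / 3 / M"] e M by auto
    then obtain k where k: "k \<ge> 1" "norm (P k x - x) < e / 3 / M" by (meson le_cases order_refl)
    have small: "norm (G n x - G n (P k x)) < e / 3" if "n \<ge> 1" for n
    proof -
      have "norm (G n x - G n (P k x)) \<le> C * norm (x - P k x)"
        using bnd[OF that, of "x - P k x"] Gdiff[OF that] by (simp add: G_def)
      also have "\<dots> \<le> M * norm (x - P k x)" using C0 by (simp add: M_def)
      also have "\<dots> < e / 3" using k(2) M by (simp add: norm_minus_commute field_simps)
      finally show ?thesis .
    qed
    obtain N' where N': "\<And>a b. a \<ge> N' \<Longrightarrow> b \<ge> N' \<Longrightarrow> dist (G a (P k x)) (G b (P k x)) < e / 3"
      using metric_CauchyD[OF LIMSEQ_imp_Cauchy[OF GPlim[OF k(1)]] divide_pos_pos[OF e zero_less_numeral]] by blast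
    have "dist (G a x) (G b x) < e" if "a \<ge> max N' 1" "b \<ge> max N' 1" for a b
    proof -
      have "G a x - G b x = (G a x - G a (P k x)) + (G a (P k x) - G b (P k x)) - (G b x - G b (P k x))" by simp
      also have "norm \<dots> \<le> norm (G a x - G a (P k x)) + norm (G a (P k x) - G b (P k x)) + norm (G b x - G b (P k x))"
        by (rule order_trans[OF norm_triangle_ineq4 add_right_mono[OF norm_triangle_ineq]])
      finally have "norm (G a x - G b x) \<le> norm (G a x - G a (P k x)) + norm (G a (P k x) - G b (P k x)) + norm (G b x - G b (P k x))" .
      then show ?thesis using small[of a] small[of b] N'[of a b] that by (simp add: dist_norm)
    qed
    then show "\<exists>M. \<forall>m\<ge>M. \<forall>n\<ge>M. dist (G m x) (G n x) < e" by blast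
  qed
  then have L: "(\<lambda>n. G n x) \<longlonglongrightarrow> lim (\<lambda>n. G n x)"
    by (simp add: Cauchy_convergent_iff convergent_LIMSEQ_iff)
  have "(\<lambda>n. P m (G n x)) \<longlonglongrightarrow> P m (lim (\<lambda>n. G n x))"
    by (rule bounded_linear.tendsto[OF bounded_clinear_opD(1)[OF P_lin[OF m]] L])
  moreover have "(\<lambda>n. P m (G n x)) \<longlonglongrightarrow> G m x"
  proof (rule Lim_transform_eventually[OF GPlim[OF m]])
    show "\<forall>\<^sub>F n in sequentially. G n (P m x) = P m (G n x)"
      using GP m by (intro eventually_sequentiallyI[of 1]) simp
  qed
  ultimately show ?thesis unfolding G_def by (rule LIMSEQ_unique)
qed

end

subsection \<open>Dependence on a parameter\<close>

text \<open>Cauchy's estimate on discs of radius \<open>r\<close> inside the disc of radius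
  \<open>2 r\<close>. The constant depends only on \<open>M\<close> and \<open>r\<close>, so it
  serves all \<open>z\<close> at once when \<open>h\<close> is \<open>f\<close> with its second
  variable frozen at \<open>z\<close>.\<close>

lemma bounded_holomorphic_lipschitz:
  fixes h :: "complex \<Rightarrow> complex"
  assumes hol: "h holomorphic_on ball w0 (2 * r)" and bnd: "\<And>w. w \<in> ball w0 (2 * r) \<Longrightarrow> cmod (h w) \<le> M"
    and w: "w \<in> ball w0 r"
  shows "cmod (h w - h w0) \<le> M / r * cmod (w - w0)"
proof (rule field_differentiable_bound[of "ball w0 r" h "deriv h"])
  have r: "r > 0" using w by (auto simp: dist_norm intro: le_less_trans[OF norm_ge_zero])
  then show "w0 \<in> ball w0 r" by simp
  fix z assume z: "z \<in> ball w0 r"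
  have sub: "cball z r \<subseteq> ball w0 (2 * r)"
  proof
    fix y assume "y \<in> cball z r"
    then show "y \<in> ball w0 (2 * r)" using z dist_triangle[of w0 y z] by (simp add: dist_commute)
  qed
  have "z \<in> ball w0 (2 * r)" using z r by auto
  then show "(h has_field_derivative deriv h z) (at z within ball w0 r)"
    using holomorphic_derivI[OF hol open_ball] has_field_derivative_at_within by blast
  have "norm ((deriv ^^ 1) h z) \<le> fact 1 * M / r ^ 1"
  proof (rule Cauchy_inequality[OF _ _ r])
    show "h holomorphic_on ball z r" using hol sub by (meson ball_subset_cball holomorphic_on_subset subset_trans)
    show "continuous_on (cball z r) h" using hol sub by (meson holomorphic_on_imp_continuous_on continuous_on_subset)
    fix x assume "cmod (z - x) = r"
    then have "x \<in> cball z r" by (simp add: dist_norm)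
    then show "cmod (h x) \<le> M" using sub bnd by auto
  qed
  then show "cmod (deriv h z) \<le> M / r" by simp
qed (use w in auto)

context resolvent_family
begin

lemma I_sum:
  assumes \<nu>: "\<alpha> < \<nu>" "\<nu> < \<rho>" "\<rho> \<le> pi" and V: "bdd_analytic (sector \<rho>) V"
    and g: "\<And>k. k < N \<Longrightarrow> decay1 \<rho> (g k)"
  shows "I \<nu> (\<lambda>z. \<Sum>k<N. a k * g k z) V = (\<Sum>k<(N::nat). a k *\<^sub>C I \<nu> (g k) V)"
  using g
proof (induction N)
  case 0
  then show ?case by (simp add: I_def)
next
  case (Suc N)
  have d: "decay1 \<rho> (\<lambda>z. \<Sum>k<N. a k * g k z)" using Suc.prems by (intro decay1_sum decay1_cmult) auto
  show ?case
    using I_lincomb[OF \<nu> d Suc.prems V, of N 1 "a N"] Suc by simp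
qed

text \<open>\<open>f\<close> is bounded and holomorphic in each variable separately, so uniformity
  in \<open>z\<close> comes from the local Lipschitz bound in \<open>w\<close>. It gives norm
  continuity through the norm estimate of the calculus, and a majorant for the difference quotients
  of the scalar integrals, which are then differentiated under the integral sign.\<close>

lemma I_param_analytic:
  assumes \<nu>: "\<alpha> < \<nu>" "\<nu> < \<rho>" "\<rho> \<le> pi" and g: "decay1 \<rho> g" and S: "open S"
    and fz: "\<And>w. w \<in> S \<Longrightarrow> f w holomorphic_on sector \<rho>"
    and fw: "\<And>z. z \<in> sector \<rho> \<Longrightarrow> (\<lambda>w. f w z) holomorphic_on S"
    and bd: "\<And>w z. w \<in> S \<Longrightarrow> z \<in> sector \<rho> \<Longrightarrow> cmod (f w z) \<le> M"
  shows "bdd_analytic S (\<lambda>w. I \<nu> (\<lambda>z. g z * f w z) (\<lambda>_. x))"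
proof -
  define V where "V = (\<lambda>w. I \<nu> (\<lambda>z. g z * f w z) (\<lambda>_. x))"
  obtain C where C: "C \<ge> 0" "\<And>z. z \<in> sector \<rho> \<Longrightarrow> cmod (g z) \<le> C * (cmod z / (1 + (cmod z)\<^sup>2))"
    using decay1E[OF g] by metis
  have dec: "decay1 \<rho> (\<lambda>z. g z * f w z)" if "w \<in> S" for w
    using decay1_mult_bounded[OF g fz[OF that] bd[OF that]] by (simp add: mult.commute)
  have mul: "cmod (g z * k) \<le> (C * N) * (cmod z / (1 + (cmod z)\<^sup>2))" if "z \<in> sector \<rho>" "cmod k \<le> N" for z k N
    unfolding norm_mult using mult_mono[OF C(2)[OF that(1)] that(2)] C(1) by (simp add: mult_ac)
  define M' where "M' = \<bar>M\<bar>"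
  have bd': "cmod (f w z) \<le> M'" if "w \<in> S" "z \<in> sector \<rho>" for w z using bd[OF that] by (simp add: M'_def)
  have M': "M' \<ge> 0" by (simp add: M'_def)
  have "norm (V w) \<le> norm x * (C * M' * K)" if "w \<in> S" for w
    unfolding V_def using C M' by (intro I_const_norm[OF \<nu> dec[OF that]] mul bd' that) auto
  moreover have loc: "\<exists>r>0. ball w0 (2 * r) \<subseteq> S \<and>
      (\<forall>w\<in>ball w0 r. \<forall>z\<in>sector \<rho>. cmod (f w z - f w0 z) \<le> M' / r * cmod (w - w0))" if w0: "w0 \<in> S" for w0
  proof -
    obtain e where e: "e > 0" "ball w0 e \<subseteq> S" using S w0 openE by blast
    have "cmod (f w z - f w0 z) \<le> M' / (e / 2) * cmod (w - w0)" if "w \<in> ball w0 (e / 2)" "z \<in> sector \<rho>" for w z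
      using e that fw[OF that(2)] bd'[OF _ that(2)]
      by (intro bounded_holomorphic_lipschitz[where h = "\<lambda>w. f w z"]) (auto intro: holomorphic_on_subset)
    then show ?thesis using e by (intro exI[of _ "e / 2"]) auto
  qed
  moreover have "continuous_on S V"
    unfolding continuous_on_eq_continuous_at[OF S] isCont_def
  proof
    fix w0 assume w0: "w0 \<in> S"
    obtain r where r: "r > 0" "ball w0 (2 * r) \<subseteq> S"
      "\<And>w z. w \<in> ball w0 r \<Longrightarrow> z \<in> sector \<rho> \<Longrightarrow> cmod (f w z - f w0 z) \<le> M' / r * cmod (w - w0)"
      using loc[OF w0] by blast
    have le: "norm (V w - V w0) \<le> norm x * (C * (M' / r * cmod (w - w0)) * K)" if w: "w \<in> ball w0 r" for w
    proof -
      have wS: "w \<in> S" using w r by auto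
      have eq: "(\<lambda>z. g z * (f w z - f w0 z)) = (\<lambda>z. 1 * (g z * f w z) + (-1) * (g z * f w0 z))"
        by (simp add: algebra_simps)
      have d: "decay1 \<rho> (\<lambda>z. g z * (f w z - f w0 z))"
        unfolding eq by (intro decay1_add decay1_cmult dec wS w0)
      have "V w - V w0 = I \<nu> (\<lambda>z. g z * (f w z - f w0 z)) (\<lambda>_. x)"
        unfolding eq I_lincomb[OF \<nu> dec[OF wS] dec[OF w0] bdd_analytic_const] by (simp add: V_def)
      also have "norm \<dots> \<le> norm x * (C * (M' / r * cmod (w - w0)) * K)"
        using C M' r w by (intro I_const_norm[OF \<nu> d] mul) auto
      finally show ?thesis .
    qed
    have "((\<lambda>w. norm x * (C * (M' / r * cmod (w - w0)) * K)) \<longlongrightarrow> norm x * (C * (M' / r * cmod (w0 - w0)) * K)) (at w0)"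
      by (intro tendsto_intros)
    then have lim: "((\<lambda>w. norm x * (C * (M' / r * cmod (w - w0)) * K)) \<longlongrightarrow> 0) (at w0)" by simp
    have "\<forall>\<^sub>F w in at w0. w \<in> ball w0 r" using r by (intro eventually_at_in_open') auto
    then have "\<forall>\<^sub>F w in at w0. norm (V w - V w0) \<le> norm x * (C * (M' / r * cmod (w - w0)) * K)"
      by (rule eventually_mono) (rule le)
    then have "((\<lambda>w. V w - V w0) \<longlongrightarrow> 0) (at w0)" by (rule Lim_null_comparison[OF _ lim])
    then show "V \<midarrow>w0\<rightarrow> V w0" by (simp add: Lim_null[symmetric])
  qed
  moreover have "(\<lambda>w. l (V w)) holomorphic_on S" if l: "dual_elem l" for l
    unfolding holomorphic_on_open[OF S]
  proof
    fix w0 assume w0: "w0 \<in> S"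
    obtain r where r: "r > 0" "ball w0 (2 * r) \<subseteq> S"
      "\<And>w z. w \<in> ball w0 r \<Longrightarrow> z \<in> sector \<rho> \<Longrightarrow> cmod (f w z - f w0 z) \<le> M' / r * cmod (w - w0)"
      using loc[OF w0] by blast
    obtain L where L: "L \<ge> 0" "\<And>x. cmod (l x) \<le> norm x * L"
      using bounded_linear.nonneg_bounded[OF dual_elemD(6)[OF l]] by auto
    define k where "k = (\<lambda>w t. g (bpath \<nu> t) * f w (bpath \<nu> t) * l (R (bpath \<nu> t) x) * bpath' \<nu> t)"
    have kint: "k w integrable_on UNIV" if "w \<in> S" for w
      unfolding k_def by (rule contour_fun_I[OF \<nu> dec[OF that] bdd_analytic_const l, of x]) (rule contour_fun.integrable)
    have lV: "l (V w) = 1 / (2 * pi * \<i>) * integral UNIV (k w)" if "w \<in> S" for w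
      unfolding V_def dual_I[OF \<nu> dec[OF that] bdd_analytic_const l] cint_def k_def ..
    define D where "D = (\<lambda>t. if t = 0 then 0 else g (bpath \<nu> t) * deriv (\<lambda>w. f w (bpath \<nu> t)) w0 * l (R (bpath \<nu> t) x) * bpath' \<nu> t)"
    define Q where "Q = (\<lambda>w t. if t = 0 then 0 else (k w t - k w0 t) / (w - w0))"
    define B where "B = C * (M' / r) * (K * norm x * L)"
    have ball: "w \<in> S" if "w \<in> ball w0 r" for w using that r by auto
    have Qint: "Q w integrable_on UNIV" and QV: "(l (V w) - l (V w0)) / (w - w0) = 1 / (2 * pi * \<i>) * integral UNIV (Q w)"
      if w: "w \<in> ball w0 r" "w \<noteq> w0" for w
    proof -
      have d: "((\<lambda>t. (k w t - k w0 t) / (w - w0)) has_integral (integral UNIV (k w) - integral UNIV (k w0)) / (w - w0)) UNIV"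
        by (intro has_integral_divide has_integral_diff integrable_integral kint ball w w0)
      then have Qi: "(Q w has_integral (integral UNIV (k w) - integral UNIV (k w0)) / (w - w0)) UNIV"
        by (rule has_integral_spike_finite[of "{0}", rotated 2]) (auto simp: Q_def)
      then show "Q w integrable_on UNIV" by blast
      show "(l (V w) - l (V w0)) / (w - w0) = 1 / (2 * pi * \<i>) * integral UNIV (Q w)"
        unfolding integral_unique[OF Qi] lV[OF ball[OF w(1)]] lV[OF w0] by (simp add: right_diff_distrib diff_divide_distrib)
    qed
    have Qbd: "norm (Q w t) \<le> B / (1 + t\<^sup>2)" if w: "w \<in> ball w0 r" "w \<noteq> w0" for w t
    proof (cases "t = 0")
      case True
      have "0 \<le> B" unfolding B_def using C M' r K L by simp
      then show ?thesis using True by (simp add: Q_def)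
    next
      case False
      have z: "bpath \<nu> t \<in> sector \<rho>" "bpath \<nu> t \<in> cosector \<alpha>" using bpath_mem[OF \<nu> False] by auto
      have "Q w t = g (bpath \<nu> t) * (f w (bpath \<nu> t) - f w0 (bpath \<nu> t)) / (w - w0) * (l (R (bpath \<nu> t) x) * bpath' \<nu> t)"
        using False by (simp add: Q_def k_def algebra_simps diff_divide_distrib)
      then have "norm (Q w t) = cmod (g (bpath \<nu> t)) * (cmod (f w (bpath \<nu> t) - f w0 (bpath \<nu> t)) / cmod (w - w0)) * cmod (l (R (bpath \<nu> t) x))"
        by (simp add: norm_mult norm_divide)
      also have "\<dots> \<le> (C * (\<bar>t\<bar> / (1 + t\<^sup>2))) * (M' / r) * (K / \<bar>t\<bar> * norm x * L)"
      proof (intro mult_mono mult_nonneg_nonneg)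
        show "cmod (g (bpath \<nu> t)) \<le> C * (\<bar>t\<bar> / (1 + t\<^sup>2))" using C(2)[OF z(1)] by simp
        show "cmod (f w (bpath \<nu> t) - f w0 (bpath \<nu> t)) / cmod (w - w0) \<le> M' / r"
          using r(3)[OF w(1) z(1)] w(2) by (simp add: pos_divide_le_eq)
        have "cmod (l (R (bpath \<nu> t) x)) \<le> norm (R (bpath \<nu> t) x) * L" by (rule L)
        also have "\<dots> \<le> K / \<bar>t\<bar> * norm x * L" using R_bound[OF z(2), of x] L by (intro mult_right_mono) auto
        finally show "cmod (l (R (bpath \<nu> t) x)) \<le> K / \<bar>t\<bar> * norm x * L" .
      qed (use C M' r K L in auto)
      also have "\<dots> = B / (1 + t\<^sup>2)" using False by (simp add: B_def ac_simps)
      finally show ?thesis .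
    qed
    have Qlim: "((\<lambda>w. Q w t) \<longlongrightarrow> D t) (at w0)" for t
    proof (cases "t = 0")
      case False
      have z: "bpath \<nu> t \<in> sector \<rho>" using bpath_mem[OF \<nu> False] by auto
      have "((\<lambda>w. f w (bpath \<nu> t)) has_field_derivative deriv (\<lambda>w. f w (bpath \<nu> t)) w0) (at w0)"
        by (rule holomorphic_derivI[OF fw[OF z] S w0])
      then have "((\<lambda>w. (f w (bpath \<nu> t) - f w0 (bpath \<nu> t)) / (w - w0)) \<longlongrightarrow> deriv (\<lambda>w. f w (bpath \<nu> t)) w0) (at w0)"
        by (simp add: has_field_derivative_iff)
      then have "((\<lambda>w. g (bpath \<nu> t) * ((f w (bpath \<nu> t) - f w0 (bpath \<nu> t)) / (w - w0)) * l (R (bpath \<nu> t) x) * bpath' \<nu> t) \<longlongrightarrow> D t) (at w0)"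
        unfolding D_def if_not_P[OF False] by (intro tendsto_mult tendsto_const)
      moreover have "Q w t = g (bpath \<nu> t) * ((f w (bpath \<nu> t) - f w0 (bpath \<nu> t)) / (w - w0)) * l (R (bpath \<nu> t) x) * bpath' \<nu> t" for w
        using False by (simp add: Q_def k_def algebra_simps diff_divide_distrib)
      ultimately show ?thesis by simp
    qed (simp add: Q_def D_def)
    have "((\<lambda>w. (l (V w) - l (V w0)) / (w - w0)) \<longlongrightarrow> 1 / (2 * pi * \<i>) * integral UNIV D) (at w0 within ball w0 r)"
      \<comment> \<open>Dominated convergence is sequential, so the limit in \<open>w\<close> is
        tested along sequences that avoid \<open>w0\<close>.\<close>
      unfolding tendsto_at_iff_sequentially o_def
    proof (intro allI impI)
      fix X assume X: "\<forall>i. X i \<in> ball w0 r - {w0}" and Xl: "X \<longlonglongrightarrow> w0"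
      have "(\<lambda>i. integral UNIV (Q (X i))) \<longlonglongrightarrow> integral UNIV D"
      proof (rule dominated_convergence(2)[OF _ integrable_const_over_1_plus_square[of B]])
        fix t
        have "filterlim X (at w0) sequentially" using X Xl by (auto simp: filterlim_at)
        then show "(\<lambda>i. Q (X i) t) \<longlonglongrightarrow> D t" by (rule filterlim_compose[OF Qlim])
      qed (use X Qint Qbd in auto)
      then have "(\<lambda>i. 1 / (2 * pi * \<i>) * integral UNIV (Q (X i))) \<longlonglongrightarrow> 1 / (2 * pi * \<i>) * integral UNIV D"
        by (rule tendsto_mult_left)
      moreover have "(l (V (X i)) - l (V w0)) / (X i - w0) = 1 / (2 * pi * \<i>) * integral UNIV (Q (X i))" for i
        using X by (intro QV) auto
      ultimately show "(\<lambda>i. (l (V (X i)) - l (V w0)) / (X i - w0)) \<longlonglongrightarrow> 1 / (2 * pi * \<i>) * integral UNIV D" by simp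
    qed
    then have "((\<lambda>w. (l (V w) - l (V w0)) / (w - w0)) \<longlongrightarrow> 1 / (2 * pi * \<i>) * integral UNIV D) (at w0)"
      using r by (simp add: at_within_open[of w0 "ball w0 r"])
    then show "\<exists>f'. ((\<lambda>w. l (V w)) has_field_derivative f') (at w0)"
      unfolding has_field_derivative_iff by blast
  qed
  ultimately show ?thesis unfolding bdd_analytic_def V_def by blast
qed

end

subsection \<open>A dyadic partition of unity\<close>

text \<open>With \<open>p = z / (1 + z)\<close> this is the part \<open>j \<ge> 3\<close> of the
  binomial expansion of \<open>(p + (1 - p))^5\<close>, that is,
  \<open>10 p^3 - 15 p^4 + 6 p^5\<close>. Its complement
  \<open>1 - step z = (1 + 5 z + 10 z^2) / (1 + z)^5\<close> is the mirror image under
  \<open>z\<close> to \<open>1 / z\<close>.\<close>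

definition step :: "complex \<Rightarrow> complex" where
  "step z = (10 * z ^ 3 + 5 * z ^ 4 + z ^ 5) / (1 + z) ^ 5"

text \<open>What is left of \<open>step z - step (z / 2)\<close> after division by the square of
  \<open>hfun 1 z\<close>. Hence only one power of \<open>1 + z\<close> remains, next to the five
  powers of \<open>2 + z\<close> from \<open>step (z / 2)\<close>; degree \<open>5\<close> over
  degree \<open>6\<close> and the zero at \<open>0\<close> leave decay at both ends.\<close>

definition bump :: "complex \<Rightarrow> complex" where
  "bump z = z * (280 + 750 * z + 781 * z ^ 2 + 375 * z ^ 3 + 70 * z ^ 4) / ((1 + z) * (2 + z) ^ 5)"

text \<open>\<open>step\<close> vanishes to third order at \<open>0\<close> and \<open>1 - step\<close> to third order at infinity, so each dyadic
  increment of \<open>step\<close> contains the factor \<open>hfun\<close> twice and still leaves an integrable factor.\<close>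

lemma step_increment:
  assumes s: "s > 0" and z: "of_real s + z \<noteq> 0" "2 * of_real s + z \<noteq> 0"
  shows "step (z / of_real s) - step (z / (2 * of_real s)) = hfun s z * (hfun s z * bump (z / of_real s))"
proof -
  define w where "w = z / of_real s"
  have s0: "complex_of_real s \<noteq> 0" using s by simp
  have zw: "z = of_real s * w" using s0 by (simp add: w_def)
  have 1: "1 + w \<noteq> 0" and 2: "2 + w \<noteq> 0"
  proof -
    have "of_real s + z = of_real s * (1 + w)" "2 * of_real s + z = of_real s * (2 + w)"
      by (simp_all add: zw algebra_simps)
    then show "1 + w \<noteq> 0" "2 + w \<noteq> 0" using z by auto
  qed
  have h: "hfun s z = w / (1 + w)\<^sup>2"
  proof -
    have "of_real s + z = of_real s * (1 + w)" by (simp add: zw distrib_left)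
    then show ?thesis using s0 1 by (simp add: hfun_def zw power2_eq_square)
  qed
  have half: "step (w / 2) = (40 * w ^ 3 + 10 * w ^ 4 + w ^ 5) / (2 + w) ^ 5"
  proof -
    have "(1 + w / 2) ^ 5 = ((2 + w) / 2) ^ 5" by (simp add: add_divide_distrib)
    then have 1: "(1 + w / 2) ^ 5 = (2 + w) ^ 5 / 32" by (simp add: power_divide)
    have 2: "10 * (w / 2) ^ 3 + 5 * (w / 2) ^ 4 + (w / 2) ^ 5 = (40 * w ^ 3 + 10 * w ^ 4 + w ^ 5) / 32"
      by (simp add: power_divide add_divide_distrib)
    have "(a / 32) / (b / 32) = a / b" for a b :: complex by simp
    then show ?thesis unfolding step_def 1 2 .
  qed
  define p where "p = 280 + 750 * w + 781 * w ^ 2 + 375 * w ^ 3 + 70 * w ^ 4"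
  have "(10 * w ^ 3 + 5 * w ^ 4 + w ^ 5) * (2 + w) ^ 5 - (40 * w ^ 3 + 10 * w ^ 4 + w ^ 5) * (1 + w) ^ 5 = w ^ 3 * p"
    unfolding p_def by algebra
  then have "step w - step (w / 2) = w ^ 3 * p / ((1 + w) ^ 5 * (2 + w) ^ 5)"
    unfolding half unfolding step_def using 1 2 by (subst diff_frac_eq) auto
  also have "\<dots> = w / (1 + w)\<^sup>2 * (w / (1 + w)\<^sup>2 * (w * p / ((1 + w) * (2 + w) ^ 5)))"
    by (simp add: power2_eq_square power3_eq_cube eval_nat_numeral mult_ac)
  finally have "step w - step (w / 2) = hfun s z * (hfun s z * bump w)" by (simp add: h bump_def p_def)
  moreover have "z / (2 * of_real s) = w / 2" by (simp add: w_def)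
  ultimately show ?thesis by (simp only: w_def)
qed

text \<open>With \<open>a k = r / (s 2^k + r)\<close> every summand is at most
  \<open>2 (a k - a (k + 1))\<close>, and the sum telescopes. The bound depends neither on the
  starting scale \<open>s\<close> nor on \<open>N\<close>, which lets the partition be extended to
  all scales.\<close>

lemma dyadic_sum_le:
  fixes s r :: real
  assumes s: "s > 0" and r: "r \<ge> 0"
  shows "(\<Sum>k<N. (s * 2 ^ k) * r / (s * 2 ^ k + r)\<^sup>2) \<le> 2"
proof -
  define a where "a = (\<lambda>k. r / (s * 2 ^ k + r))"
  have "(s * 2 ^ k) * r / (s * 2 ^ k + r)\<^sup>2 \<le> 2 * (a k - a (Suc k))" for k
  proof -
    define t where "t = s * 2 ^ k"
    have t: "t > 0" using s by (simp add: t_def)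
    have ak: "a k = r / (t + r)" "a (Suc k) = r / (2 * t + r)" by (simp_all add: a_def t_def mult_ac)
    have "a k - a (Suc k) = r * t / ((t + r) * (2 * t + r))"
      unfolding ak using t r by (subst diff_frac_eq) (auto simp: algebra_simps)
    moreover have "t * r / (2 * (t + r)\<^sup>2) \<le> r * t / ((t + r) * (2 * t + r))"
    proof (rule frac_le)
      have "(t + r) * (2 * t + r) \<le> (t + r) * (2 * (t + r))" using t r by (intro mult_left_mono) auto
      then show "(t + r) * (2 * t + r) \<le> 2 * (t + r)\<^sup>2" by (simp add: power2_eq_square mult_ac)
    qed (use t r in \<open>auto simp: mult.commute intro!: mult_pos_pos add_pos_nonneg\<close>)
    ultimately have "t * r / (2 * (t + r)\<^sup>2) \<le> a k - a (Suc k)" by (simp only:)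
    then have "2 * (t * r / (2 * (t + r)\<^sup>2)) \<le> 2 * (a k - a (Suc k))" by (rule mult_left_mono) simp
    then show ?thesis by (simp add: t_def)
  qed
  then have "(\<Sum>k<N. (s * 2 ^ k) * r / (s * 2 ^ k + r)\<^sup>2) \<le> (\<Sum>k<N. 2 * (a k - a (Suc k)))"
    by (rule sum_mono)
  also have "\<dots> = 2 * (a 0 - a N)" by (simp only: sum_distrib_left[symmetric] sum_lessThan_telescope')
  also have "\<dots> \<le> 2"
  proof -
    have "a 0 \<le> 1" "a N \<ge> 0" using s r by (auto simp: a_def divide_le_eq_1)
    then show ?thesis by simp
  qed
  finally show ?thesis .
qed

lemma hfun_sum_le:
  assumes "0 \<le> \<rho>" "\<rho> < pi"
  obtains C where "C \<ge> 0" "\<And>s z N. s > 0 \<Longrightarrow> z \<in> sector \<rho> \<Longrightarrow> (\<Sum>k<N. cmod (hfun (s * 2 ^ k) z)) \<le> C"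
proof -
  obtain c where c: "c > 0" "\<And>s z. s > 0 \<Longrightarrow> \<bar>Arg z\<bar> \<le> \<rho> \<Longrightarrow> c * (s + cmod z) \<le> cmod (of_real s + z)"
    using norm_plus_real_ge[OF assms] by metis
  show ?thesis
  proof (rule that[of "(1 / c\<^sup>2) * 2"])
    fix s :: real and z N assume s: "s > 0" and z: "z \<in> sector \<rho>"
    have "cmod (hfun (s * 2 ^ k) z) \<le> (1 / c\<^sup>2) * ((s * 2 ^ k) * cmod z / (s * 2 ^ k + cmod z)\<^sup>2)" for k
      using s z by (intro hfun_bound c) (auto simp: sector_def)
    then have "(\<Sum>k<N. cmod (hfun (s * 2 ^ k) z)) \<le> (1 / c\<^sup>2) * (\<Sum>k<N. (s * 2 ^ k) * cmod z / (s * 2 ^ k + cmod z)\<^sup>2)"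
      unfolding sum_distrib_left by (intro sum_mono)
    also have "\<dots> \<le> (1 / c\<^sup>2) * 2"
      using dyadic_sum_le[OF s, of "cmod z" N] by (intro mult_left_mono) auto
    finally show "(\<Sum>k<N. cmod (hfun (s * 2 ^ k) z)) \<le> (1 / c\<^sup>2) * 2" .
  qed simp
qed

lemma step_bump_bounds:
  assumes "0 \<le> \<rho>" "\<rho> < pi"
  obtains C where "C \<ge> 0" "\<And>z. z \<in> sector \<rho> \<Longrightarrow> cmod (step z) \<le> C"
    "\<And>z. z \<in> sector \<rho> \<Longrightarrow> cmod (bump z) \<le> C * (cmod z / (1 + (cmod z)\<^sup>2))"
    "bump holomorphic_on sector \<rho>"
proof -
  obtain c where c: "c > 0" "\<And>s z. s > 0 \<Longrightarrow> \<bar>Arg z\<bar> \<le> \<rho> \<Longrightarrow> c * (s + cmod z) \<le> cmod (of_real s + z)"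
    using norm_plus_real_ge[OF assms] by metis
  have 1: "c * (1 + cmod z) \<le> cmod (1 + z)" and 2: "c * (1 + cmod z) \<le> cmod (2 + z)" if "z \<in> sector \<rho>" for z
  proof -
    have z: "\<bar>Arg z\<bar> \<le> \<rho>" using that by (simp add: sector_def)
    show "c * (1 + cmod z) \<le> cmod (1 + z)" using c(2)[of 1, OF _ z] by simp
    have "c * (1 + cmod z) \<le> c * (2 + cmod z)" using c(1) by (intro mult_left_mono) auto
    also have "\<dots> \<le> cmod (2 + z)" using c(2)[of 2, OF _ z] by simp
    finally show "c * (1 + cmod z) \<le> cmod (2 + z)" .
  qed
  have pos: "0 < c * (1 + cmod z)" for z using c(1) by (auto intro!: mult_pos_pos add_pos_nonneg)
  have ne: "1 + z \<noteq> 0" "2 + z \<noteq> 0" if "z \<in> sector \<rho>" for z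
    using 1[OF that] 2[OF that] pos[of z] by auto
  \<comment> \<open>Here \<open>16\<close> is the sum of the coefficients of the numerator, each
    power of \<open>r\<close> being at most \<open>(1 + r)^5\<close>; in the bound on
    \<open>bump\<close> below, \<open>781\<close> is the largest coefficient, which dominates
    coefficient by coefficient.\<close>
  have stepb: "cmod (step z) \<le> 16 / c ^ 5" if z: "z \<in> sector \<rho>" for z
  proof -
    define r where "r = cmod z"
    have r: "r \<ge> 0" by (simp add: r_def)
    have "cmod (10 * z ^ 3 + 5 * z ^ 4 + z ^ 5) \<le> 10 * r ^ 3 + 5 * r ^ 4 + r ^ 5"
      by (intro order_trans[OF norm_triangle_ineq] add_mono) (simp_all add: norm_mult norm_power r_def)
    also have "\<dots> \<le> 16 * (1 + r) ^ 5"
    proof -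
      have "16 * (1 + r) ^ 5 - (10 * r ^ 3 + 5 * r ^ 4 + r ^ 5) = 16 + 80 * r + 160 * r ^ 2 + 150 * r ^ 3 + 75 * r ^ 4 + 15 * r ^ 5"
        by algebra
      also have "\<dots> \<ge> 0" using r by simp
      finally show ?thesis by simp
    qed
    finally have n: "cmod (10 * z ^ 3 + 5 * z ^ 4 + z ^ 5) \<le> 16 * (1 + r) ^ 5" .
    have "(c * (1 + r)) ^ 5 \<le> cmod (1 + z) ^ 5" using 1[OF z] pos[of z] by (intro power_mono) (auto simp: r_def)
    then have "cmod (step z) \<le> (16 * (1 + r) ^ 5) / (c * (1 + r)) ^ 5"
      unfolding step_def norm_divide norm_power using n pos[of z] by (intro frac_le) (auto simp: r_def)
    also have "\<dots> = 16 / c ^ 5" using r c(1) by (simp add: power_mult_distrib)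
    finally show ?thesis .
  qed
  have bumpb: "cmod (bump z) \<le> 781 / c ^ 6 * (cmod z / (1 + (cmod z)\<^sup>2))" if z: "z \<in> sector \<rho>" for z
  proof -
    define r where "r = cmod z"
    have r: "r \<ge> 0" by (simp add: r_def)
    have "cmod (280 + 750 * z + 781 * z ^ 2 + 375 * z ^ 3 + 70 * z ^ 4) \<le> 280 + 750 * r + 781 * r ^ 2 + 375 * r ^ 3 + 70 * r ^ 4"
      by (intro order_trans[OF norm_triangle_ineq] add_mono) (simp_all add: norm_mult norm_power r_def)
    also have "\<dots> \<le> 781 * (1 + r) ^ 4"
    proof -
      have "781 * (1 + r) ^ 4 - (280 + 750 * r + 781 * r ^ 2 + 375 * r ^ 3 + 70 * r ^ 4)
        = 501 + 2374 * r + 3905 * r ^ 2 + 2749 * r ^ 3 + 711 * r ^ 4"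
        by algebra
      also have "\<dots> \<ge> 0" using r by simp
      finally show ?thesis by simp
    qed
    finally have n: "cmod (280 + 750 * z + 781 * z ^ 2 + 375 * z ^ 3 + 70 * z ^ 4) \<le> 781 * (1 + r) ^ 4" .
    have "(c * (1 + r)) * (c * (1 + r)) ^ 5 \<le> cmod (1 + z) * cmod (2 + z) ^ 5"
      using 1[OF z] 2[OF z] pos[of z] by (intro mult_mono power_mono) (auto simp: r_def)
    then have "cmod (bump z) \<le> (r * (781 * (1 + r) ^ 4)) / ((c * (1 + r)) * (c * (1 + r)) ^ 5)"
      unfolding bump_def norm_divide norm_mult norm_power
    proof (intro frac_le)
      show "cmod z * cmod (280 + 750 * z + 781 * z ^ 2 + 375 * z ^ 3 + 70 * z ^ 4) \<le> r * (781 * (1 + r) ^ 4)"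
        unfolding r_def[symmetric] using n r by (intro mult_left_mono) auto
      show "0 < c * (1 + r) * (c * (1 + r)) ^ 5" using c(1) r by (intro mult_pos_pos zero_less_power add_pos_nonneg) auto
    qed (use r in auto)
    also have "\<dots> = (781 / c ^ 6) * (r / (1 + r)\<^sup>2)"
    proof -
      have eq: "(c * (1 + r)) * (c * (1 + r)) ^ 5 = c ^ 6 * ((1 + r) ^ 4 * (1 + r)\<^sup>2)" by algebra
      have "r * (781 * x) / (d * (x * y)) = 781 / d * (r / y)" if "x \<noteq> 0" for x y d :: real
        using that by simp
      moreover have "(1 + r) ^ 4 \<noteq> 0" using r by simp
      ultimately show ?thesis unfolding eq by blast
    qed
    also have "\<dots> \<le> (781 / c ^ 6) * (r / (1 + r\<^sup>2))"
      using r c(1) by (intro mult_left_mono frac_le) (auto simp: power2_eq_square algebra_simps add_pos_nonneg)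
    finally show ?thesis by (simp add: r_def)
  qed
  define C where "C = max (16 / c ^ 5) (781 / c ^ 6)"
  show ?thesis
  proof (rule that[of C])
    show "C \<ge> 0" using c by (simp add: C_def le_max_iff_disj)
    show "cmod (step z) \<le> C" if "z \<in> sector \<rho>" for z using stepb[OF that] by (simp add: C_def)
    show "cmod (bump z) \<le> C * (cmod z / (1 + (cmod z)\<^sup>2))" if "z \<in> sector \<rho>" for z
      by (rule order_trans[OF bumpb[OF that] mult_right_mono]) (auto simp: C_def)
    show "bump holomorphic_on sector \<rho>"
      unfolding bump_def[abs_def] using ne by (intro holomorphic_intros) auto
  qed
qed

lemma sector_scale: "s > 0 \<Longrightarrow> z \<in> sector \<rho> \<Longrightarrow> z / of_real s \<in> sector \<rho>"
  by (simp add: sector_def)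

lemma decay1_scale:
  assumes s: "s > 0" and hol: "g holomorphic_on sector \<rho>"
    and bnd: "\<And>z. z \<in> sector \<rho> \<Longrightarrow> cmod (g z) \<le> C * (cmod z / (1 + (cmod z)\<^sup>2))" and C: "0 \<le> C"
  shows "decay1 \<rho> (\<lambda>z. g (z / of_real s))"
proof (rule decay1I[of _ _ "C * (s / min 1 (s\<^sup>2))"])
  have "(g \<circ> (\<lambda>z. z / of_real s)) holomorphic_on sector \<rho>"
    using s by (intro holomorphic_on_compose_gen[OF _ hol] holomorphic_intros) (auto intro: sector_scale)
  then show "(\<lambda>z. g (z / of_real s)) holomorphic_on sector \<rho>" by (simp add: o_def)
  fix z assume z: "z \<in> sector \<rho>"
  define r where "r = cmod z"
  have m: "min 1 (s\<^sup>2) > 0" using s by simp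
  have "cmod (g (z / of_real s)) \<le> C * ((r / s) / (1 + (r / s)\<^sup>2))"
    using bnd[OF sector_scale[OF s z]] s by (simp add: norm_divide r_def)
  also have "(r / s) / (1 + (r / s)\<^sup>2) = s * r / (s\<^sup>2 + r\<^sup>2)"
    using s by (simp add: field_simps power2_eq_square)
  also have "C * (s * r / (s\<^sup>2 + r\<^sup>2)) \<le> C * (s * r / (min 1 (s\<^sup>2) * (1 + r\<^sup>2)))"
  proof (intro mult_left_mono frac_le)
    have "min 1 (s\<^sup>2) * r\<^sup>2 \<le> 1 * r\<^sup>2" by (intro mult_right_mono) auto
    moreover have "min 1 (s\<^sup>2) \<le> s\<^sup>2" by simp
    ultimately show "min 1 (s\<^sup>2) * (1 + r\<^sup>2) \<le> s\<^sup>2 + r\<^sup>2" unfolding distrib_left by linarith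
    show "0 < min 1 (s\<^sup>2) * (1 + r\<^sup>2)" using m by (intro mult_pos_pos) (auto intro: add_pos_nonneg)
  qed (use s C in \<open>auto simp: r_def\<close>)
  finally show "cmod (g (z / of_real s)) \<le> C * (s / min 1 (s\<^sup>2)) * (cmod z / (1 + (cmod z)\<^sup>2))"
    by (simp add: r_def)
qed

lemma step_telescope_tendsto:
  assumes "z \<noteq> 0"
  shows "(\<lambda>M. step (2 ^ M * z) - step (z / 2 ^ M)) \<longlonglongrightarrow> 1"
proof -
  have p: "(\<lambda>M. (1 / 2) ^ M :: complex) \<longlonglongrightarrow> 0" by (rule LIMSEQ_power_zero) (simp add: norm_divide)
  have "(\<lambda>M. step (z * (1 / 2) ^ M)) \<longlonglongrightarrow> (10 * (z * 0) ^ 3 + 5 * (z * 0) ^ 4 + (z * 0) ^ 5) / (1 + z * 0) ^ 5"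
    unfolding step_def by (intro tendsto_intros p) auto
  moreover have "z * (1 / 2) ^ M = z / 2 ^ M" for M by (simp add: power_one_over)
  ultimately have 1: "(\<lambda>M. step (z / 2 ^ M)) \<longlonglongrightarrow> 0" by simp
  define y where "y = (\<lambda>M. (1 / z) * (1 / 2) ^ M)"
  have y0: "y M \<noteq> 0" for M using assms by (simp add: y_def)
  \<comment> \<open>The behaviour at infinity is read off at \<open>0\<close> in the variable
    \<open>y = 1 / (2^M z)\<close>. At \<open>y M = - 1\<close> both sides are quotients by
    \<open>0\<close>, hence equal.\<close>
  have eq: "step (1 / y M) = (10 * y M ^ 2 + 5 * y M + 1) / (y M + 1) ^ 5" for M
  proof (cases "y M + 1 = 0")
    case True
    then have "y M = - 1" by (simp add: eq_neg_iff_add_eq_0)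
    then show ?thesis by (simp add: step_def)
  next
    case False
    have a: "1 + 1 / y M = (y M + 1) / y M" using y0[of M] by (simp add: field_simps)
    have b: "10 * (1 / y M) ^ 3 + 5 * (1 / y M) ^ 4 + (1 / y M) ^ 5 = (10 * y M ^ 2 + 5 * y M + 1) / y M ^ 5"
      using y0[of M] by (simp add: field_simps eval_nat_numeral)
    show ?thesis unfolding step_def a b using y0[of M] by (simp add: power_divide)
  qed
  have "y \<longlonglongrightarrow> (1 / z) * 0" unfolding y_def by (intro tendsto_intros p)
  then have "y \<longlonglongrightarrow> 0" by simp
  then have "(\<lambda>M. (10 * y M ^ 2 + 5 * y M + 1) / (y M + 1) ^ 5) \<longlonglongrightarrow> (10 * 0 ^ 2 + 5 * 0 + 1) / (0 + 1) ^ 5"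
    by (intro tendsto_intros) auto
  then have "(\<lambda>M. step (1 / y M)) \<longlonglongrightarrow> 1" by (simp add: eq)
  moreover have "1 / y M = 2 ^ M * z" for M by (simp add: y_def power_one_over)
  ultimately have "(\<lambda>M. step (2 ^ M * z)) \<longlonglongrightarrow> 1" by simp
  from tendsto_diff[OF this 1] show ?thesis by simp
qed

subsection \<open>Unconditional sums and U-boundedness\<close>

abbreviation sgn_of :: "bool \<Rightarrow> complex" where
  "sgn_of b \<equiv> (if b then 1 else - 1)"

text \<open>Functions live on the sector of angle \<sigma>, while \<eta> is the angle at which
  \<open>fc\<close> places its contour. The hypothesis on the calculus speaks of this contour, so
  unconditional sums are formed at \<eta>.\<close>

locale Hinf_family = resolvent_family R \<alpha> K for R :: "complex \<Rightarrow> 'a::complex_banach \<Rightarrow> 'a" and \<alpha> K +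
  fixes \<sigma> \<eta> CH :: real
  assumes angles: "\<alpha> < \<eta>" "\<eta> < \<sigma>" "\<sigma> < pi" and CH: "0 \<le> CH"
    and Hinf_bound: "\<And>g M x. decay1 \<sigma> g \<Longrightarrow> (\<And>z. z \<in> sector \<sigma> \<Longrightarrow> cmod (g z) \<le> M) \<Longrightarrow>
      norm (I \<eta> g (\<lambda>_. x)) \<le> CH * M * norm x"
begin

lemma \<sigma>_nonneg: "0 \<le> \<sigma>" and \<sigma>_le: "\<sigma> \<le> pi" and \<eta>_less: "\<eta> < pi" and \<eta>_pos: "0 < \<eta>"
  using angles \<alpha> by auto

text \<open>The signs are moved into the function: a signed sum of operators is the calculus applied
  to one function, which on the sector is at most \<open>D\<close> times the sum of all
  \<open>|hfun|\<close>, whatever the signs. The calculus bound sees nothing but this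
  supremum.\<close>

lemma unconditional:
  obtains C where "C \<ge> 0" "\<And>s N e g D x. s > 0 \<Longrightarrow> (\<And>k. k < N \<Longrightarrow> decay1 \<sigma> (g k)) \<Longrightarrow> 0 \<le> D \<Longrightarrow>
      (\<And>k z. k < N \<Longrightarrow> z \<in> sector \<sigma> \<Longrightarrow> cmod (g k z) \<le> D * cmod (hfun (s * 2 ^ k) z)) \<Longrightarrow>
      norm (\<Sum>k<(N::nat). sgn_of (e k) *\<^sub>C I \<eta> (g k) (\<lambda>_. x)) \<le> C * D * norm x"
proof -
  obtain B where B: "B \<ge> 0" "\<And>s z N. s > 0 \<Longrightarrow> z \<in> sector \<sigma> \<Longrightarrow> (\<Sum>k<N. cmod (hfun (s * 2 ^ k) z)) \<le> B"
    using hfun_sum_le[OF \<sigma>_nonneg angles(3)] by metis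
  show ?thesis
  proof (rule that[of "CH * B"])
    fix s :: real and N :: nat and e g D x
    assume s: "s > 0" and g: "\<And>k. k < N \<Longrightarrow> decay1 \<sigma> (g k)" and D: "0 \<le> D"
      and le: "\<And>k z. k < N \<Longrightarrow> z \<in> sector \<sigma> \<Longrightarrow> cmod (g k z) \<le> D * cmod (hfun (s * 2 ^ k) z)"
    have "(\<Sum>k<N. sgn_of (e k) *\<^sub>C I \<eta> (g k) (\<lambda>_. x)) = I \<eta> (\<lambda>z. \<Sum>k<N. sgn_of (e k) * g k z) (\<lambda>_. x)"
      by (rule I_sum[OF angles(1,2) \<sigma>_le bdd_analytic_const g, symmetric])
    also have "norm \<dots> \<le> CH * (D * B) * norm x"
    proof (rule Hinf_bound)
      show "decay1 \<sigma> (\<lambda>z. \<Sum>k<N. sgn_of (e k) * g k z)" using g by (intro decay1_sum decay1_cmult) auto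
      fix z assume z: "z \<in> sector \<sigma>"
      have "cmod (\<Sum>k<N. sgn_of (e k) * g k z) \<le> (\<Sum>k<N. D * cmod (hfun (s * 2 ^ k) z))"
        using le z by (intro sum_norm_le) (auto simp: norm_mult)
      also have "\<dots> \<le> D * B" unfolding sum_distrib_left[symmetric] using B(2)[OF s z] D by (intro mult_left_mono)
      finally show "cmod (\<Sum>k<N. sgn_of (e k) * g k z) \<le> D * B" .
    qed
    finally show "norm (\<Sum>k<N. sgn_of (e k) *\<^sub>C I \<eta> (g k) (\<lambda>_. x)) \<le> CH * B * D * norm x" by (simp add: mult_ac)
  qed (use B CH in auto)
qed

lemma H_unconditional:
  obtains C where "C \<ge> 0" "\<And>s N e x. s > 0 \<Longrightarrow> norm (\<Sum>k<(N::nat). sgn_of (e k) *\<^sub>C H (s * 2 ^ k) x) \<le> C * norm x"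
proof -
  obtain C where C: "C \<ge> 0" "\<And>s N e g D x. s > 0 \<Longrightarrow> (\<And>k. k < N \<Longrightarrow> decay1 \<sigma> (g k)) \<Longrightarrow> 0 \<le> D \<Longrightarrow>
      (\<And>k z. k < N \<Longrightarrow> z \<in> sector \<sigma> \<Longrightarrow> cmod (g k z) \<le> D * cmod (hfun (s * 2 ^ k) z)) \<Longrightarrow>
      norm (\<Sum>k<(N::nat). sgn_of (e k) *\<^sub>C I \<eta> (g k) (\<lambda>_. x)) \<le> C * D * norm x"
    using unconditional by blast
  have "norm (\<Sum>k<(N::nat). sgn_of (e k) *\<^sub>C H (s * 2 ^ k) x) \<le> C * 1 * norm x" if s: "s > 0" for s N e x
  proof -
    have "H (s * 2 ^ k) x = I \<eta> (hfun (s * 2 ^ k)) (\<lambda>_. x)" for k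
      using s by (intro I_hfun[symmetric] angles(1) \<eta>_less) auto
    then show ?thesis
      using s decay1_hfun[OF _ \<sigma>_nonneg angles(3)] C(2)[of s N "\<lambda>k. hfun (s * 2 ^ k)" 1 e x] by simp
  qed
  then show ?thesis using C(1) that[of C] by simp
qed

text \<open>\<open>\<mu> R(\<mu>)\<close> contributes the function
  \<open>\<mu> / (\<mu> - z)\<close>, bounded on the sector of \<sigma> uniformly for \<mu> at angle
  at least \<theta>, because \<open>\<sigma> < \<theta>\<close>. The points may differ from one
  scale to the next, as they will after the substitution.\<close>

lemma RH_unconditional:
  assumes \<theta>: "\<sigma> < \<theta>" "\<theta> \<le> pi"
  obtains C where "C \<ge> 0" "\<And>s N e \<mu> x. s > 0 \<Longrightarrow> (\<And>k. k < N \<Longrightarrow> \<mu> k \<noteq> 0 \<and> \<theta> \<le> \<bar>Arg (\<mu> k)\<bar>) \<Longrightarrow>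
     norm (\<Sum>k<(N::nat). sgn_of (e k) *\<^sub>C \<mu> k *\<^sub>C R (\<mu> k) (H (s * 2 ^ k) x)) \<le> C * norm x"
proof -
  obtain C where C: "C \<ge> 0" "\<And>s N e g D x. s > 0 \<Longrightarrow> (\<And>k. k < N \<Longrightarrow> decay1 \<sigma> (g k)) \<Longrightarrow> 0 \<le> D \<Longrightarrow>
      (\<And>k z. k < N \<Longrightarrow> z \<in> sector \<sigma> \<Longrightarrow> cmod (g k z) \<le> D * cmod (hfun (s * 2 ^ k) z)) \<Longrightarrow>
      norm (\<Sum>k<(N::nat). sgn_of (e k) *\<^sub>C I \<eta> (g k) (\<lambda>_. x)) \<le> C * D * norm x"
    using unconditional by blast
  obtain c where c: "c > 0"
    "\<And>\<mu> z. \<theta> \<le> \<bar>Arg \<mu>\<bar> \<Longrightarrow> \<bar>Arg z\<bar> \<le> \<sigma> \<Longrightarrow> c * (cmod \<mu> + cmod z) \<le> cmod (\<mu> - z)"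
    using sector_separation[OF \<sigma>_nonneg \<theta>] by metis
  have "norm (\<Sum>k<(N::nat). sgn_of (e k) *\<^sub>C \<mu> k *\<^sub>C R (\<mu> k) (H (s * 2 ^ k) x)) \<le> C * (1 / c) * norm x"
    if s: "s > 0" and \<mu>: "\<And>k. k < N \<Longrightarrow> \<mu> k \<noteq> 0 \<and> \<theta> \<le> \<bar>Arg (\<mu> k)\<bar>" for s N e \<mu> x
  proof -
    define g where "g = (\<lambda>k z. \<mu> k * (hfun (s * 2 ^ k) z / (\<mu> k - z)))"
    have dh: "decay1 \<sigma> (hfun (s * 2 ^ k))" for k using s by (intro decay1_hfun \<sigma>_nonneg angles) auto
    have dq: "decay1 \<sigma> (\<lambda>z. hfun (s * 2 ^ k) z / (\<mu> k - z))" if "k < N" for k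
      using \<mu>[OF that] \<theta> by (intro decay1_div dh \<sigma>_nonneg) auto
    have dg: "decay1 \<sigma> (g k)" if "k < N" for k unfolding g_def by (intro decay1_cmult dq that)
    have eq: "\<mu> k *\<^sub>C R (\<mu> k) (H (s * 2 ^ k) x) = I \<eta> (g k) (\<lambda>_. x)" if "k < N" for k
    proof -
      have "H (s * 2 ^ k) x = I \<eta> (hfun (s * 2 ^ k)) (\<lambda>_. x)"
        using s by (intro I_hfun[symmetric] angles(1) \<eta>_less) auto
      then have "R (\<mu> k) (H (s * 2 ^ k) x) = I \<eta> (\<lambda>z. hfun (s * 2 ^ k) z / (\<mu> k - z)) (\<lambda>_. x)"
        using \<mu>[OF that] \<theta> by (simp add: I_resolvent[OF angles(1,2) \<sigma>_le dh bdd_analytic_const])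
      then show ?thesis
        using I_lincomb[OF angles(1,2) \<sigma>_le dq[OF that] decay1_0 bdd_analytic_const, of "\<mu> k" 0 x] by (simp add: g_def)
    qed
    have "norm (\<Sum>k<N. sgn_of (e k) *\<^sub>C I \<eta> (g k) (\<lambda>_. x)) \<le> C * (1 / c) * norm x"
    proof (rule C(2)[OF s dg])
      fix k z assume k: "k < N" and z: "z \<in> sector \<sigma>"
      have "c * cmod (\<mu> k) \<le> c * (cmod (\<mu> k) + cmod z)" using c(1) by (intro mult_left_mono) auto
      also have "\<dots> \<le> cmod (\<mu> k - z)" using c(2)[of "\<mu> k" z] \<mu>[OF k] z by (simp add: sector_def)
      finally have "cmod (\<mu> k) / cmod (\<mu> k - z) \<le> cmod (\<mu> k) / (c * cmod (\<mu> k))"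
        using c(1) \<mu>[OF k] by (intro frac_le) auto
      also have "\<dots> = 1 / c" using \<mu>[OF k] by simp
      finally have "cmod (\<mu> k) / cmod (\<mu> k - z) * cmod (hfun (s * 2 ^ k) z) \<le> 1 / c * cmod (hfun (s * 2 ^ k) z)"
        by (intro mult_right_mono) auto
      then show "cmod (g k z) \<le> 1 / c * cmod (hfun (s * 2 ^ k) z)" by (simp add: g_def norm_mult norm_divide)
    qed (use c in auto)
    moreover have "(\<Sum>k<N. sgn_of (e k) *\<^sub>C \<mu> k *\<^sub>C R (\<mu> k) (H (s * 2 ^ k) x)) = (\<Sum>k<N. sgn_of (e k) *\<^sub>C I \<eta> (g k) (\<lambda>_. x))"
      by (intro sum.cong refl) (simp only: eq lessThan_iff)
    ultimately show ?thesis by (simp only:)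
  qed
  then show ?thesis using C(1) c(1) that[of "C * (1 / c)"] by simp
qed

end

section \<open>From U-boundedness to the estimate of the contour integral\<close>

lemma U_bounded_sum_le:
  fixes F :: "('a::complex_banach \<Rightarrow> 'a) set"
  assumes "U_bounded F"
  obtains C where "C \<ge> 0" "\<And>(n::nat) x l T a b. (\<And>k. k < n \<Longrightarrow> T k \<in> F) \<Longrightarrow> (\<And>k. k < n \<Longrightarrow> dual_elem (l k)) \<Longrightarrow>
     0 \<le> a \<Longrightarrow> 0 \<le> b \<Longrightarrow>
     (\<And>e. norm (\<Sum>k<n. sgn_of (e k) *\<^sub>C x k) \<le> a) \<Longrightarrow>
     (\<And>e y. cmod (\<Sum>k<n. sgn_of (e k) * l k y) \<le> b * norm y) \<Longrightarrow>
     (\<Sum>k<n. cmod (l k (T k (x k)))) \<le> C * a * b"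
proof -
  obtain C where C: "\<And>(n::nat) x l T. (\<forall>k<n. T k \<in> F) \<Longrightarrow> (\<forall>k<n. dual_elem (l k)) \<Longrightarrow>
     (\<Sum>k<n. cmod (l k (T k (x k)))) \<le>
       C * (SUP e::nat \<Rightarrow> bool. norm (\<Sum>k<n. if e k then x k else - x k))
         * (SUP e::nat \<Rightarrow> bool. onorm (\<lambda>y. \<Sum>k<n. if e k then l k y else - l k y))"
    using assms unfolding U_bounded_def by blast
  show ?thesis
  proof (rule that[of "\<bar>C\<bar>"])
    fix n :: nat and x :: "nat \<Rightarrow> 'a" and l :: "nat \<Rightarrow> 'a \<Rightarrow> complex" and T :: "nat \<Rightarrow> 'a \<Rightarrow> 'a" and a b :: real
    assume T: "\<And>k. k < n \<Longrightarrow> T k \<in> F" and l: "\<And>k. k < n \<Longrightarrow> dual_elem (l k)" and ab: "0 \<le> a" "0 \<le> b"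
      and xa: "\<And>e. norm (\<Sum>k<n. sgn_of (e k) *\<^sub>C x k) \<le> a"
      and lb: "\<And>e y. cmod (\<Sum>k<n. sgn_of (e k) * l k y) \<le> b * norm y"
    define S1 S2 where "S1 = (SUP e::nat \<Rightarrow> bool. norm (\<Sum>k<n. if e k then x k else - x k))"
      and "S2 = (SUP e::nat \<Rightarrow> bool. onorm (\<lambda>y. \<Sum>k<n. if e k then l k y else - l k y))"
    have eqx: "(\<Sum>k<n. sgn_of (e k) *\<^sub>C x k) = (\<Sum>k<n. if e k then x k else - x k)" for e
      by (intro sum.cong) auto
    have eql: "(\<Sum>k<n. sgn_of (e k) * l k y) = (\<Sum>k<n. if e k then l k y else - l k y)" for e y
      by (intro sum.cong) auto
    have x: "norm (\<Sum>k<n. if e k then x k else - x k) \<le> a" for e using xa[of e] unfolding eqx .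
    have o: "onorm (\<lambda>y. \<Sum>k<n. if e k then l k y else - l k y) \<le> b" for e
      using lb[of e] ab unfolding eql by (intro onorm_bound) auto
    have "S1 \<le> a" "S2 \<le> b" unfolding S1_def S2_def by (intro cSUP_least x o; simp)+
    \<comment> \<open>Nonnegativity of the suprema is needed to replace \<open>C\<close>, whose sign
      is unknown, by its modulus in the product.\<close>
    moreover have "0 \<le> S1"
      unfolding S1_def
      by (rule order_trans[OF norm_ge_zero cSUP_upper[of "\<lambda>_. True"]]) (auto intro!: bdd_aboveI2 x)
    moreover have "0 \<le> S2"
      unfolding S2_def
    proof (rule order_trans[OF onorm_pos_le cSUP_upper[of "\<lambda>_. True"]])
      have "bounded_linear (\<lambda>y. \<Sum>k<n. l k y)" by (intro bounded_linear_sum dual_elemD(6) l) simp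
      then show "bounded_linear (\<lambda>y. \<Sum>k<n. if True then l k y else - l k y)" by simp
    qed (auto intro!: bdd_aboveI2 o)
    ultimately have "S1 * S2 \<le> a * b" "0 \<le> S1 * S2" using ab by (auto intro!: mult_mono)
    then have "C * (S1 * S2) \<le> \<bar>C\<bar> * (a * b)" by (meson abs_ge_self abs_ge_zero mult_mono)
    moreover have "(\<Sum>k<n. cmod (l k (T k (x k)))) \<le> C * S1 * S2"
      unfolding S1_def S2_def using T l by (intro C) auto
    ultimately show "(\<Sum>k<n. cmod (l k (T k (x k)))) \<le> \<bar>C\<bar> * a * b" by (simp add: mult.assoc)
  qed simp
qed

context Hinf_family
begin

text \<open>The operators are reordered so that one \<open>H\<close> acts together with
  \<open>\<mu> R(\<mu>)\<close> on \<open>x\<close> and the other, together with \<open>Q\<close>,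
  on the functional, while \<open>T k\<close> stays between the two, as U-boundedness demands.
  Resolvents are moved past \<open>Q\<close> alone or past the product of \<open>Q\<close> and
  \<open>T k\<close>; for the regularized operators both commutations are known.\<close>

lemma U_pointwise:
  fixes F :: "('a \<Rightarrow> 'a) set"
  assumes \<theta>: "\<sigma> < \<theta>" "\<theta> \<le> pi" and U: "U_bounded F"
  obtains C where "C \<ge> 0" "\<And>(Q :: 'a \<Rightarrow> 'a) q T \<mu> (N::nat) l s (x :: 'a). bounded_clinear_op Q \<Longrightarrow> 0 \<le> q \<Longrightarrow> (\<And>y. norm (Q y) \<le> q * norm y) \<Longrightarrow>
     (\<And>z y. z \<in> cosector \<alpha> \<Longrightarrow> Q (R z y) = R z (Q y)) \<Longrightarrow>
     (\<And>k. k < N \<Longrightarrow> T k \<in> F) \<Longrightarrow> (\<And>k. k < N \<Longrightarrow> bounded_clinear_op (\<lambda>y. Q (T k y))) \<Longrightarrow>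
     (\<And>k z y. k < N \<Longrightarrow> z \<in> cosector \<alpha> \<Longrightarrow> Q (T k (R z y)) = R z (Q (T k y))) \<Longrightarrow>
     (\<And>k. k < N \<Longrightarrow> \<mu> k \<noteq> 0 \<and> \<theta> \<le> \<bar>Arg (\<mu> k)\<bar>) \<Longrightarrow> dual_elem l \<Longrightarrow> (\<And>y. cmod (l y) \<le> norm y) \<Longrightarrow> s > 0 \<Longrightarrow>
     (\<Sum>k<N. cmod (l (H (s * 2 ^ k) (H (s * 2 ^ k) (\<mu> k *\<^sub>C R (\<mu> k) (Q (T k x))))))) \<le> C * q * norm x"
proof -
  obtain CU where CU: "CU \<ge> 0" "\<And>(n::nat) x l T a b. (\<And>k. k < n \<Longrightarrow> T k \<in> F) \<Longrightarrow> (\<And>k. k < n \<Longrightarrow> dual_elem (l k)) \<Longrightarrow>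
     0 \<le> a \<Longrightarrow> 0 \<le> b \<Longrightarrow>
     (\<And>e. norm (\<Sum>k<n. sgn_of (e k) *\<^sub>C x k) \<le> a) \<Longrightarrow>
     (\<And>e y. cmod (\<Sum>k<n. sgn_of (e k) * l k y) \<le> b * norm y) \<Longrightarrow>
     (\<Sum>k<n. cmod (l k (T k (x k)))) \<le> CU * a * b"
    using U_bounded_sum_le[OF U] by blast
  obtain C1 where C1: "C1 \<ge> 0" "\<And>s N e x. s > 0 \<Longrightarrow> norm (\<Sum>k<(N::nat). sgn_of (e k) *\<^sub>C H (s * 2 ^ k) x) \<le> C1 * norm x"
    using H_unconditional by blast
  obtain C2 where C2: "C2 \<ge> 0" "\<And>s N e \<mu> x. s > 0 \<Longrightarrow> (\<And>k. k < N \<Longrightarrow> \<mu> k \<noteq> 0 \<and> \<theta> \<le> \<bar>Arg (\<mu> k)\<bar>) \<Longrightarrow>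
     norm (\<Sum>k<(N::nat). sgn_of (e k) *\<^sub>C \<mu> k *\<^sub>C R (\<mu> k) (H (s * 2 ^ k) x)) \<le> C2 * norm x"
    using RH_unconditional[OF \<theta>] by blast
  show ?thesis
  proof (rule that[of "CU * C2 * C1"])
    fix Q :: "'a \<Rightarrow> 'a" and T :: "nat \<Rightarrow> 'a \<Rightarrow> 'a" and q :: real and \<mu> :: "nat \<Rightarrow> complex" and N :: nat
      and l :: "'a \<Rightarrow> complex" and s :: real and x :: 'a
    assume Q: "bounded_clinear_op Q" and q: "0 \<le> q" "\<And>y. norm (Q y) \<le> q * norm y"
      and Qc: "\<And>z y. z \<in> cosector \<alpha> \<Longrightarrow> Q (R z y) = R z (Q y)"
      and T: "\<And>k. k < N \<Longrightarrow> T k \<in> F" and QT: "\<And>k. k < N \<Longrightarrow> bounded_clinear_op (\<lambda>y. Q (T k y))"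
      and QTc: "\<And>k z y. k < N \<Longrightarrow> z \<in> cosector \<alpha> \<Longrightarrow> Q (T k (R z y)) = R z (Q (T k y))"
      and \<mu>: "\<And>k. k < N \<Longrightarrow> \<mu> k \<noteq> 0 \<and> \<theta> \<le> \<bar>Arg (\<mu> k)\<bar>" and l: "dual_elem l" "\<And>y. cmod (l y) \<le> norm y" and s: "s > 0"
    define h where "h = (\<lambda>k. s * 2 ^ k)"
    have h: "h k > 0" for k using s by (simp add: h_def)
    note Hl = bounded_clinear_opD[OF H_lin[OF h]]
    have \<mu>o: "\<mu> k \<in> cosector \<alpha>" if "k < N" for k using \<mu>[OF that] \<theta> angles by (auto simp: cosector_def)
    have m: "- of_real (h k) \<in> cosector \<alpha>" for k using minus_real_in_cosector[OF h] \<alpha> by simp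
    have QH: "Q (H (h k) y) = H (h k) (Q y)" for k y
      unfolding H_def J_def by (simp add: bounded_clinear_opD[OF Q] Qc m bounded_clinear_opD[OF R_lin[OF m]])
    have QTH: "Q (T k (H (h j) y)) = H (h j) (Q (T k y))" if "k < N" for k j y
      unfolding H_def J_def by (simp add: bounded_clinear_opD[OF QT[OF that]] QTc that m bounded_clinear_opD[OF R_lin[OF m]])
    define x' where "x' = (\<lambda>k. \<mu> k *\<^sub>C R (\<mu> k) (H (h k) x))"
    define l' where "l' = (\<lambda>k y. l (Q (H (h k) y)))"
    have eq: "l (H (h k) (H (h k) (\<mu> k *\<^sub>C R (\<mu> k) (Q (T k x))))) = l' k (T k (x' k))" if k: "k < N" for k
    proof -
      have "Q (T k (x' k)) = \<mu> k *\<^sub>C R (\<mu> k) (H (h k) (Q (T k x)))"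
        unfolding x'_def by (simp add: bounded_clinear_opD(2)[OF QT[OF k]] QTc[OF k \<mu>o[OF k]] QTH[OF k])
      then have "H (h k) (Q (T k (x' k))) = H (h k) (H (h k) (\<mu> k *\<^sub>C R (\<mu> k) (Q (T k x))))"
        by (simp add: Hl H_commute_R[OF h \<mu>o[OF k]])
      then show ?thesis by (simp add: l'_def QH)
    qed
    have "(\<Sum>k<N. cmod (l' k (T k (x' k)))) \<le> CU * (C2 * norm x) * (q * C1)"
    proof (rule CU(2)[OF T])
      show "dual_elem (l' k)" for k
        unfolding l'_def by (rule dual_elem_comp[OF dual_elem_comp[OF l(1) Q] H_lin[OF h]])
      show "norm (\<Sum>k<N. sgn_of (e k) *\<^sub>C x' k) \<le> C2 * norm x" for e
        unfolding x'_def h_def by (rule C2(2)[OF s \<mu>])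
      show "cmod (\<Sum>k<N. sgn_of (e k) * l' k y) \<le> q * C1 * norm y" for e y
      proof -
        have "(\<Sum>k<N. sgn_of (e k) * l' k y) = l (Q (\<Sum>k<N. sgn_of (e k) *\<^sub>C H (h k) y))"
          by (simp only: bounded_clinear_opD[OF Q] dual_elem_sum[OF l(1)] dual_elemD(2)[OF l(1)] l'_def)
        also have "cmod \<dots> \<le> norm (Q (\<Sum>k<N. sgn_of (e k) *\<^sub>C H (h k) y))" by (rule l(2))
        also have "\<dots> \<le> q * norm (\<Sum>k<N. sgn_of (e k) *\<^sub>C H (h k) y)" by (rule q(2))
        also have "\<dots> \<le> q * (C1 * norm y)" unfolding h_def by (intro mult_left_mono C1(2) s q(1))
        finally show ?thesis by (simp add: mult.assoc)
      qed
    qed (use C1 C2 q in auto)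
    then show "(\<Sum>k<N. cmod (l (H (s * 2 ^ k) (H (s * 2 ^ k) (\<mu> k *\<^sub>C R (\<mu> k) (Q (T k x))))))) \<le> CU * C2 * C1 * q * norm x"
      using eq by (simp add: h_def mult_ac)
  qed (use CU C1 C2 in auto)
qed

lemma U_estimate:
  assumes \<theta>: "\<sigma> < \<theta>" "\<theta> < \<rho>" "\<rho> < pi" and U: "U_bounded (T ` sector \<rho>)"
    and Q: "\<And>n. n \<ge> 1 \<Longrightarrow> bounded_clinear_op (Q n)" "0 \<le> q" "\<And>n y. n \<ge> 1 \<Longrightarrow> norm (Q n y) \<le> q * norm y"
      "\<And>n z y. n \<ge> 1 \<Longrightarrow> z \<in> cosector \<alpha> \<Longrightarrow> Q n (R z y) = R z (Q n y)"
    and QT: "\<And>n w. n \<ge> 1 \<Longrightarrow> w \<in> sector \<rho> \<Longrightarrow> bounded_clinear_op (\<lambda>y. Q n (T w y))"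
      "\<And>n w z y. n \<ge> 1 \<Longrightarrow> w \<in> sector \<rho> \<Longrightarrow> z \<in> cosector \<alpha> \<Longrightarrow> Q n (T w (R z y)) = R z (Q n (T w y))"
    and an: "\<And>n x. n \<ge> 1 \<Longrightarrow> bdd_analytic (sector \<rho>) (\<lambda>w. Q n (T w x))"
  obtains C where "\<And>n x. n \<ge> 1 \<Longrightarrow> norm (I \<theta> (phi n) (\<lambda>w. Q n (T w x))) \<le> C * norm x"
proof -
  have \<theta>': "\<alpha> < \<theta>" "\<theta> \<le> pi" "\<theta> < pi" "\<rho> \<le> pi" "0 \<le> \<rho>" "0 \<le> \<theta>" using \<theta> angles \<alpha> by auto
  obtain CU where CU: "CU \<ge> 0" "\<And>(Q :: 'a \<Rightarrow> 'a) q T' \<mu> (N::nat) l s (x :: 'a). bounded_clinear_op Q \<Longrightarrow> 0 \<le> q \<Longrightarrow> (\<And>y. norm (Q y) \<le> q * norm y) \<Longrightarrow>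
     (\<And>z y. z \<in> cosector \<alpha> \<Longrightarrow> Q (R z y) = R z (Q y)) \<Longrightarrow>
     (\<And>k. k < N \<Longrightarrow> T' k \<in> T ` sector \<rho>) \<Longrightarrow> (\<And>k. k < N \<Longrightarrow> bounded_clinear_op (\<lambda>y. Q (T' k y))) \<Longrightarrow>
     (\<And>k z y. k < N \<Longrightarrow> z \<in> cosector \<alpha> \<Longrightarrow> Q (T' k (R z y)) = R z (Q (T' k y))) \<Longrightarrow>
     (\<And>k. k < N \<Longrightarrow> \<mu> k \<noteq> 0 \<and> \<theta> \<le> \<bar>Arg (\<mu> k)\<bar>) \<Longrightarrow> dual_elem l \<Longrightarrow> (\<And>y. cmod (l y) \<le> norm y) \<Longrightarrow> s > 0 \<Longrightarrow>
     (\<Sum>k<N. cmod (l (H (s * 2 ^ k) (H (s * 2 ^ k) (\<mu> k *\<^sub>C R (\<mu> k) (Q (T' k x))))))) \<le> CU * q * norm x"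
    using U_pointwise[OF \<theta>(1) \<theta>'(2) U] by blast
  obtain Cp where Cp: "Cp \<ge> 0" "\<And>n z. n \<ge> 1 \<Longrightarrow> z \<in> sector \<rho> \<Longrightarrow> cmod (phi n z) \<le> Cp" "\<And>n. n \<ge> 1 \<Longrightarrow> decay1 \<rho> (phi n)"
    using phi_bounds[OF \<theta>'(5) \<theta>(3)] by metis
  obtain Cb where Cb: "Cb \<ge> 0" "\<And>z. z \<in> sector \<rho> \<Longrightarrow> cmod (step z) \<le> Cb"
    "\<And>z. z \<in> sector \<rho> \<Longrightarrow> cmod (bump z) \<le> Cb * (cmod z / (1 + (cmod z)\<^sup>2))" "bump holomorphic_on sector \<rho>"
    using step_bump_bounds[OF \<theta>'(5) \<theta>(3)] by metis
  define C where "C = Cp * Cb * (CU * q)"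
  have "norm (I \<theta> (phi n) (\<lambda>w. Q n (T w x))) \<le> C * norm x" if n: "n \<ge> 1" for n x
  proof (rule norm_le_by_dual)
    fix l :: "'a \<Rightarrow> complex" assume l: "dual_elem l" "\<And>y. cmod (l y) \<le> norm y"
    define V where "V = (\<lambda>w. Q n (T w x))"
    have V: "bdd_analytic (sector \<rho>) V" unfolding V_def by (rule an[OF n])
    have db: "decay1 \<rho> (\<lambda>z. bump (z / of_real s))" if "s > 0" for s
      by (rule decay1_scale[OF that Cb(4) Cb(3) Cb(1)])
    have dpb: "decay1 \<rho> (\<lambda>z. phi n z * bump (z / of_real s))" if "s > 0" for s
      by (rule decay1_mult_bounded[OF db[OF that] decay1_holomorphic[OF Cp(3)[OF n]] Cp(2)[OF n]])
    note ba = bpath_in_sector[OF _ \<theta>'(6) \<theta>'(3) \<theta>(2)]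
    \<comment> \<open>The scales run from \<open>2^(-M)\<close> to \<open>2^(M - 1)\<close>, so the
      \<open>2 M\<close> increments telescope to the difference \<open>E\<close> of
      \<open>step\<close> at \<open>2^M z\<close> and at \<open>2^(-M) z\<close>, which tends to
      \<open>1\<close>.\<close>
    define h where "h = (\<lambda>M k. 2 ^ k / 2 ^ M :: real)"
    have h: "h M k > 0" for M k by (simp add: h_def)
    define E where "E = (\<lambda>M z. step (2 ^ M * z) - step (z / 2 ^ M))"
    have E_sum: "E M z = (\<Sum>k<2 * M. hfun (h M k) z * (hfun (h M k) z * bump (z / of_real (h M k))))"
      if z: "z \<in> sector \<rho>" for M z
    proof -
      have ne: "of_real t + z \<noteq> 0" if "t > 0" for t
      proof
        assume "of_real t + z = 0"
        then have "z = of_real (- t)" by (simp add: eq_neg_iff_add_eq_0 add.commute)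
        then show False using z \<theta>(3) that by (simp add: sector_def del: of_real_minus)
      qed
      have inc: "hfun (h M k) z * (hfun (h M k) z * bump (z / of_real (h M k)))
          = step (z / of_real (h M k)) - step (z / of_real (h M (Suc k)))" for k
      proof -
        have "of_real (h M (Suc k)) = (2 :: complex) * of_real (h M k)" by (simp add: h_def)
        then show ?thesis
          using step_increment[OF h ne[OF h], of M k] ne[OF h, of M "Suc k"] by simp
      qed
      have "(\<Sum>k<2 * M. hfun (h M k) z * (hfun (h M k) z * bump (z / of_real (h M k))))
          = step (z / of_real (h M 0)) - step (z / of_real (h M (2 * M)))"
        unfolding inc by (rule sum_lessThan_telescope')
      also have "z / of_real (h M 0) = 2 ^ M * z" by (simp add: h_def)
      also have "z / of_real (h M (2 * M)) = z / 2 ^ M" by (simp add: h_def mult_2 power_add)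
      finally show ?thesis by (simp add: E_def)
    qed
    \<comment> \<open>The factors \<open>1\<close> are the coefficients in the shape of
      \<open>I_sum\<close>.\<close>
    have Eb: "(\<Sum>k<2 * M. 1 * (hfun (h M k) z * (hfun (h M k) z * (phi n z * bump (z / of_real (h M k)))))) = E M z * phi n z"
      if "z \<in> sector \<rho>" for M z
      unfolding E_sum[OF that] sum_distrib_right by (intro sum.cong refl) simp
    have d1: "decay1 \<rho> (\<lambda>z. hfun s z * (phi n z * bump (z / of_real s)))" if "s > 0" for s
      by (intro decay1_mult[OF decay1_hfun[OF that \<theta>'(5) \<theta>(3)]] dpb that)
    have dE: "decay1 \<rho> (\<lambda>z. hfun s z * (hfun s z * (phi n z * bump (z / of_real s))))" if "s > 0" for s
      by (intro decay1_mult[OF decay1_hfun[OF that \<theta>'(5) \<theta>(3)]] d1 that)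
    define u where "u = (\<lambda>z. phi n z * l (R z (V z)))"
    obtain B where "contour_fun (sector \<rho> \<inter> cosector \<alpha>) u B \<theta>"
      unfolding u_def using contour_fun_I[OF \<theta>'(1) \<theta>(2) \<theta>'(4) Cp(3)[OF n] V l(1)] by metis
    then interpret u: contour_fun "sector \<rho> \<inter> cosector \<alpha>" u B \<theta> .
    \<comment> \<open>Dominated convergence removes the partition: \<open>E\<close> is bounded by
      \<open>2 Cb\<close> uniformly in \<open>M\<close> and converges to \<open>1\<close> on the
      contour.\<close>
    have lim: "(\<lambda>M. integral UNIV (\<lambda>t. if t = 0 then 0 else E M (bpath \<theta> t) * (u (bpath \<theta> t) * bpath' \<theta> t)))
        \<longlonglongrightarrow> integral UNIV (\<lambda>t. if t = 0 then 0 else u (bpath \<theta> t) * bpath' \<theta> t)"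
    and Eint: "\<And>M. integral UNIV (\<lambda>t. if t = 0 then 0 else E M (bpath \<theta> t) * (u (bpath \<theta> t) * bpath' \<theta> t))
        = cint \<theta> (\<lambda>z. (\<Sum>k<2 * M. 1 * (hfun (h M k) z * (hfun (h M k) z * (phi n z * bump (z / of_real (h M k)))))) * l (R z (V z)))"
    proof -
      show 1: "integral UNIV (\<lambda>t. if t = 0 then 0 else E M (bpath \<theta> t) * (u (bpath \<theta> t) * bpath' \<theta> t))
        = cint \<theta> (\<lambda>z. (\<Sum>k<2 * M. 1 * (hfun (h M k) z * (hfun (h M k) z * (phi n z * bump (z / of_real (h M k)))))) * l (R z (V z)))" for M
        unfolding cint_def
        by (rule integral_spike[of "{0}"]) (use Eb[OF ba] in \<open>simp_all add: u_def\<close>)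
      have dS: "decay1 \<rho> (\<lambda>z. \<Sum>k<2 * M. 1 * (hfun (h M k) z * (hfun (h M k) z * (phi n z * bump (z / of_real (h M k))))))" for M
        by (intro decay1_sum decay1_cmult dE h)
      have int: "(\<lambda>t. if t = 0 then 0 else E M (bpath \<theta> t) * (u (bpath \<theta> t) * bpath' \<theta> t)) integrable_on UNIV" for M
      proof -
        have "(\<lambda>t. (\<Sum>k<2 * M. 1 * (hfun (h M k) (bpath \<theta> t) * (hfun (h M k) (bpath \<theta> t) * (phi n (bpath \<theta> t) * bump (bpath \<theta> t / of_real (h M k))))))
            * l (R (bpath \<theta> t) (V (bpath \<theta> t))) * bpath' \<theta> t) integrable_on UNIV"
          by (rule contour_fun_I[OF \<theta>'(1) \<theta>(2) \<theta>'(4) dS V l(1)]) (rule contour_fun.integrable)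
        then show ?thesis
          by (rule integrable_spike_finite[of "{0}", rotated 2])
            (use Eb[OF ba] in \<open>simp_all add: u_def\<close>)
      qed
      show "(\<lambda>M. integral UNIV (\<lambda>t. if t = 0 then 0 else E M (bpath \<theta> t) * (u (bpath \<theta> t) * bpath' \<theta> t)))
        \<longlonglongrightarrow> integral UNIV (\<lambda>t. if t = 0 then 0 else u (bpath \<theta> t) * bpath' \<theta> t)"
      proof (rule dominated_convergence(2)[OF int integrable_const_over_1_plus_square[of "(2 * Cb) * B"]])
        fix M t
        have B0: "0 \<le> B" using order_trans[OF norm_ge_zero u.norm_le[of 1]] by simp
        show "norm (if t = 0 then 0 else E M (bpath \<theta> t) * (u (bpath \<theta> t) * bpath' \<theta> t)) \<le> (2 * Cb) * B / (1 + t\<^sup>2)"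
        proof (cases "t = 0")
          case False
          have "2 ^ M * bpath \<theta> t \<in> sector \<rho>" "bpath \<theta> t / 2 ^ M \<in> sector \<rho>"
            using sector_scale[OF _ ba[OF False], of "1 / 2 ^ M"] sector_scale[OF _ ba[OF False], of "2 ^ M"]
            by (simp_all add: mult.commute)
          then have "cmod (E M (bpath \<theta> t)) \<le> 2 * Cb"
            unfolding E_def using Cb(2)[of "2 ^ M * bpath \<theta> t"] Cb(2)[of "bpath \<theta> t / 2 ^ M"]
            by (intro order_trans[OF norm_triangle_ineq4]) linarith
          then have "cmod (E M (bpath \<theta> t)) * cmod (u (bpath \<theta> t) * bpath' \<theta> t) \<le> (2 * Cb) * (B / (1 + t\<^sup>2))"
            using u.norm_le[OF False] Cb(1) by (intro mult_mono) auto
          then show ?thesis using False by (simp add: norm_mult)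
        qed (use B0 Cb in simp)
        show "(\<lambda>M. if t = 0 then 0 else E M (bpath \<theta> t) * (u (bpath \<theta> t) * bpath' \<theta> t))
            \<longlonglongrightarrow> (if t = 0 then 0 else u (bpath \<theta> t) * bpath' \<theta> t)"
        proof (cases "t = 0")
          case False
          have "(\<lambda>M. E M (bpath \<theta> t)) \<longlonglongrightarrow> 1" unfolding E_def using False by (intro step_telescope_tendsto) simp
          from tendsto_mult_right[OF this, of "u (bpath \<theta> t) * bpath' \<theta> t"] show ?thesis using False by simp
        qed simp
      qed
    qed
    have main: "cmod (cint \<theta> (\<lambda>z. (\<Sum>k<2 * M. 1 * (hfun (h M k) z * (hfun (h M k) z * (phi n z * bump (z / of_real (h M k)))))) * l (R z (V z))))
        \<le> C * norm x * (2 * pi)" for M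
    proof -
      \<comment> \<open>Both \<open>H\<close> have left the integral and act inside the functional,
        so that only \<open>phi n\<close> and \<open>bump\<close> remain as scalar weights in the
        \<open>k\<close>-th integral.\<close>
      define w where "w = (\<lambda>k z. phi n z * bump (z / of_real (h M k)) * l (H (h M k) (H (h M k) (R z (V z)))))"
      have l2: "dual_elem (\<lambda>y. l (H (h M k) (H (h M k) y)))" for k
        by (rule dual_elem_comp[OF dual_elem_comp[OF l(1) H_lin[OF h]] H_lin[OF h]])
      have cf: "\<exists>B. contour_fun (sector \<rho> \<inter> cosector \<alpha>) (w k) B \<theta>" for k
        unfolding w_def using contour_fun_I[OF \<theta>'(1) \<theta>(2) \<theta>'(4) dpb[OF h] V l2] by metis
      \<comment> \<open>After the substitution by \<open>h M k\<close> the weight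
        \<open>bump\<close> is evaluated at \<open>bpath \<theta> t\<close> for every
        \<open>k\<close>. For fixed \<open>t\<close> its bound comes out of the sum over
        \<open>k\<close> and supplies the integrable majorant.\<close>
      define W where "W = (\<lambda>k t. of_real (h M k) * (w k (of_real (h M k) * bpath \<theta> t) * bpath' \<theta> t))"
      have Wi: "(\<lambda>t. if t = 0 then 0 else W k t) integrable_on UNIV" and Wc: "cint \<theta> (w k) = integral UNIV (\<lambda>t. if t = 0 then 0 else W k t)" for k
      proof -
        obtain B where "contour_fun (sector \<rho> \<inter> cosector \<alpha>) (w k) B \<theta>" using cf by blast
        then interpret contour_fun "sector \<rho> \<inter> cosector \<alpha>" "w k" B \<theta> .
        have "W k integrable_on UNIV"
          unfolding W_def by (rule integrable_on_mult_right[OF cint_scale(2)[OF h]])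
        then show "(\<lambda>t. if t = 0 then 0 else W k t) integrable_on UNIV"
          by (rule integrable_spike_finite[of "{0}", rotated 2]) auto
        have "cint \<theta> (w k) = integral UNIV (W k)"
          unfolding cint_scale(1)[OF h[of M k]] W_def by (rule integral_mult_right[symmetric])
        also have "\<dots> = integral UNIV (\<lambda>t. if t = 0 then 0 else W k t)" by (rule integral_spike[of "{0}"]) auto
        finally show "cint \<theta> (w k) = integral UNIV (\<lambda>t. if t = 0 then 0 else W k t)" .
      qed
      define c where "c = 1 / (2 * pi * \<i>)"
      have c0: "c \<noteq> 0" by (simp add: c_def)
      have "c * cint \<theta> (\<lambda>z. (\<Sum>k<2 * M. 1 * (hfun (h M k) z * (hfun (h M k) z * (phi n z * bump (z / of_real (h M k)))))) * l (R z (V z)))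
         = l (I \<theta> (\<lambda>z. \<Sum>k<2 * M. 1 * (hfun (h M k) z * (hfun (h M k) z * (phi n z * bump (z / of_real (h M k)))))) V)"
        unfolding c_def by (rule dual_I[OF \<theta>'(1) \<theta>(2) \<theta>'(4) _ V l(1), symmetric]) (intro decay1_sum decay1_cmult dE h)
      also have "\<dots> = l (\<Sum>k<2 * M. 1 *\<^sub>C I \<theta> (\<lambda>z. hfun (h M k) z * (hfun (h M k) z * (phi n z * bump (z / of_real (h M k))))) V)"
        by (rule arg_cong[where f = l]) (rule I_sum[OF \<theta>'(1) \<theta>(2) \<theta>'(4) V dE[OF h]])
      also have "\<dots> = (\<Sum>k<2 * M. l (H (h M k) (H (h M k) (I \<theta> (\<lambda>z. phi n z * bump (z / of_real (h M k))) V))))"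
      proof -
        have "I \<theta> (\<lambda>z. hfun (h M k) z * (hfun (h M k) z * (phi n z * bump (z / of_real (h M k))))) V
          = H (h M k) (H (h M k) (I \<theta> (\<lambda>z. phi n z * bump (z / of_real (h M k))) V))" for k
          by (simp only: I_H[OF \<theta>'(1) \<theta>(2,3) dpb[OF h] V h] I_H[OF \<theta>'(1) \<theta>(2,3) d1[OF h] V h])
        then show ?thesis by (simp add: dual_elem_sum[OF l(1)])
      qed
      also have "\<dots> = (\<Sum>k<2 * M. c * cint \<theta> (w k))"
        unfolding dual_I[OF \<theta>'(1) \<theta>(2) \<theta>'(4) dpb[OF h] V l2] c_def w_def ..
      also have "\<dots> = c * (\<Sum>k<2 * M. cint \<theta> (w k))" by (simp add: sum_distrib_left)
      finally have "cint \<theta> (\<lambda>z. (\<Sum>k<2 * M. 1 * (hfun (h M k) z * (hfun (h M k) z * (phi n z * bump (z / of_real (h M k)))))) * l (R z (V z)))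
         = (\<Sum>k<2 * M. cint \<theta> (w k))" using c0 by simp
      also have "\<dots> = integral UNIV (\<lambda>t. \<Sum>k<2 * M. if t = 0 then 0 else W k t)"
        unfolding Wc by (rule Henstock_Kurzweil_Integration.integral_sum[symmetric]) (auto intro: Wi)
      also have "cmod \<dots> \<le> integral UNIV (\<lambda>t. (C * norm x * 2) / (1 + t\<^sup>2))"
      proof (rule integral_norm_bound_integral[OF integrable_sum integrable_const_over_1_plus_square])
        fix t :: real
        show "norm (\<Sum>k<2 * M. if t = 0 then 0 else W k t) \<le> (C * norm x * 2) / (1 + t\<^sup>2)"
        proof (cases "t = 0")
          case True
          then show ?thesis using Cp Cb CU Q(2) by (simp add: C_def)
        next
          case False
          define \<mu> where "\<mu> = (\<lambda>k. of_real (h M k) * bpath \<theta> t)"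
          have \<mu>: "\<mu> k \<in> sector \<rho>" "\<mu> k \<noteq> 0" "\<bar>Arg (\<mu> k)\<bar> = \<theta>" for k
          proof -
            show a: "\<mu> k \<noteq> 0" "\<bar>Arg (\<mu> k)\<bar> = \<theta>"
              using h[of M k] False abs_Arg_bpath[OF False \<theta>'(6,3)] by (simp_all add: \<mu>_def)
            then show "\<mu> k \<in> sector \<rho>" using \<theta>(2) by (simp add: sector_def)
          qed
          have "cmod (\<Sum>k<2 * M. W k t) \<le> (\<Sum>k<2 * M. (Cp * Cb / (1 + t\<^sup>2)) * cmod (l (H (h M k) (H (h M k) (\<mu> k *\<^sub>C R (\<mu> k) (V (\<mu> k)))))))"
          proof (rule sum_norm_le)
            fix k
            define y where "y = l (H (h M k) (H (h M k) (R (\<mu> k) (V (\<mu> k)))))"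
            have y: "l (H (h M k) (H (h M k) (\<mu> k *\<^sub>C R (\<mu> k) (V (\<mu> k))))) = \<mu> k * y"
              by (simp add: y_def dual_elemD[OF l(1)] bounded_clinear_opD[OF H_lin[OF h]])
            \<comment> \<open>The Jacobian \<open>h M k\<close> and the factor \<open>|t|\<close> in
              the bound on \<open>bump\<close> combine to \<open>|\<mu> k|\<close>, the scalar that
              \<open>U_pointwise\<close> attaches to the resolvent.\<close>
            have "norm (W k t) = h M k * (cmod (phi n (\<mu> k)) * cmod (bump (bpath \<theta> t)) * cmod y)"
              using h[of M k] by (simp add: W_def w_def \<mu>_def[symmetric] y_def norm_mult) (simp add: \<mu>_def)
            also have "\<dots> \<le> h M k * (Cp * (Cb * (\<bar>t\<bar> / (1 + t\<^sup>2))) * cmod y)"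
            proof (intro mult_left_mono mult_right_mono mult_mono)
              show "cmod (phi n (\<mu> k)) \<le> Cp" by (rule Cp(2)[OF n \<mu>(1)])
              show "cmod (bump (bpath \<theta> t)) \<le> Cb * (\<bar>t\<bar> / (1 + t\<^sup>2))" using Cb(3)[OF ba[OF False]] by simp
            qed (use h[of M k] Cp in auto)
            also have "\<dots> = (Cp * Cb / (1 + t\<^sup>2)) * cmod (\<mu> k * y)"
              using h[of M k] by (simp add: \<mu>_def norm_mult)
            finally show "norm (W k t) \<le> (Cp * Cb / (1 + t\<^sup>2)) * cmod (l (H (h M k) (H (h M k) (\<mu> k *\<^sub>C R (\<mu> k) (V (\<mu> k))))))"
              unfolding y .
          qed
          also have "\<dots> = (Cp * Cb / (1 + t\<^sup>2)) * (\<Sum>k<2 * M. cmod (l (H (h M k) (H (h M k) (\<mu> k *\<^sub>C R (\<mu> k) (Q n (T (\<mu> k) x)))))))"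
            by (simp only: sum_distrib_left V_def)
          also have "\<dots> \<le> (Cp * Cb / (1 + t\<^sup>2)) * (CU * q * norm x)"
          proof (rule mult_left_mono)
            have hk: "h M k = (1 / 2 ^ M) * 2 ^ k" for k by (simp add: h_def)
            show "(\<Sum>k<2 * M. cmod (l (H (h M k) (H (h M k) (\<mu> k *\<^sub>C R (\<mu> k) (Q n (T (\<mu> k) x))))))) \<le> CU * q * norm x"
              unfolding hk
              by (rule CU(2)[where T' = "\<lambda>k. T (\<mu> k)" and Q = "Q n", OF Q(1)[OF n] Q(2) Q(3)[OF n] Q(4)[OF n] _ QT(1)[OF n \<mu>(1)] QT(2)[OF n \<mu>(1)] _ l])
                (use \<mu> in auto)
          qed (use Cp Cb in \<open>auto intro!: divide_nonneg_nonneg\<close>)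
          also have "\<dots> = C * norm x / (1 + t\<^sup>2)" by (simp add: C_def)
          also have "\<dots> \<le> C * norm x * 2 / (1 + t\<^sup>2)"
            using Cp Cb CU Q(2) by (intro divide_right_mono) (auto simp: C_def)
          finally show ?thesis using False by simp
        qed
      qed (auto intro: Wi)
      also have "\<dots> = C * norm x * (2 * pi)"
        using integral_unique[OF has_integral_mult_right[OF has_integral_arctan, of "C * norm x * 2"]] by simp
      finally show ?thesis .
    qed
    have "cmod (integral UNIV (\<lambda>t. if t = 0 then 0 else u (bpath \<theta> t) * bpath' \<theta> t)) \<le> C * norm x * (2 * pi)"
      by (rule tendsto_upperbound[OF tendsto_norm[OF lim]]) (simp_all only: Eint main eventually_True trivial_limit_sequentially not_False_eq_True)
    moreover have "integral UNIV (\<lambda>t. if t = 0 then 0 else u (bpath \<theta> t) * bpath' \<theta> t) = cint \<theta> u"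
      unfolding cint_def by (rule integral_spike[of "{0}"]) auto
    ultimately have "cmod (cint \<theta> u) \<le> C * norm x * (2 * pi)" by simp
    moreover have "l (I \<theta> (phi n) V) = 1 / (2 * pi * \<i>) * cint \<theta> u"
      unfolding u_def by (rule dual_I[OF \<theta>'(1) \<theta>(2) \<theta>'(4) Cp(3)[OF n] V l(1)])
    ultimately have "cmod (l (I \<theta> (phi n) V)) \<le> 1 / (2 * pi) * (C * norm x * (2 * pi))"
      by (simp only: norm_mult) (intro mult_mono; simp add: norm_divide norm_mult)
    then show "cmod (l (I \<theta> (phi n) (\<lambda>w. Q n (T w x)))) \<le> C * norm x" by (simp add: V_def)
  qed
  then show ?thesis using that by blast
qed

end

subsection \<open>Sectorial operators\<close>

lemma is_resolvent_unique:
  assumes "is_resolvent D A z R" "is_resolvent D A z S"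
  shows "R = S"
proof
  fix x
  have "z *\<^sub>C S x - A (S x) = x" "S x \<in> D" using assms(2) by (auto simp: is_resolvent_def)
  moreover from this have "R (z *\<^sub>C S x - A (S x)) = S x" using assms(1) unfolding is_resolvent_def by blast
  ultimately have "R x = S x" by (simp only:)
  then show "R x = S x" .
qed

lemma is_resolvent_resolvent: "in_resolvent_set D A z \<Longrightarrow> is_resolvent D A z (resolvent D A z)"
  unfolding in_resolvent_set_def resolvent_def
  by (metis is_resolvent_unique theI)

text \<open>The infimum need not itself be a type of the operator, but every larger angle has a type
  below it; sectoriality is used in this form.\<close>

lemma sect_angle_bounds:
  assumes "sectorial D A"
  shows "0 \<le> sect_angle D A" "sect_angle D A < pi"
    "\<And>\<alpha>. sect_angle D A < \<alpha> \<Longrightarrow> \<exists>w<\<alpha>. sectorial_of_type D A w"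
proof -
  have ne: "{w. sectorial_of_type D A w} \<noteq> {}" using assms by (auto simp: sectorial_def)
  have bdd: "bdd_below {w. sectorial_of_type D A w}" by (rule bdd_belowI[of _ 0]) (auto simp: sectorial_of_type_def)
  show "0 \<le> sect_angle D A"
    unfolding sect_angle_def by (rule cInf_greatest[OF ne]) (auto simp: sectorial_of_type_def)
  obtain w where w: "sectorial_of_type D A w" using assms by (auto simp: sectorial_def)
  then have "sect_angle D A \<le> w" unfolding sect_angle_def by (intro cInf_lower bdd) auto
  then show "sect_angle D A < pi" using w by (auto simp: sectorial_of_type_def)
  show "\<exists>w<\<alpha>. sectorial_of_type D A w" if "sect_angle D A < \<alpha>" for \<alpha>
    using cInf_lessD[OF ne, of \<alpha>] that by (auto simp: sect_angle_def)
qed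

text \<open>A type below \<alpha> provides the resolvent and its bound at all angles beyond
  \<alpha>. The resolvent identity follows by applying \<open>R z\<close> to
  \<open>(u - A) y\<close> and to \<open>(z - A) y\<close> for \<open>y = R u x\<close> and
  subtracting.\<close>

lemma sectorial_resolvent_family:
  assumes "sectorial D A" "sect_angle D A < \<alpha>" "\<alpha> < pi"
  obtains K where "resolvent_family (resolvent D A) \<alpha> K" "\<And>z. z \<in> cosector \<alpha> \<Longrightarrow> in_resolvent_set D A z"
    "closure D = UNIV" "closure (A ` D) = UNIV"
    "\<And>z x. z \<in> cosector \<alpha> \<Longrightarrow> x \<in> D \<Longrightarrow> resolvent D A z (z *\<^sub>C x - A x) = x"
proof -
  obtain w where w: "w < \<alpha>" "sectorial_of_type D A w" using sect_angle_bounds(3)[OF assms(1,2)] by blast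
  have in_res: "in_resolvent_set D A z" if "z \<in> cosector \<alpha>" for z
    using that w by (auto simp: sectorial_of_type_def cosector_def)
  note res = is_resolvent_resolvent[OF in_res]
  have inv: "resolvent D A z (z *\<^sub>C x - A x) = x" if "z \<in> cosector \<alpha>" "x \<in> D" for z x
    using res[OF that(1)] that(2) by (auto simp: is_resolvent_def)
  have D: "resolvent D A z x \<in> D" and eq: "z *\<^sub>C resolvent D A z x - A (resolvent D A z x) = x"
    and lin: "bounded_clinear_op (resolvent D A z)" if "z \<in> cosector \<alpha>" for z x
    using res[OF that] by (auto simp: is_resolvent_def)
  obtain C where C: "\<And>z x. z \<noteq> 0 \<Longrightarrow> \<alpha> \<le> \<bar>Arg z\<bar> \<Longrightarrow> norm (z *\<^sub>C resolvent D A z x) \<le> C * norm x"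
    using w assms(3) unfolding sectorial_of_type_def by meson
  have "resolvent_family (resolvent D A) \<alpha> \<bar>C\<bar>"
  proof
    show "0 \<le> \<alpha>" using assms sect_angle_bounds(1)[OF assms(1)] by linarith
    show "resolvent D A z x - resolvent D A u x = (u - z) *\<^sub>C resolvent D A z (resolvent D A u x)"
      if z: "z \<in> cosector \<alpha>" and u: "u \<in> cosector \<alpha>" for z u x
    proof -
      note R = bounded_clinear_opD[OF lin[OF z]]
      define y where "y = resolvent D A u x"
      have "resolvent D A z x = resolvent D A z (u *\<^sub>C y - A y)" using eq[OF u, of x] by (simp add: y_def)
      moreover have "y = resolvent D A z (z *\<^sub>C y - A y)" using inv[OF z D[OF u]] by (simp add: y_def)
      ultimately have "resolvent D A z x - y = resolvent D A z ((u *\<^sub>C y - A y) - (z *\<^sub>C y - A y))" by (metis R(4))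
      also have "(u *\<^sub>C y - A y) - (z *\<^sub>C y - A y) = (u - z) *\<^sub>C y" by (simp add: scaleC.scale_left_diff_distrib)
      finally show ?thesis by (simp add: R y_def)
    qed
    show "norm (resolvent D A z x) \<le> \<bar>C\<bar> / cmod z * norm x" if z: "z \<in> cosector \<alpha>" for z x
    proof -
      have z': "z \<noteq> 0" "\<alpha> \<le> \<bar>Arg z\<bar>" using z by (auto simp: cosector_def)
      have "cmod z * norm (resolvent D A z x) \<le> C * norm x" using C[OF z', of x] by (simp add: norm_scaleC)
      also have "\<dots> \<le> \<bar>C\<bar> * norm x" by (intro mult_right_mono) auto
      finally show ?thesis using z' by (simp add: field_simps)
    qed
  qed (use assms lin in auto)
  then show ?thesis
    using that in_res inv w(2) unfolding sectorial_of_type_def densely_defined_def by blast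
qed

theorem theorem4p5:
  fixes DA DB :: "'a::complex_banach set" and A B :: "'a \<Rightarrow> 'a"
    and f :: "complex \<Rightarrow> complex \<Rightarrow> complex" and \<sigma> \<sigma>' \<rho> :: real
  assumes "sectorial DA A" and "sectorial DB B"
    and "commuting DA A DB B"
    and "Hinf_calculus DA A \<sigma>"
    and "sect_angle DB B < \<sigma>'"
    and "\<sigma> < \<rho>" and "\<rho> < pi"
    and "Hinf2 \<rho> \<sigma>' f"
    and "\<forall>w\<in>sector \<rho>. in_H DB B \<sigma>' (f w)"
    and "U_bounded {fcH DB B \<sigma>' (f w) | w. w \<in> sector \<rho>}"
  shows "in_H2 DA A DB B \<rho> \<sigma>' f"
proof -
  define \<omega> \<omega>' where "\<omega> = sect_angle DA A" and "\<omega>' = sect_angle DB B"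
  have \<omega>: "0 \<le> \<omega>" "\<omega> < \<sigma>" using sect_angle_bounds[OF assms(1)] assms(4) by (auto simp: \<omega>_def Hinf_calculus_def)
  have \<omega>': "0 \<le> \<omega>'" "\<omega>' < min \<sigma>' pi" using sect_angle_bounds[OF assms(2)] assms(5) by (auto simp: \<omega>'_def)
  \<comment> \<open>These two angles are prescribed by \<open>fc\<close> and \<open>fc2\<close>. The
    other two are chosen: \<alpha> lies below both, so that resolvents are controlled around either
    contour, and \<theta> lies above \<sigma> and \<nu> but still below \<rho>.\<close>
  define \<eta> \<nu> where "\<eta> = mid_angle \<omega> \<sigma>" and "\<nu> = mid_angle \<omega> \<rho>"
  define \<alpha> \<theta> where "\<alpha> = (\<omega> + \<eta>) / 2" and "\<theta> = (max \<nu> \<sigma> + \<rho>) / 2"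
  have \<eta>\<nu>: "\<eta> = (\<omega> + \<sigma>) / 2" "\<nu> = (\<omega> + \<rho>) / 2"
    using assms(6,7) by (simp_all add: \<eta>_def \<nu>_def mid_angle_def)
  have max: "max \<nu> \<sigma> < \<rho>" "\<nu> \<le> max \<nu> \<sigma>" "\<sigma> \<le> max \<nu> \<sigma>"
    using assms(6) \<omega> \<eta>\<nu> by auto
  have a: "\<omega> < \<alpha>" "\<alpha> < \<eta>" "\<eta> < \<sigma>" "\<sigma> < pi" "\<sigma> < \<theta>" "\<theta> < \<rho>" "\<alpha> < \<nu>" "\<nu> \<le> \<theta>" "\<alpha> < pi" "\<nu> < \<rho>" "\<rho> \<le> pi"
  proof -
    show a1: "\<omega> < \<alpha>" "\<alpha> < \<eta>" "\<eta> < \<sigma>" "\<sigma> < pi" using \<eta>\<nu>(1) \<omega> assms(6,7) by (simp_all add: \<alpha>_def)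
    show "\<sigma> < \<theta>" "\<theta> < \<rho>" "\<nu> \<le> \<theta>" using max assms(6) by (simp_all add: \<theta>_def)
    show "\<nu> < \<rho>" "\<rho> \<le> pi" using max assms(7) by simp_all
    show "\<alpha> < \<nu>" "\<alpha> < pi" using a1 \<eta>\<nu> assms(6) by simp_all
  qed
  define \<nu>' where "\<nu>' = mid_angle \<omega>' \<sigma>'"
  \<comment> \<open>For \<open>B\<close> the sector is shrunk to the angle \<open>\<rho>'\<close>,
    strictly below both \<open>\<sigma>'\<close> and pi, because \<open>\<sigma>'\<close> may be
    larger than pi while the contour lemmas need a proper sector.\<close>
  define \<beta> \<rho>' where "\<beta> = (\<omega>' + \<nu>') / 2" and "\<rho>' = (\<nu>' + min \<sigma>' pi) / 2"
  have b: "\<omega>' < \<beta>" "\<beta> < \<nu>'" "\<nu>' < \<rho>'" "\<rho>' < min \<sigma>' pi"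
  proof -
    have mid: "x < (x + y) / 2" "(x + y) / 2 < y" if "x < y" for x y :: real using that by simp_all
    have n: "\<nu>' = (\<omega>' + min \<sigma>' pi) / 2" by (simp only: \<nu>'_def mid_angle_def)
    have n1: "\<omega>' < \<nu>'" "\<nu>' < min \<sigma>' pi" unfolding n by (intro mid \<omega>'(2))+
    show "\<omega>' < \<beta>" "\<beta> < \<nu>'" "\<nu>' < \<rho>'" "\<rho>' < min \<sigma>' pi"
      unfolding \<beta>_def \<rho>'_def by (intro mid n1)+
  qed
  then have b': "\<rho>' < pi" "\<rho>' \<le> pi" "\<rho>' \<le> \<sigma>'" "\<beta> < pi" "0 \<le> \<rho>'" using \<omega>' by auto

  obtain KA where KA: "resolvent_family (resolvent DA A) \<alpha> KA" "\<And>z. z \<in> cosector \<alpha> \<Longrightarrow> in_resolvent_set DA A z"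
    using sectorial_resolvent_family[OF assms(1) a(1)[unfolded \<omega>_def] a(9)] by metis
  obtain KB where KB: "resolvent_family (resolvent DB B) \<beta> KB" "\<And>z. z \<in> cosector \<beta> \<Longrightarrow> in_resolvent_set DB B z"
    and dense: "closure DB = UNIV" "closure (B ` DB) = UNIV"
    and inv: "\<And>z x. z \<in> cosector \<beta> \<Longrightarrow> x \<in> DB \<Longrightarrow> resolvent DB B z (z *\<^sub>C x - B x) = x"
    using sectorial_resolvent_family[OF assms(2) b(1)[unfolded \<omega>'_def] b'(4)] by metis
  interpret A: resolvent_family "resolvent DA A" \<alpha> KA by (rule KA)
  interpret B: resolvent_family "resolvent DB B" \<beta> KB by (rule KB)
  have comm: "resolvent DA A z (resolvent DB B w x) = resolvent DB B w (resolvent DA A z x)"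
    if "z \<in> cosector \<alpha>" "w \<in> cosector \<beta>" for z w x
    using assms(3) KA(2)[OF that(1)] KB(2)[OF that(2)] unfolding commuting_def by (metis comp_apply)
  have fcB: "fc DB B \<sigma>' g x = B.I \<nu>' g (\<lambda>_. x)" for g x
    by (simp add: fc_def fc_int_def B.I_def \<nu>'_def \<omega>'_def)

  obtain CH where CH: "\<And>g x. decaying \<sigma> g \<Longrightarrow> norm (fc DA A \<sigma> g x) \<le> CH * (SUP z\<in>sector \<sigma>. cmod (g z)) * norm x"
    using assms(4) by (auto simp: Hinf_calculus_def)
  \<comment> \<open>The constant is replaced by its modulus; the supremum is nonnegative and at most
    \<open>M\<close>, the sector being nonempty as it contains \<open>1\<close>.\<close>
  interpret A: Hinf_family "resolvent DA A" \<alpha> KA \<sigma> \<eta> "\<bar>CH\<bar>"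
  proof
    fix g :: "complex \<Rightarrow> complex" and M :: real and x :: 'a
    assume g: "decay1 \<sigma> g" and M: "\<And>z. z \<in> sector \<sigma> \<Longrightarrow> cmod (g z) \<le> M"
    have one: "1 \<in> sector \<sigma>" using \<omega> by (simp add: sector_def)
    define S where "S = (SUP z\<in>sector \<sigma>. cmod (g z))"
    have "S \<le> M" unfolding S_def using one M by (intro cSUP_least) auto
    moreover have "0 \<le> S"
      unfolding S_def by (rule order_trans[OF norm_ge_zero cSUP_upper[OF one]]) (use M in \<open>auto intro!: bdd_aboveI2\<close>)
    ultimately have "CH * S \<le> \<bar>CH\<bar> * M" by (intro mult_mono) auto
    then have "CH * S * norm x \<le> \<bar>CH\<bar> * M * norm x" by (intro mult_right_mono) auto
    moreover have "A.I \<eta> g (\<lambda>_. x) = fc DA A \<sigma> g x"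
      by (simp add: fc_def fc_int_def A.I_def \<eta>_def \<omega>_def)
    ultimately show "norm (A.I \<eta> g (\<lambda>_. x)) \<le> \<bar>CH\<bar> * M * norm x"
      using CH[OF decay1_decaying[OF g], of x] unfolding S_def by simp
  qed (use a in auto)

  obtain M where M: "\<And>w z. w \<in> sector \<rho> \<Longrightarrow> z \<in> sector \<sigma>' \<Longrightarrow> cmod (f w z) \<le> M" using assms(8) unfolding Hinf2_def by blast
  have sub: "sector \<rho>' \<subseteq> sector \<sigma>'" using b'(3) by (rule sector_mono)
  have fz: "f w holomorphic_on sector \<rho>'" if "w \<in> sector \<rho>" for w
    using assms(8) that sub by (auto simp: Hinf2_def intro: holomorphic_on_subset)
  have fw: "(\<lambda>w. f w z) holomorphic_on sector \<rho>" if "z \<in> sector \<rho>'" for z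
    using assms(8) that sub by (auto simp: Hinf2_def)
  have fM: "cmod (f w z) \<le> M" if "w \<in> sector \<rho>" "z \<in> sector \<rho>'" for w z using M that sub by auto
  have dphi: "decay1 \<rho>' (phi n)" if "n \<ge> 1" for n using phi_bounds[OF b'(5,1)] that by metis
  have dphif: "decay1 \<rho>' (\<lambda>z. phi n z * f w z)" if "n \<ge> 1" "w \<in> sector \<rho>" for n w
    using decay1_mult_bounded[OF dphi[OF that(1)] fz[OF that(2)] fM[OF that(2)]] by (simp add: mult.commute)

  define T where "T = (\<lambda>w. fcH DB B \<sigma>' (f w))"
  \<comment> \<open>Membership in \<open>in_H\<close> supplies the bound that makes the limit
    defining \<open>fcH\<close> exist. Linearity, commutation and analyticity in \<open>w\<close>
    are then read off from the contour integral on the right.\<close>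
  have PT: "B.P n (T w x) = B.I \<nu>' (\<lambda>z. phi n z * f w z) (\<lambda>_. x)" if n: "n \<ge> 1" and w: "w \<in> sector \<rho>" for n w x
  proof -
    obtain C where C: "\<And>n x. n \<ge> 1 \<Longrightarrow> norm (B.I \<nu>' (\<lambda>z. phi n z * f w z) (\<lambda>_. x)) \<le> C * norm x"
      using assms(9) w unfolding in_H_def fcB by blast
    show ?thesis
      unfolding T_def fcH_def fcB
      by (rule B.regularized_limit[OF b(2,3) b'(1) fz[OF w] fM[OF w] B.P_tendsto[OF dense inv] C n])
  qed
  have PTlin: "bounded_clinear_op (\<lambda>y. B.P n (T w y))" if "n \<ge> 1" "w \<in> sector \<rho>" for n w
    unfolding PT[OF that] by (rule B.I_const_lin[OF b(2,3) b'(2) dphif[OF that]])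
  have PTcomm: "B.P n (T w (resolvent DA A z y)) = resolvent DA A z (B.P n (T w y))"
    if "n \<ge> 1" "w \<in> sector \<rho>" "z \<in> cosector \<alpha>" for n w z y
    unfolding PT[OF that(1,2)]
    by (rule B.I_compose[OF b(2,3) b'(2) dphif[OF that(1,2)] bdd_analytic_const A.R_lin[OF that(3)] comm[OF that(3)], symmetric])
  \<comment> \<open>Analyticity in \<open>w\<close> is established for the regularized vectors; it
    is what allows the contour of \<open>A\<close> to be moved.\<close>
  have PTan: "bdd_analytic (sector \<rho>) (\<lambda>w. B.P n (T w x))" if "n \<ge> 1" for n x
    by (rule bdd_analytic_cong[OF B.I_param_analytic[OF b(2,3) b'(2) dphi[OF that] open_sector[OF a(11)] fz fw fM]])
      (simp_all add: PT[OF that])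
  have Pcomm: "B.P n (resolvent DA A z y) = resolvent DA A z (B.P n y)" if "n \<ge> 1" "z \<in> cosector \<alpha>" for n z y
  proof -
    have "- of_real s \<in> cosector \<beta>" if "s > 0" for s :: real using minus_real_in_cosector[OF that b'(4)] .
    then have "B.J s (resolvent DA A z y) = resolvent DA A z (B.J s y)" if "s > 0" for s
      using comm[OF \<open>z \<in> cosector \<alpha>\<close>] that by (simp add: B.J_def bounded_clinear_opD[OF A.R_lin[OF \<open>z \<in> cosector \<alpha>\<close>]])
    then show ?thesis using that by (simp add: B.P_def bounded_clinear_opD[OF A.R_lin[OF that(2)]])
  qed
  have "U_bounded (T ` sector \<rho>)" using assms(10) by (simp add: T_def Setcompr_eq_image)
  then obtain C where C: "\<And>n x. n \<ge> 1 \<Longrightarrow> norm (A.I \<theta> (phi n) (\<lambda>w. B.P n (T w x))) \<le> C * norm x"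
    by (rule A.U_estimate[where T = T and Q = B.P and q = "2 * KB", OF a(5,6) assms(7) _ B.P_lin _ B.norm_P Pcomm PTlin PTcomm PTan])
      (use B.K in auto)

  have "norm (fc2 DA A DB B \<rho> \<sigma>' (\<lambda>w z. phi n w * phi n z * f w z) x) \<le> C * norm x" if n: "n \<ge> 1" for n x
  proof -
    have dphiA: "decay1 \<rho> (phi n)" using phi_bounds[of \<rho>] assms(6,7) \<omega> n by (metis less_le_trans less_imp_le order_le_less_trans)
    define V where "V = (\<lambda>w. B.P n (T w x))"
    define c where "c = 1 / (2 * pi * \<i>)"
    have c0: "c \<noteq> 0" by (simp add: c_def)
    let ?in = "\<lambda>s t. (phi n (bpath \<nu> s) * phi n (bpath \<nu>' t) * f (bpath \<nu> s) (bpath \<nu>' t) * bpath' \<nu> s * bpath' \<nu>' t) *\<^sub>C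
          resolvent DA A (bpath \<nu> s) (resolvent DB B (bpath \<nu>' t) x)"
    let ?out = "\<lambda>s. (phi n (bpath \<nu> s) * bpath' \<nu> s) *\<^sub>C resolvent DA A (bpath \<nu> s) (V (bpath \<nu> s))"
    \<comment> \<open>For fixed \<open>s\<close> the resolvent of \<open>A\<close> is a bounded
      operator and comes out of the integral over the contour of \<open>B\<close>; what remains
      there, with one of the two constants \<open>c\<close>, is the regularized
      \<open>f(w, B) x\<close>.\<close>
    have inner: "c *\<^sub>C integral UNIV (?in s) = ?out s" if s: "s \<noteq> 0" for s
    proof -
      have w: "bpath \<nu> s \<in> sector \<rho>" "bpath \<nu> s \<in> cosector \<alpha>" using A.bpath_mem[OF a(7,10,11) s] by auto
      let ?k = "\<lambda>t. (phi n (bpath \<nu>' t) * f (bpath \<nu> s) (bpath \<nu>' t) * bpath' \<nu>' t) *\<^sub>C resolvent DB B (bpath \<nu>' t) x"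
      let ?L = "\<lambda>y. (phi n (bpath \<nu> s) * bpath' \<nu> s) *\<^sub>C resolvent DA A (bpath \<nu> s) y"
      note R = bounded_clinear_opD[OF A.R_lin[OF w(2)]]
      have L: "bounded_linear ?L" by (rule bounded_linear_compose[OF scaleC.bounded_linear_right R(1)])
      have int: "?k integrable_on UNIV"
        using B.I_integrable[OF b(2,3) b'(2) dphif[OF n w(1)] bdd_analytic_const, of x] .
      have "integral UNIV (?in s) = integral UNIV (?L \<circ> ?k)" by (simp add: o_def R mult_ac)
      also have "\<dots> = ?L (integral UNIV ?k)" by (rule integral_linear[OF int L])
      finally have "c *\<^sub>C integral UNIV (?in s) = ?L (c *\<^sub>C integral UNIV ?k)" by (simp add: R mult_ac)
      also have "c *\<^sub>C integral UNIV ?k = V (bpath \<nu> s)"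
        by (simp add: V_def PT[OF n w(1)] B.I_def c_def)
      finally show ?thesis .
    qed
    have outint: "?out integrable_on UNIV"
      using A.I_integrable[OF a(7,10,11) dphiA PTan[OF n, of x]] by (simp add: V_def)
    have "fc2 DA A DB B \<rho> \<sigma>' (\<lambda>w z. phi n w * phi n z * f w z) x = c\<^sup>2 *\<^sub>C integral UNIV (\<lambda>s. integral UNIV (?in s))"
      by (simp add: fc2_def fc2_int_def c_def \<nu>_def \<nu>'_def \<omega>_def \<omega>'_def)
    \<comment> \<open>One of the two factors \<open>c\<close> belongs to the inner integral, hence
      the quotient \<open>1 / c\<close>; the exceptional point is the origin, which
      \<open>inner\<close> leaves out.\<close>
    also have "integral UNIV (\<lambda>s. integral UNIV (?in s)) = integral UNIV ((\<lambda>y. (1 / c) *\<^sub>C y) \<circ> ?out)"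
    proof (rule integral_spike[of "{0}"])
      fix s :: real assume "s \<in> UNIV - {0}"
      then have "?out s = c *\<^sub>C integral UNIV (?in s)" using inner by simp
      then show "((\<lambda>y. (1 / c) *\<^sub>C y) \<circ> ?out) s = integral UNIV (?in s)"
        unfolding o_def using c0 by (simp only: scaleC_scaleC) (simp add: scaleC_one)
    qed simp
    also have "\<dots> = (1 / c) *\<^sub>C integral UNIV ?out"
      by (rule integral_linear[OF outint scaleC.bounded_linear_right])
    also have "c\<^sup>2 *\<^sub>C (1 / c) *\<^sub>C integral UNIV ?out = c *\<^sub>C integral UNIV ?out"
      using c0 by (simp add: scaleC_scaleC power2_eq_square)
    also have "\<dots> = A.I \<nu> (phi n) V" by (simp add: A.I_def c_def)
    \<comment> \<open>The contour of \<open>fc2\<close> may run inside the sector of \<sigma>, so it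
      is moved out to \<theta>, where \<open>U_estimate\<close> applies.\<close>
    also have "\<dots> = A.I \<theta> (phi n) V"
      unfolding V_def by (rule A.I_rotate[OF a(7,8,6,11) dphiA PTan[OF n]])
    finally show ?thesis using C[OF n] by (simp add: V_def)
  qed
  then show ?thesis using assms(8) unfolding in_H2_def by blast
qed

end
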